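(* Let $n\in\{1,2,\dots,\infty\}$ and let $\alpha^n$ be the Clifford flow of rank $n$. Then the gauge index $\dim G(\alpha^n)$ is $0$.
   Context: An $E_0$-semigroup on a von Neumann algebra $\mathrm{M}$ is a semigroup $(\alpha_t)_{t\ge 0}$ of normal unital $*$-endomorphisms of $\mathrm{M}$ with $\alpha_0=\mathrm{id}$, $\alpha_t(\mathrm{M})\ne \mathrm{M}$ for all $t>0$, and $t\mapsto\rho(\alpha_t(x))$ continuous for all $x\in\mathrm{M}$, $\rho\in\mathrm{M}_*$. A cocycle for $\alpha$ is a strongly continuous family of unitaries $(U_t)_{t\ge0}$ in $\mathrm{M}$ with $U_s\alpha_s(U_t)=U_{s+t}$ for all $s,t\ge 0$. Gauge index: for $\alpha$ on a $\mathrm{II}_1$ factor $\mathrm{M}$ with trace $\tau$, a gauge cocycle is a cocycle $U$ with $U_t\in\mathrm{M}\cap\alpha_t(\mathrm{M})'$ for all $t\ge0$; the gauge cocycles form a group $G(\alpha)$ under $(UV)_t=U_tV_t$. For $U,V\in G(\alpha)$ there is a unique $c_*(U,V)\in\mathbb{C}$ with $\tau(U_t^*V_t)=e^{c_*(U,V)t}$ for all $t\ge0$. The form $\langle f,g\rangle=\sum_{U,V}c_*(U,V)\overline{f(U)}g(V)$ is positive semidefinite on the space of finitely supported functions $f:G(\alpha)\to\mathbb{C}$ with $\sum_Uf(U)=0$; $H(G(\alpha))$ is the Hilbert space obtained by quotienting by null vectors and completing, and $\dim G(\alpha):=\dim H(G(\alpha))$. Clifford flow: let $\mathrm{k}$ be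 a separable real Hilbert space of dimension $n$ with complexification $\mathrm{k}^{\mathbb{C}}$, and let $\Gamma_a$ be the antisymmetric Fock space over $L^2(\mathbb{R}_+;\mathrm{k}^{\mathbb{C}})$ with vacuum $\Omega$. Let $a^*(f)$ be the fermionic creation operators, $a^*(f)\Omega=f$, $a^*(f)(\xi_1\wedge\dots\wedge\xi_m)=f\wedge\xi_1\wedge\dots\wedge\xi_m$ (satisfying the canonical anticommutation relations), $a(f)=a^*(f)^*$, and $u(f)=(a(f)+a^*(f))/\sqrt2$ for $f\in L^2(\mathbb{R}_+;\mathrm{k})$. The von Neumann algebra $\mathcal{R}=\{u(f):f\in L^2(\mathbb{R}_+;\mathrm{k})\}''$ is the hyperfinite $\mathrm{II}_1$ factor, acting standardly on $\Gamma_a$ with $\Omega$ a cyclic and separating trace vector. With $(T_t)$ the unilateral shift semigroup, $(T_tf)(s)=0$ for $s<t$ and $f(s-t)$ for $s\ge t$, the Clifford flow of rank $n$ is the $E_0$-semigroup $\alpha^n$ on $\mathcal{R}$ with $\alpha^n_t(u(f_1)\cdots u(f_k))=u(T_tf_1)\cdots u(T_tf_k)$. *)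

theory Defs
  imports "HOL-Analysis.Analysis" "HOL-Combinatorics.Permutations" "HOL-Library.Extended_Nat"
begin

section \<open>Positive semidefinite forms and their Hilbert space completions\<close>

definition finsupp :: "'a set \<Rightarrow> ('a \<Rightarrow> complex) set" where
  "finsupp S = {f. finite {x. f x \<noteq> 0} \<and> {x. f x \<noteq> 0} \<subseteq> S}"

definition kernel_form ::
    "('a \<Rightarrow> 'a \<Rightarrow> complex) \<Rightarrow> ('a \<Rightarrow> complex) \<Rightarrow> ('a \<Rightarrow> complex) \<Rightarrow> complex" where
  "kernel_form K f g = (\<Sum>x | f x \<noteq> 0. \<Sum>y | g y \<noteq> 0. K x y * cnj (f x) * g y)"

text \<open>Quotienting a semi-inner product space \<open>V\<close> by its null vectors and completing is done in
  one step: the points of the resulting Hilbert space are the Cauchy sequences in \<open>V\<close> modulo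
  sequences whose seminorm tends to zero.\<close>

definition cauchy_seqs ::
    "('a \<Rightarrow> complex) set \<Rightarrow> (('a \<Rightarrow> complex) \<Rightarrow> ('a \<Rightarrow> complex) \<Rightarrow> complex) \<Rightarrow> (nat \<Rightarrow> 'a \<Rightarrow> complex) set"
  where "cauchy_seqs V B = {x. (\<forall>n. x n \<in> V) \<and>
    (\<forall>e>0. \<exists>N. \<forall>m\<ge>N. \<forall>n\<ge>N. Re (B (x m - x n) (x m - x n)) < e)}"

definition null_equiv ::
    "('a \<Rightarrow> complex) set \<Rightarrow> (('a \<Rightarrow> complex) \<Rightarrow> ('a \<Rightarrow> complex) \<Rightarrow> complex) \<Rightarrow>
     (nat \<Rightarrow> 'a \<Rightarrow> complex) \<Rightarrow> (nat \<Rightarrow> 'a \<Rightarrow> complex) \<Rightarrow> bool"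
  where "null_equiv V B x y \<longleftrightarrow> x \<in> cauchy_seqs V B \<and> y \<in> cauchy_seqs V B \<and>
    (\<lambda>n. Re (B (x n - y n) (x n - y n))) \<longlonglongrightarrow> 0"

definition hcompletion ::
    "('a \<Rightarrow> complex) set \<Rightarrow> (('a \<Rightarrow> complex) \<Rightarrow> ('a \<Rightarrow> complex) \<Rightarrow> complex) \<Rightarrow>
     (nat \<Rightarrow> 'a \<Rightarrow> complex) set set"
  where "hcompletion V B = cauchy_seqs V B // {(x, y). null_equiv V B x y}"

definition hcompletion_inner ::
    "(('a \<Rightarrow> complex) \<Rightarrow> ('a \<Rightarrow> complex) \<Rightarrow> complex) \<Rightarrow>
     (nat \<Rightarrow> 'a \<Rightarrow> complex) set \<Rightarrow> (nat \<Rightarrow> 'a \<Rightarrow> complex) set \<Rightarrow> complex"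
  where "hcompletion_inner B X Y =
    lim (\<lambda>n. B ((SOME x. x \<in> X) n) ((SOME y. y \<in> Y) n))"

text \<open>An orthonormal basis of a (real or complex) Hilbert space is a maximal orthonormal set.
  All infinite Hilbert space dimensions are identified with \<open>\<infinity>\<close>.\<close>

definition orthonormal_basis :: "'a set \<Rightarrow> ('a \<Rightarrow> 'a \<Rightarrow> 'f::zero_neq_one) \<Rightarrow> 'a set \<Rightarrow> bool" where
  "orthonormal_basis H ip B \<longleftrightarrow> B \<subseteq> H \<and>
     (\<forall>x\<in>B. \<forall>y\<in>B. ip x y = (if x = y then 1 else 0)) \<and>
     (\<forall>x\<in>H. (\<forall>b\<in>B. ip b x = 0) \<longrightarrow> ip x x = 0)"

definition hilbert_dim :: "'a set \<Rightarrow> ('a \<Rightarrow> 'a \<Rightarrow> 'f::zero_neq_one) \<Rightarrow> enat" where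
  "hilbert_dim H ip =
     (THE d. \<exists>B. orthonormal_basis H ip B \<and> d = (if finite B then enat (card B) else \<infinity>))"

locale psd_form =
  fixes V :: "('a \<Rightarrow> complex) set" and B :: "('a \<Rightarrow> complex) \<Rightarrow> ('a \<Rightarrow> complex) \<Rightarrow> complex"
  assumes V_zero: "(\<lambda>_. 0) \<in> V"
    and V_add: "f \<in> V \<Longrightarrow> g \<in> V \<Longrightarrow> (\<lambda>i. f i + g i) \<in> V"
    and V_mult: "f \<in> V \<Longrightarrow> (\<lambda>i. c * f i) \<in> V"
    and B_add: "f \<in> V \<Longrightarrow> g \<in> V \<Longrightarrow> h \<in> V \<Longrightarrow> B f (\<lambda>i. g i + h i) = B f g + B f h"
    and B_mult: "f \<in> V \<Longrightarrow> g \<in> V \<Longrightarrow> B f (\<lambda>i. c * g i) = c * B f g"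
    and B_herm: "f \<in> V \<Longrightarrow> g \<in> V \<Longrightarrow> B g f = cnj (B f g)"
    and B_pos: "f \<in> V \<Longrightarrow> 0 \<le> Re (B f f)"
begin

definition nrm :: "('a \<Rightarrow> complex) \<Rightarrow> real" where "nrm f = sqrt (Re (B f f))"

lemma V_diff: assumes "f \<in> V" "g \<in> V" shows "f - g \<in> V"
proof -
  have "f - g = (\<lambda>i. f i + (-1) * g i)" by (auto simp: fun_eq_iff)
  then show ?thesis using V_add[OF assms(1) V_mult[OF assms(2), of "-1"]] by simp
qed

lemma B_add_left: assumes "f \<in> V" "g \<in> V" "h \<in> V" shows "B (\<lambda>i. g i + h i) f = B g f + B h f"
  using B_herm[of f "\<lambda>i. g i + h i"] B_herm[of f g] B_herm[of f h] B_add[of f g h] assms V_add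
  by simp

lemma B_mult_left: assumes "f \<in> V" "g \<in> V" shows "B (\<lambda>i. c * g i) f = cnj c * B g f"
  using B_herm[of f "\<lambda>i. c * g i"] B_herm[of f g] B_mult[of f g] assms V_mult by simp

lemma diff_conv: "f - g = (\<lambda>i. f i + (-1) * (g i :: complex))" by (auto simp: fun_eq_iff)

lemma B_diff: "f \<in> V \<Longrightarrow> g \<in> V \<Longrightarrow> h \<in> V \<Longrightarrow> B f (g - h) = B f g - B f h"
  using B_add[of f g "\<lambda>i. (-1) * h i"] B_mult[of f h "-1"] V_mult[of h "-1"]
  by (simp add: diff_conv del: mult_minus1)

lemma B_diff_left: "f \<in> V \<Longrightarrow> g \<in> V \<Longrightarrow> h \<in> V \<Longrightarrow> B (g - h) f = B g f - B h f"
  using B_add_left[of f g "\<lambda>i. (-1) * h i"] B_mult_left[of f h "-1"] V_mult[of h "-1"]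
  by (simp add: diff_conv del: mult_minus1)

lemma nrm_ge0 [simp]: "f \<in> V \<Longrightarrow> 0 \<le> nrm f" by (simp add: nrm_def B_pos)

lemma nrm_sq: "f \<in> V \<Longrightarrow> (nrm f)\<^sup>2 = Re (B f f)" by (simp add: nrm_def B_pos)

lemma B_self: assumes "f \<in> V" shows "B f f = of_real ((nrm f)\<^sup>2)"
proof -
  have "Im (B f f) = 0" using B_herm[OF assms assms] by (metis cnj.simps(2) neg_equal_zero)
  then show ?thesis by (simp add: nrm_sq[OF assms] complex_eq_iff)
qed

lemma cauchy_schwarz: assumes f: "f \<in> V" and g: "g \<in> V" shows "cmod (B f g) \<le> nrm f * nrm g"
proof -
  define b P where "b = B f g" and "P = (cmod b)\<^sup>2"
  have P0: "P \<ge> 0" by (simp add: P_def)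
  have bgf: "B g f = cnj b" using B_herm[OF f g] by (simp add: b_def)
  have q: "0 \<le> (nrm f)\<^sup>2 + 2 * t * P + t\<^sup>2 * P * (nrm g)\<^sup>2" for t :: real
  proof -
    define c where "c = of_real t * cnj b"
    define h where "h = (\<lambda>i. c * g i)"
    have h: "h \<in> V" using V_mult g by (simp add: h_def)
    have fh: "(\<lambda>i. f i + h i) \<in> V" by (rule V_add[OF f h])
    have "B (\<lambda>i. f i + h i) (\<lambda>i. f i + h i) = B f f + B f h + (B h f + B h h)"
      using B_add_left[OF fh f h] B_add[OF f f h] B_add[OF h f h] by simp
    also have "B f h = c * b" unfolding h_def b_def by (rule B_mult[OF f g])
    also have "B h f = cnj c * cnj b" unfolding h_def using B_mult_left[OF f g] bgf by simp
    also have "B h h = cnj c * (c * B g g)" 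
      using B_mult_left[OF h g, of c] B_mult[OF g g, of c] by (simp add: h_def)
    finally have e: "B (\<lambda>i. f i + h i) (\<lambda>i. f i + h i)
       = B f f + c * b + (cnj c * cnj b + cnj c * (c * B g g))" .
    have cb: "c * b = of_real (t * P)"
      by (simp add: c_def P_def complex_eq_iff cmod_power2) (simp add: power2_eq_square algebra_simps)
    have cb': "cnj c * cnj b = of_real (t * P)" using arg_cong[OF cb, of cnj] by simp
    have "cnj c * c = of_real (t\<^sup>2 * P)"
      by (simp add: c_def P_def complex_eq_iff cmod_power2) (simp add: power2_eq_square algebra_simps)
    then have cc: "cnj c * (c * B g g) = of_real (t\<^sup>2 * P * (nrm g)\<^sup>2)"
      by (simp add: B_self[OF g] flip: mult.assoc)
    have "B (\<lambda>i. f i + h i) (\<lambda>i. f i + h i) = of_real ((nrm f)\<^sup>2 + 2 * t * P + t\<^sup>2 * P * (nrm g)\<^sup>2)"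
      unfolding e cb cb' cc B_self[OF f] by (simp add: algebra_simps)
    then show ?thesis using B_pos[OF fh] by simp
  qed
  have "P \<le> (nrm f)\<^sup>2 * (nrm g)\<^sup>2"
  proof (cases "nrm g = 0")
    case True
    have "P = 0"
    proof (rule ccontr)
      assume "P \<noteq> 0"
      then show False using q[of "- ((nrm f)\<^sup>2 + 1) / (2 * P)"] True by (simp add: field_simps)
    qed
    then show ?thesis by simp
  next
    case False
    then have g0: "(nrm g)\<^sup>2 > 0" by simp
    have "0 \<le> (nrm f)\<^sup>2 - P / (nrm g)\<^sup>2"
    proof -
      have e: "2 * (- 1 / (nrm g)\<^sup>2) * P + (- 1 / (nrm g)\<^sup>2)\<^sup>2 * P * (nrm g)\<^sup>2 = - P / (nrm g)\<^sup>2"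
        using False by (simp add: field_simps power2_eq_square)
      show ?thesis using q[of "- 1 / (nrm g)\<^sup>2"] unfolding add.assoc e by simp
    qed
    then show ?thesis using g0 by (simp add: pos_divide_le_eq)
  qed
  then have "(cmod b)\<^sup>2 \<le> (nrm f * nrm g)\<^sup>2" by (simp add: P_def power_mult_distrib)
  then show ?thesis unfolding b_def
    by (rule power2_le_imp_le) (intro mult_nonneg_nonneg nrm_ge0 f g)
qed

lemma nrm_triangle: assumes f: "f \<in> V" and g: "g \<in> V" shows "nrm (\<lambda>i. f i + g i) \<le> nrm f + nrm g"
proof -
  have fg: "(\<lambda>i. f i + g i) \<in> V" by (rule V_add[OF f g])
  have "(nrm (\<lambda>i. f i + g i))\<^sup>2 = Re (B f f + B f g + (B g f + B g g))"
    using B_add_left[OF fg f g] B_add[OF f f g] B_add[OF g f g] nrm_sq[OF fg] by simp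
  also have "\<dots> = (nrm f)\<^sup>2 + 2 * Re (B f g) + (nrm g)\<^sup>2"
    using B_herm[OF f g] by (simp add: nrm_sq f g)
  also have "\<dots> \<le> (nrm f)\<^sup>2 + 2 * (nrm f * nrm g) + (nrm g)\<^sup>2"
    using cauchy_schwarz[OF f g] complex_Re_le_cmod[of "B f g"] by simp
  also have "\<dots> = (nrm f + nrm g)\<^sup>2" by (simp add: power2_eq_square algebra_simps)
  finally show ?thesis using f g by (meson add_nonneg_nonneg nrm_ge0 power2_le_imp_le)
qed

lemma nrm_mult: assumes f: "f \<in> V" shows "nrm (\<lambda>i. c * f i) = cmod c * nrm f"
proof -
  have "B (\<lambda>i. c * f i) (\<lambda>i. c * f i) = cnj c * (c * B f f)"
    using B_mult_left[OF V_mult[OF f] f, of c c] B_mult[OF f f, of c] by simp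
  also have "\<dots> = (cnj c * c) * of_real ((nrm f)\<^sup>2)" by (simp add: B_self[OF f])
  also have "cnj c * c = of_real ((cmod c)\<^sup>2)" by (simp add: complex_eq_iff cmod_power2) (simp add: power2_eq_square)
  finally have "Re (B (\<lambda>i. c * f i) (\<lambda>i. c * f i)) = (cmod c * nrm f)\<^sup>2"
    by (simp add: power_mult_distrib)
  then show ?thesis using nrm_ge0[OF f] by (simp add: nrm_def)
qed

lemma nrm_commute: assumes "f \<in> V" "g \<in> V" shows "nrm (f - g) = nrm (g - f)"
proof -
  have "g - f = (\<lambda>i. (-1) * (f - g) i)" by (auto simp: fun_eq_iff)
  then show ?thesis using nrm_mult[OF V_diff[OF assms], of "-1"] by simp
qed

lemma nrm_triangle3:
  assumes "f \<in> V" "g \<in> V" "h \<in> V" shows "nrm (f - h) \<le> nrm (f - g) + nrm (g - h)"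
proof -
  have "f - h = (\<lambda>i. (f - g) i + (g - h) i)" by (auto simp: fun_eq_iff)
  then show ?thesis using nrm_triangle[OF V_diff V_diff, of f g g h] assms by simp
qed

lemma nrm_zero: "nrm (f - f) = 0" 
proof -
  have "f - f = (\<lambda>i. 0 * (\<lambda>_. 0) i)" by (auto simp: fun_eq_iff)
  then show ?thesis using nrm_mult[OF V_zero, of 0] by simp
qed

lemma cauchy_seqs_iff:
  "x \<in> cauchy_seqs V B \<longleftrightarrow>
     (\<forall>n. x n \<in> V) \<and> (\<forall>e>0. \<exists>N. \<forall>m\<ge>N. \<forall>n\<ge>N. nrm (x m - x n) < e)"
proof (cases "\<forall>n. x n \<in> V")
  case True
  then have d: "x m - x n \<in> V" for m n by (simp add: V_diff)
  have 1: "(Re (B (x m - x n) (x m - x n)) < e\<^sup>2) = (nrm (x m - x n) < e)" if "e > 0" for m n e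
    using that nrm_ge0[OF d, of m n] unfolding nrm_sq[OF d, of m n, symmetric]
    by (meson less_imp_le power2_less_imp_less power_strict_mono zero_less_numeral)
  have "(\<forall>e>0. \<exists>N. \<forall>m\<ge>N. \<forall>n\<ge>N. Re (B (x m - x n) (x m - x n)) < e) \<longleftrightarrow>
      (\<forall>e>0. \<exists>N. \<forall>m\<ge>N. \<forall>n\<ge>N. nrm (x m - x n) < e)"
  proof (intro iffI allI impI)
    fix e :: real assume e: "e > 0"
      and a: "\<forall>e>0. \<exists>N. \<forall>m\<ge>N. \<forall>n\<ge>N. Re (B (x m - x n) (x m - x n)) < e"
    have "e\<^sup>2 > 0" using e by simp
    then show "\<exists>N. \<forall>m\<ge>N. \<forall>n\<ge>N. nrm (x m - x n) < e" using a unfolding 1[OF e, symmetric] by blast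
  next
    fix e :: real assume e: "e > 0"
      and a: "\<forall>e>0. \<exists>N. \<forall>m\<ge>N. \<forall>n\<ge>N. nrm (x m - x n) < e"
    have s: "sqrt e > 0" "(sqrt e)\<^sup>2 = e" using e by simp_all
    show "\<exists>N. \<forall>m\<ge>N. \<forall>n\<ge>N. Re (B (x m - x n) (x m - x n)) < e"
      using a s(1) unfolding 1[OF s(1), unfolded s(2)] by blast
  qed
  then show ?thesis using True by (simp add: cauchy_seqs_def)
next
  case False
  then show ?thesis unfolding cauchy_seqs_def by blast
qed

lemma cauchy_V: "x \<in> cauchy_seqs V B \<Longrightarrow> x n \<in> V" by (simp add: cauchy_seqs_def)

lemma null_equiv_iff:
  "null_equiv V B x y \<longleftrightarrow>
     x \<in> cauchy_seqs V B \<and> y \<in> cauchy_seqs V B \<and> (\<lambda>n. nrm (x n - y n)) \<longlonglongrightarrow> 0"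
proof (cases "x \<in> cauchy_seqs V B \<and> y \<in> cauchy_seqs V B")
  case True
  then have d: "x n - y n \<in> V" for n by (simp add: V_diff cauchy_V)
  have "(\<lambda>n. nrm (x n - y n)) \<longlonglongrightarrow> 0" if "(\<lambda>n. Re (B (x n - y n) (x n - y n))) \<longlonglongrightarrow> 0"
    using tendsto_real_sqrt[OF that] by (simp add: nrm_def)
  moreover have "(\<lambda>n. Re (B (x n - y n) (x n - y n))) \<longlonglongrightarrow> 0" if "(\<lambda>n. nrm (x n - y n)) \<longlonglongrightarrow> 0"
    using tendsto_power[OF that, of 2] by (simp add: nrm_sq[OF d])
  ultimately show ?thesis using True by (auto simp: null_equiv_def)
qed (auto simp: null_equiv_def)

lemma const_cauchy: "f \<in> V \<Longrightarrow> (\<lambda>_. f) \<in> cauchy_seqs V B"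
  by (simp add: cauchy_seqs_iff nrm_zero)

lemma part_equivp_null_equiv: "part_equivp (null_equiv V B)"
proof (rule part_equivpI)
  have "null_equiv V B (\<lambda>_. (\<lambda>_. 0)) (\<lambda>_. (\<lambda>_. 0))"
    by (simp add: null_equiv_iff const_cauchy V_zero nrm_zero)
  then show "\<exists>x. null_equiv V B x x" by blast
  show "symp (null_equiv V B)"
    by (rule sympI) (auto simp: null_equiv_iff nrm_commute cauchy_V)
  show "transp (null_equiv V B)"
  proof (rule transpI)
    fix x y z assume a: "null_equiv V B x y" "null_equiv V B y z"
    have v: "x n \<in> V" "y n \<in> V" "z n \<in> V" for n using a by (auto simp: null_equiv_iff cauchy_V)
    have "(\<lambda>n. nrm (x n - y n) + nrm (y n - z n)) \<longlonglongrightarrow> 0 + 0"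
      using a by (intro tendsto_add) (auto simp: null_equiv_iff)
    then have "(\<lambda>n. nrm (x n - z n)) \<longlonglongrightarrow> 0"
      by (intro tendsto_sandwich[of "\<lambda>_. 0" "\<lambda>n. nrm (x n - z n)" sequentially
            "\<lambda>n. nrm (x n - y n) + nrm (y n - z n)" 0])
        (auto simp: v V_diff intro!: always_eventually nrm_triangle3 nrm_ge0)
    then show "null_equiv V B x z" using a by (auto simp: null_equiv_iff)
  qed
qed

lemma cauchy_add: assumes "x \<in> cauchy_seqs V B" "y \<in> cauchy_seqs V B"
  shows "(\<lambda>n i. x n i + y n i) \<in> cauchy_seqs V B"
  unfolding cauchy_seqs_iff
proof (intro conjI allI impI)
  show "(\<lambda>i. x n i + y n i) \<in> V" for n using assms by (simp add: cauchy_V V_add)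
  fix e :: real assume "e > 0"
  then have e2: "e / 2 > 0" by simp
  obtain N where N: "\<And>m n. m \<ge> N \<Longrightarrow> n \<ge> N \<Longrightarrow> nrm (x m - x n) < e / 2"
    using assms(1) e2 unfolding cauchy_seqs_iff by blast
  obtain M where M: "\<And>m n. m \<ge> M \<Longrightarrow> n \<ge> M \<Longrightarrow> nrm (y m - y n) < e / 2"
    using assms(2) e2 unfolding cauchy_seqs_iff by blast
  have "nrm ((\<lambda>i. x m i + y m i) - (\<lambda>i. x n i + y n i)) < e" if "m \<ge> max M N" "n \<ge> max M N" for m n
  proof -
    have "(\<lambda>i. x m i + y m i) - (\<lambda>i. x n i + y n i) = (\<lambda>i. (x m - x n) i + (y m - y n) i)"
      by (auto simp: fun_eq_iff)
    then have "nrm ((\<lambda>i. x m i + y m i) - (\<lambda>i. x n i + y n i)) \<le> nrm (x m - x n) + nrm (y m - y n)"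
      using nrm_triangle[OF V_diff V_diff, of "x m" "x n" "y m" "y n"] assms by (simp add: cauchy_V)
    then show ?thesis using N[of m n] M[of m n] that by simp
  qed
  then show "\<exists>N. \<forall>m\<ge>N. \<forall>n\<ge>N. nrm ((\<lambda>i. x m i + y m i) - (\<lambda>i. x n i + y n i)) < e" by blast
qed

lemma cauchy_mult: assumes "x \<in> cauchy_seqs V B"
  shows "(\<lambda>n i. c * x n i) \<in> cauchy_seqs V B"
  unfolding cauchy_seqs_iff
proof (intro conjI allI impI)
  show "(\<lambda>i. c * x n i) \<in> V" for n using assms by (simp add: cauchy_V V_mult)
  fix e :: real assume e: "e > 0"
  have c1: "cmod c + 1 > 0" by (simp add: add_nonneg_pos)
  then have "e / (cmod c + 1) > 0" using e by simp
  then obtain N where N: "\<And>m n. m \<ge> N \<Longrightarrow> n \<ge> N \<Longrightarrow> nrm (x m - x n) < e / (cmod c + 1)"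
    using assms(1) unfolding cauchy_seqs_iff by blast
  have "nrm ((\<lambda>i. c * x m i) - (\<lambda>i. c * x n i)) < e" if "m \<ge> N" "n \<ge> N" for m n
  proof -
    have d: "x m - x n \<in> V" using assms by (simp add: cauchy_V V_diff)
    have "(\<lambda>i. c * x m i) - (\<lambda>i. c * x n i) = (\<lambda>i. c * (x m - x n) i)"
      by (auto simp: fun_eq_iff algebra_simps)
    then have "nrm ((\<lambda>i. c * x m i) - (\<lambda>i. c * x n i)) = cmod c * nrm (x m - x n)"
      using nrm_mult[OF d, of c] by simp
    also have "\<dots> \<le> (cmod c + 1) * nrm (x m - x n)" using nrm_ge0[OF d] by (simp add: mult_right_mono)
    also have "\<dots> < e" using N[OF that] c1 by (simp add: field_simps)
    finally show ?thesis .
  qed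
  then show "\<exists>N. \<forall>m\<ge>N. \<forall>n\<ge>N. nrm ((\<lambda>i. c * x m i) - (\<lambda>i. c * x n i)) < e" by blast
qed

lemma null_equiv_add:
  assumes "null_equiv V B x x'" "null_equiv V B y y'"
  shows "null_equiv V B (\<lambda>n i. x n i + y n i) (\<lambda>n i. x' n i + y' n i)"
proof -
  have v: "x n \<in> V" "x' n \<in> V" "y n \<in> V" "y' n \<in> V" for n
    using assms by (auto simp: null_equiv_iff cauchy_V)
  have sum0: "(\<lambda>n. nrm (x n - x' n) + nrm (y n - y' n)) \<longlonglongrightarrow> 0"
    using assms tendsto_add[of "\<lambda>n. nrm (x n - x' n)" 0 sequentially "\<lambda>n. nrm (y n - y' n)" 0]
    by (simp add: null_equiv_iff del: minus_apply)
  have "nrm ((\<lambda>i. x n i + y n i) - (\<lambda>i. x' n i + y' n i))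
      = nrm (\<lambda>i. (x n - x' n) i + (y n - y' n) i)" for n
    by (intro arg_cong[where f = nrm]) (auto simp: fun_eq_iff)
  then have le: "nrm ((\<lambda>i. x n i + y n i) - (\<lambda>i. x' n i + y' n i))
      \<le> nrm (x n - x' n) + nrm (y n - y' n)" for n
    using nrm_triangle[OF V_diff[OF v(1,2)] V_diff[OF v(3,4)]] by (simp del: minus_apply)
  have ge: "0 \<le> nrm ((\<lambda>i. x n i + y n i) - (\<lambda>i. x' n i + y' n i))" for n
    by (intro nrm_ge0 V_diff V_add v)
  have "(\<lambda>n. nrm ((\<lambda>i. x n i + y n i) - (\<lambda>i. x' n i + y' n i))) \<longlonglongrightarrow> 0"
    by (rule tendsto_sandwich[OF always_eventually[OF allI[OF ge]] always_eventually[OF allI[OF le]]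
          tendsto_const sum0])
  moreover have "(\<lambda>n i. x n i + y n i) \<in> cauchy_seqs V B" "(\<lambda>n i. x' n i + y' n i) \<in> cauchy_seqs V B"
    using assms unfolding null_equiv_iff by (blast intro: cauchy_add)+
  ultimately show ?thesis unfolding null_equiv_iff by blast
qed

lemma null_equiv_mult:
  assumes "null_equiv V B x x'"
  shows "null_equiv V B (\<lambda>n i. c * x n i) (\<lambda>n i. c * x' n i)"
proof -
  have v: "x n - x' n \<in> V" for n using assms by (auto simp: null_equiv_iff cauchy_V V_diff)
  have "(\<lambda>n. cmod c * nrm (x n - x' n)) \<longlonglongrightarrow> cmod c * 0"
    using assms by (intro tendsto_mult_left) (auto simp: null_equiv_iff)
  moreover have "(\<lambda>i. c * x n i) - (\<lambda>i. c * x' n i) = (\<lambda>i. c * (x n - x' n) i)" for n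
    by (auto simp: fun_eq_iff algebra_simps)
  ultimately show ?thesis using assms by (auto simp: null_equiv_iff cauchy_mult nrm_mult[OF v] simp del: minus_apply)
qed

lemma nrm_abs_diff: assumes "f \<in> V" "g \<in> V" shows "\<bar>nrm f - nrm g\<bar> \<le> nrm (f - g)"
proof -
  have "f = (\<lambda>i. (f - g) i + g i)" "g = (\<lambda>i. (g - f) i + f i)" by (auto simp: fun_eq_iff)
  then have "nrm f \<le> nrm (f - g) + nrm g" "nrm g \<le> nrm (g - f) + nrm f"
    using nrm_triangle[OF V_diff[OF assms] assms(2)] nrm_triangle[OF V_diff[OF assms(2,1)] assms(1)]
    by simp_all
  then show ?thesis using nrm_commute[OF assms] by simp
qed

lemma cauchy_bounded: assumes "x \<in> cauchy_seqs V B" shows "\<exists>M. \<forall>n. nrm (x n) \<le> M"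
proof -
  have "Cauchy (\<lambda>n. nrm (x n))"
    unfolding Cauchy_def dist_real_def
  proof (intro allI impI)
    fix e :: real assume "e > 0"
    then obtain N where "\<And>m n. m \<ge> N \<Longrightarrow> n \<ge> N \<Longrightarrow> nrm (x m - x n) < e"
      using assms unfolding cauchy_seqs_iff by blast
    then show "\<exists>N. \<forall>m\<ge>N. \<forall>n\<ge>N. \<bar>nrm (x m) - nrm (x n)\<bar> < e"
      using nrm_abs_diff[OF cauchy_V[OF assms] cauchy_V[OF assms]] by (meson le_less_trans)
  qed
  then have "Bseq (\<lambda>n. nrm (x n))" by (rule Cauchy_Bseq)
  then show ?thesis unfolding Bseq_def by (metis abs_le_D1 real_norm_def)
qed

lemma B_diff_bound:
  assumes "f \<in> V" "g \<in> V" "f' \<in> V" "g' \<in> V"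
  shows "cmod (B f g - B f' g') \<le> nrm f * nrm (g - g') + nrm (f - f') * nrm g'"
proof -
  have "B f g - B f' g' = B f (g - g') + B (f - f') g'"
    using B_diff[of f g g'] B_diff_left[of g' f f'] assms by simp
  then have "cmod (B f g - B f' g') \<le> cmod (B f (g - g')) + cmod (B (f - f') g')"
    using norm_triangle_ineq by simp
  then show ?thesis
    using cauchy_schwarz[OF assms(1) V_diff[OF assms(2,4)]]
      cauchy_schwarz[OF V_diff[OF assms(1,3)] assms(4)] by linarith
qed

lemma B_convergent:
  assumes x: "x \<in> cauchy_seqs V B" and y: "y \<in> cauchy_seqs V B"
  shows "convergent (\<lambda>n. B (x n) (y n))"
proof -
  obtain M1 where M1: "\<And>n. nrm (x n) \<le> M1" using cauchy_bounded[OF x] by blast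
  obtain M2 where M2: "\<And>n. nrm (y n) \<le> M2" using cauchy_bounded[OF y] by blast
  define M where "M = max 1 (max M1 M2)"
  have M: "nrm (x n) \<le> M" "nrm (y n) \<le> M" "M > 0" for n
    using M1[of n] M2[of n] by (auto simp: M_def)
  have "Cauchy (\<lambda>n. B (x n) (y n))"
    unfolding Cauchy_def dist_norm
  proof (intro allI impI)
    fix e :: real assume e: "e > 0"
    then have eM: "e / (2 * M) > 0" using M(3) by simp
    obtain N1 where N1: "\<And>m n. m \<ge> N1 \<Longrightarrow> n \<ge> N1 \<Longrightarrow> nrm (x m - x n) < e / (2 * M)"
      using x eM unfolding cauchy_seqs_iff by blast
    obtain N2 where N2: "\<And>m n. m \<ge> N2 \<Longrightarrow> n \<ge> N2 \<Longrightarrow> nrm (y m - y n) < e / (2 * M)"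
      using y eM unfolding cauchy_seqs_iff by blast
    have "cmod (B (x m) (y m) - B (x n) (y n)) < e" if "m \<ge> max N1 N2" "n \<ge> max N1 N2" for m n
    proof -
      note v = cauchy_V[OF x] cauchy_V[OF y]
      have "cmod (B (x m) (y m) - B (x n) (y n))
          \<le> nrm (x m) * nrm (y m - y n) + nrm (x m - x n) * nrm (y n)"
        by (rule B_diff_bound) (simp_all add: v)
      also have "\<dots> \<le> M * nrm (y m - y n) + nrm (x m - x n) * M"
        by (intro add_mono mult_left_mono mult_right_mono M nrm_ge0 V_diff v)
      also have "\<dots> < M * (e / (2 * M)) + (e / (2 * M)) * M"
        using N1[of m n] N2[of m n] that M(3)
        by (intro add_strict_mono mult_strict_left_mono mult_strict_right_mono) auto
      also have "\<dots> = e" using M(3) by (simp add: field_simps)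
      finally show ?thesis .
    qed
    then show "\<exists>N. \<forall>m\<ge>N. \<forall>n\<ge>N. cmod (B (x m) (y m) - B (x n) (y n)) < e" by blast
  qed
  then show ?thesis by (simp add: Cauchy_convergent_iff)
qed

lemma B_lim: 
  assumes "x \<in> cauchy_seqs V B" "y \<in> cauchy_seqs V B"
  shows "(\<lambda>n. B (x n) (y n)) \<longlonglongrightarrow> lim (\<lambda>n. B (x n) (y n))"
  using B_convergent[OF assms] by (simp add: convergent_LIMSEQ_iff)

lemma B_lim_cong:
  assumes "null_equiv V B x x'" "null_equiv V B y y'"
  shows "lim (\<lambda>n. B (x n) (y n)) = lim (\<lambda>n. B (x' n) (y' n))"
proof -
  have c: "x \<in> cauchy_seqs V B" "x' \<in> cauchy_seqs V B" "y \<in> cauchy_seqs V B" "y' \<in> cauchy_seqs V B"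
    using assms by (auto simp: null_equiv_iff)
  note v = c[THEN cauchy_V]
  obtain M1 where M1: "\<And>n. nrm (x n) \<le> M1" using cauchy_bounded[OF c(1)] by blast
  obtain M2 where M2: "\<And>n. nrm (y' n) \<le> M2" using cauchy_bounded[OF c(4)] by blast
  have "(\<lambda>n. M1 * nrm (y n - y' n) + nrm (x n - x' n) * M2) \<longlonglongrightarrow> M1 * 0 + 0 * M2"
    using assms by (intro tendsto_intros) (auto simp: null_equiv_iff)
  then have l: "(\<lambda>n. M1 * nrm (y n - y' n) + nrm (x n - x' n) * M2) \<longlonglongrightarrow> 0" by simp
  have "norm (B (x n) (y n) - B (x' n) (y' n)) \<le> M1 * nrm (y n - y' n) + nrm (x n - x' n) * M2" for n
  proof -
    have "norm (B (x n) (y n) - B (x' n) (y' n)) \<le> nrm (x n) * nrm (y n - y' n) + nrm (x n - x' n) * nrm (y' n)"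
      by (rule B_diff_bound) (simp_all add: v)
    also have "\<dots> \<le> M1 * nrm (y n - y' n) + nrm (x n - x' n) * M2"
      by (intro add_mono mult_right_mono mult_left_mono M1 M2) (simp_all add: v V_diff)
    finally show ?thesis .
  qed
  then have "(\<lambda>n. B (x n) (y n) - B (x' n) (y' n)) \<longlonglongrightarrow> 0"
    by (intro Lim_null_comparison[OF _ l]) simp
  moreover have "(\<lambda>n. B (x n) (y n) - B (x' n) (y' n)) \<longlonglongrightarrow>
      lim (\<lambda>n. B (x n) (y n)) - lim (\<lambda>n. B (x' n) (y' n))"
    by (intro tendsto_diff B_lim c)
  ultimately show ?thesis using LIMSEQ_unique by fastforce
qed

end

definition psd_on :: "'a set \<Rightarrow> ('a \<Rightarrow> 'a \<Rightarrow> complex) \<Rightarrow> bool" where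
  "psd_on S K \<longleftrightarrow> (\<forall>x\<in>S. \<forall>y\<in>S. K y x = cnj (K x y)) \<and>
     (\<forall>A c. finite A \<longrightarrow> A \<subseteq> S \<longrightarrow> 0 \<le> Re (\<Sum>x\<in>A. \<Sum>y\<in>A. K x y * cnj (c x) * c y))"

lemma psd_on_pos:
  "psd_on S K \<Longrightarrow> finite A \<Longrightarrow> A \<subseteq> S \<Longrightarrow> 0 \<le> Re (\<Sum>x\<in>A. \<Sum>y\<in>A. K x y * cnj (c x) * c y)"
  unfolding psd_on_def by blast

lemma psd_on_herm: "psd_on S K \<Longrightarrow> x \<in> S \<Longrightarrow> y \<in> S \<Longrightarrow> K y x = cnj (K x y)"
  unfolding psd_on_def by blast

lemma psd_on_subset: "psd_on S K \<Longrightarrow> T \<subseteq> S \<Longrightarrow> psd_on T K"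
  unfolding psd_on_def by (meson order_trans subsetD)

lemma psd_on_cong: 
  assumes "psd_on S K" "\<And>x y. x \<in> S \<Longrightarrow> y \<in> S \<Longrightarrow> L x y = K x y" shows "psd_on S L"
  unfolding psd_on_def
proof (intro conjI ballI allI impI)
  show "L y x = cnj (L x y)" if "x \<in> S" "y \<in> S" for x y
    using psd_on_herm[OF assms(1) that] assms(2) that by simp
  fix A c assume A: "finite A" "A \<subseteq> S"
  have "(\<Sum>x\<in>A. \<Sum>y\<in>A. L x y * cnj (c x) * c y) = (\<Sum>x\<in>A. \<Sum>y\<in>A. K x y * cnj (c x) * c y)"
    using A assms(2) by (intro sum.cong refl) (auto simp: subset_eq)
  then show "0 \<le> Re (\<Sum>x\<in>A. \<Sum>y\<in>A. L x y * cnj (c x) * c y)"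
    using psd_on_pos[OF assms(1) A] by simp
qed

lemma kernel_form_sum:
  assumes "finite A" "{x. f x \<noteq> 0} \<subseteq> A" "{x. g x \<noteq> 0} \<subseteq> A"
  shows "kernel_form K f g = (\<Sum>x\<in>A. \<Sum>y\<in>A. K x y * cnj (f x) * g y)"
proof -
  have "(\<Sum>x\<in>A. \<Sum>y\<in>A. K x y * cnj (f x) * g y)
      = (\<Sum>x | f x \<noteq> 0. \<Sum>y\<in>A. K x y * cnj (f x) * g y)"
    by (rule sum.mono_neutral_right) (use assms in auto)
  also have "\<dots> = kernel_form K f g"
    unfolding kernel_form_def
    by (intro sum.cong refl sum.mono_neutral_right) (use assms in auto)
  finally show ?thesis by simp
qed

lemma psd_form_kernel:
  assumes "psd_on S K"
  shows "psd_form (finsupp S) (kernel_form K)"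
proof
  show "(\<lambda>_. 0) \<in> finsupp S" by (simp add: finsupp_def)
  fix f g h c
  assume f: "f \<in> finsupp S"
  show "(\<lambda>i. c * f i) \<in> finsupp S"
    using f by (auto simp: finsupp_def elim: rev_finite_subset)
  have "0 \<le> Re (\<Sum>x | f x \<noteq> 0. \<Sum>y | f y \<noteq> 0. K x y * cnj (f x) * f y)"
    by (rule psd_on_pos[OF assms]) (use f in \<open>auto simp: finsupp_def\<close>)
  then show "0 \<le> Re (kernel_form K f f)" by (simp add: kernel_form_def)
  assume g: "g \<in> finsupp S"
  show "(\<lambda>i. f i + g i) \<in> finsupp S"
  proof -
    have "{x. f x + g x \<noteq> 0} \<subseteq> {x. f x \<noteq> 0} \<union> {x. g x \<noteq> 0}" by auto
    moreover have "finite ({x. f x \<noteq> 0} \<union> {x. g x \<noteq> 0})" "{x. f x \<noteq> 0} \<union> {x. g x \<noteq> 0} \<subseteq> S"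
      using f g by (auto simp: finsupp_def)
    ultimately show ?thesis unfolding finsupp_def using finite_subset by blast
  qed
  define A where "A = {x. f x \<noteq> 0} \<union> {x. g x \<noteq> 0}"
  have A: "finite A" "A \<subseteq> S" "{x. f x \<noteq> 0} \<subseteq> A" "{x. g x \<noteq> 0} \<subseteq> A"
    using f g by (auto simp: A_def finsupp_def)
  show "kernel_form K f (\<lambda>i. c * g i) = c * kernel_form K f g"
  proof -
    have "{x. c * g x \<noteq> 0} \<subseteq> A" using A by auto
    then have "kernel_form K f (\<lambda>i. c * g i) = (\<Sum>x\<in>A. \<Sum>y\<in>A. K x y * cnj (f x) * (c * g y))"
      by (rule kernel_form_sum[OF A(1,3)])
    also have "\<dots> = c * (\<Sum>x\<in>A. \<Sum>y\<in>A. K x y * cnj (f x) * g y)"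
      by (simp add: sum_distrib_left mult_ac)
    finally show ?thesis using kernel_form_sum[OF A(1,3,4)] by simp
  qed
  have "cnj (kernel_form K f g) = (\<Sum>x\<in>A. \<Sum>y\<in>A. cnj (K x y) * f x * cnj (g y))"
    by (simp add: kernel_form_sum[OF A(1,3,4)])
  also have "\<dots> = (\<Sum>x\<in>A. \<Sum>y\<in>A. K y x * cnj (g y) * f x)"
  proof (intro sum.cong refl)
    fix x y assume "x \<in> A" "y \<in> A"
    then show "cnj (K x y) * f x * cnj (g y) = K y x * cnj (g y) * f x"
      using A(2) psd_on_herm[OF assms, of x y] by (auto simp: subset_eq)
  qed
  also have "\<dots> = (\<Sum>y\<in>A. \<Sum>x\<in>A. K y x * cnj (g y) * f x)" by (rule sum.swap)
  finally show "kernel_form K g f = cnj (kernel_form K f g)"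
    by (simp add: kernel_form_sum[OF A(1,4,3)])
  assume h: "h \<in> finsupp S"
  define C where "C = A \<union> {x. h x \<noteq> 0}"
  have C: "finite C" "{x. f x \<noteq> 0} \<subseteq> C" "{x. g x \<noteq> 0} \<subseteq> C" "{x. h x \<noteq> 0} \<subseteq> C"
    using A h by (auto simp: C_def finsupp_def)
  have "{x. g x + h x \<noteq> 0} \<subseteq> {x. g x \<noteq> 0} \<union> {x. h x \<noteq> 0}" by auto
  then have "{x. g x + h x \<noteq> 0} \<subseteq> C" using C(3,4) by blast
  from kernel_form_sum[OF C(1,2) this, of K]
  show "kernel_form K f (\<lambda>i. g i + h i) = kernel_form K f g + kernel_form K f h"
    by (simp add: kernel_form_sum[OF C(1,2,3)] kernel_form_sum[OF C(1,2,4)]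
        sum.distrib algebra_simps)
qed

text \<open>A positive semidefinite kernel on a finite set is a Gram kernel; this gives the Schur product
  theorem.\<close>

lemma psd_on_decomp:
  assumes "finite S" "psd_on S K"
  shows "\<exists>(R::nat) \<phi>. \<forall>x\<in>S. \<forall>y\<in>S. K x y = (\<Sum>r<R. cnj (\<phi> r x) * \<phi> r y)"
  using assms
proof (induction S arbitrary: K rule: finite_induct)
  case empty
  then show ?case by simp
next
  case (insert a S)
  define k where "k = Re (K a a)"
  have Kaa: "K a a = of_real k"
  proof -
    have "Im (K a a) = 0" 
      using psd_on_herm[OF insert.prems, of a a] by (metis cnj.simps(2) insertI1 neg_equal_zero)
    then show ?thesis by (simp add: k_def complex_eq_iff)
  qed
  have herm: "K y x = cnj (K x y)" if "x \<in> insert a S" "y \<in> insert a S" for x y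
    using psd_on_herm[OF insert.prems that] .
  have expand: "0 \<le> Re (\<Sum>x\<in>A. \<Sum>y\<in>A. K x y * cnj (c x) * c y)
       + 2 * Re (cnj u * (\<Sum>y\<in>A. K a y * c y)) + k * (cmod u)\<^sup>2"
    if A: "A \<subseteq> S" for A c u
  proof -
    have fA: "finite A" using A insert.hyps(1) finite_subset by blast
    have aA: "a \<notin> A" using A insert.hyps(2) by blast
    define d where "d = c(a := u)"
    have d: "d a = u" "\<And>x. x \<in> A \<Longrightarrow> d x = c x" using aA by (auto simp: d_def)
    let ?L = "\<Sum>y\<in>A. K a y * c y"
    have 1: "(\<Sum>x\<in>insert a A. \<Sum>y\<in>insert a A. K x y * cnj (d x) * d y)
       = (K a a * cnj u * u + (\<Sum>y\<in>A. K a y * cnj u * c y))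
         + (\<Sum>x\<in>A. K x a * cnj (c x) * u + (\<Sum>y\<in>A. K x y * cnj (c x) * c y))"
      using fA aA d by (simp cong: sum.cong)
    have 2: "(\<Sum>y\<in>A. K a y * cnj u * c y) = cnj u * ?L"
      by (simp add: sum_distrib_left mult_ac)
    have 3: "(\<Sum>x\<in>A. K x a * cnj (c x) * u) = cnj (cnj u * ?L)"
      unfolding cnj_sum complex_cnj_mult sum_distrib_left complex_cnj_cnj
      using A herm[of a] by (intro sum.cong refl) (auto simp: mult_ac subset_eq)
    have 4: "Re (K a a * cnj u * u) = k * (cmod u)\<^sup>2"
      by (simp add: Kaa cmod_power2) (simp add: power2_eq_square algebra_simps)
    have le: "0 \<le> Re (\<Sum>x\<in>insert a A. \<Sum>y\<in>insert a A. K x y * cnj (d x) * d y)"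
      using A fA by (intro psd_on_pos[OF insert.prems]) auto
    have 5: "Re ((p + w) + (cnj w + q)) = Re q + 2 * Re w + Re p" for p w q by simp
    show ?thesis using le unfolding 1 sum.distrib 2 3 5 4 .
  qed
  have k0: "k \<ge> 0" using expand[of "{}" _ 1] by simp
  have zero: "K a y = 0" if "k = 0" "y \<in> S" for y
  proof (rule ccontr)
    assume ne: "K a y \<noteq> 0"
    define t where "t = - (Re (K y y) + 1) / (2 * (cmod (K a y))\<^sup>2)"
    have "0 \<le> Re (K y y) + 2 * Re (cnj (of_real t * K a y) * K a y)"
      using expand[of "{y}" "\<lambda>_. 1" "of_real t * K a y"] that by simp
    also have "Re (cnj (of_real t * K a y) * K a y) = t * (cmod (K a y))\<^sup>2"
      by (simp add: cmod_power2) (simp add: power2_eq_square algebra_simps)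
    also have "\<dots> = - (Re (K y y) + 1) / 2" using ne by (simp add: t_def field_simps)
    finally have "0 \<le> Re (K y y) + 2 * (- (Re (K y y) + 1) / 2)" .
    moreover have "r + 2 * (- (r + 1) / 2) = - 1" for r :: real by (simp add: field_simps)
    ultimately show False by simp
  qed
  define K' where "K' = (\<lambda>x y. K x y - K x a * K a y / of_real k)"
  have "psd_on S K'"
    unfolding psd_on_def
  proof (intro conjI ballI allI impI)
    show "K' y x = cnj (K' x y)" if "x \<in> S" "y \<in> S" for x y
      using herm[of x y] herm[of x a] herm[of a y] that by (simp add: K'_def)
    fix A c assume A: "finite A" "A \<subseteq> S"
    define L where "L = (\<Sum>y\<in>A. K a y * c y)"
    have L': "(\<Sum>x\<in>A. K x a * cnj (c x)) = cnj L"
      unfolding L_def cnj_sum using A herm[of a] by (intro sum.cong refl) (auto simp: subset_eq)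
    have "(\<Sum>x\<in>A. \<Sum>y\<in>A. K x a * K a y / of_real k * cnj (c x) * c y)
       = (\<Sum>x\<in>A. \<Sum>y\<in>A. (K x a * cnj (c x)) * (K a y * c y)) / of_real k"
      by (simp add: sum_divide_distrib mult_ac)
    also have "\<dots> = cnj L * L / of_real k"
      by (simp only: sum_product[symmetric] L' L_def[symmetric])
    also have "\<dots> = of_real ((cmod L)\<^sup>2 / k)"
      by (simp only: of_real_divide complex_norm_square mult.commute)
    finally have e: "Re (\<Sum>x\<in>A. \<Sum>y\<in>A. K' x y * cnj (c x) * c y)
        = Re (\<Sum>x\<in>A. \<Sum>y\<in>A. K x y * cnj (c x) * c y) - (cmod L)\<^sup>2 / k"
      by (simp add: K'_def left_diff_distrib sum_subtractf)
    show "0 \<le> Re (\<Sum>x\<in>A. \<Sum>y\<in>A. K' x y * cnj (c x) * c y)"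
    proof (cases "k = 0")
      case True
      then show ?thesis unfolding e using psd_on_pos[OF insert.prems A(1)] A(2) by auto
    next
      case False
      then have kp: "k > 0" using k0 by simp
      have 1: "Re (cnj (- L / of_real k) * L) = - (cmod L)\<^sup>2 / k"
        by (simp add: cmod_power2) (simp add: power2_eq_square add_divide_distrib diff_divide_distrib)
      have 2: "k * (cmod (- L / of_real k))\<^sup>2 = (cmod L)\<^sup>2 / k"
        using kp by (simp add: norm_divide power_divide power2_eq_square)
      show ?thesis unfolding e using expand[OF A(2), of c "- L / of_real k"]
        unfolding L_def[symmetric] 1 2 by simp
    qed
  qed
  then obtain R \<phi> where \<phi>: "\<And>x y. x \<in> S \<Longrightarrow> y \<in> S \<Longrightarrow> K' x y = (\<Sum>r<(R::nat). cnj (\<phi> r x) * \<phi> r y)"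
    using insert.IH[of K'] by blast
  define \<psi> where "\<psi> = (\<lambda>r x. if r < R then (if x = a then 0 else \<phi> r x) else K a x / of_real (sqrt k))"
  have sq: "complex_of_real (sqrt k) * complex_of_real (sqrt k) = complex_of_real k"
    using k0 by (simp flip: of_real_mult)
  have "K x y = (\<Sum>r<Suc R. cnj (\<psi> r x) * \<psi> r y)" if xy: "x \<in> insert a S" "y \<in> insert a S" for x y
  proof -
    have s: "(\<Sum>r<Suc R. cnj (\<psi> r x) * \<psi> r y)
        = (\<Sum>r<R. cnj (if x = a then 0 else \<phi> r x) * (if y = a then 0 else \<phi> r y))
          + cnj (K a x) * K a y / of_real k"
      by (simp add: \<psi>_def sq)
    show ?thesis
    proof (cases "x \<noteq> a \<and> y \<noteq> a")
      case True
      then have "x \<in> S" "y \<in> S" using xy by auto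
      then show ?thesis unfolding s using True \<phi>[of x y] herm[of a x] 
        by (simp add: K'_def diff_eq_eq)
    next
      case False
      then have s0: "(\<Sum>r<Suc R. cnj (\<psi> r x) * \<psi> r y) = cnj (K a x) * K a y / of_real k"
        unfolding s by auto
      have aa: "cnj (K a a) = K a a" by (simp add: Kaa)
      show ?thesis
      proof (cases "k = 0")
        case True
        have "K a z = 0" if "z \<in> insert a S" for z using zero[OF True, of z] Kaa True that by auto
        moreover have "K z a = 0" if "z \<in> insert a S" for z using calculation[OF that] herm[of a z] that by simp
        ultimately show ?thesis unfolding s0 using False xy by auto
      next
        case k: False
        show ?thesis unfolding s0 using False k xy herm[of a x] by (auto simp: Kaa)
      qed
    qed
  qed
  then show ?case by blast
qed

lemma psd_on_mult:
  assumes K: "psd_on S K" and L: "psd_on S L"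
  shows "psd_on S (\<lambda>x y. K x y * L x y)"
  unfolding psd_on_def
proof (intro conjI ballI allI impI)
  show "K y x * L y x = cnj (K x y * L x y)" if "x \<in> S" "y \<in> S" for x y
    using psd_on_herm[OF K that] psd_on_herm[OF L that] by simp
  fix A c assume A: "finite A" "A \<subseteq> S"
  obtain R \<phi> where \<phi>: "\<And>x y. x \<in> A \<Longrightarrow> y \<in> A \<Longrightarrow> K x y = (\<Sum>r<(R::nat). cnj (\<phi> r x) * \<phi> r y)"
    using psd_on_decomp[OF A(1) psd_on_subset[OF K A(2)]] by blast
  have "(\<Sum>x\<in>A. \<Sum>y\<in>A. K x y * L x y * cnj (c x) * c y)
      = (\<Sum>x\<in>A. \<Sum>y\<in>A. \<Sum>r<R. L x y * cnj (\<phi> r x * c x) * (\<phi> r y * c y))"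
    by (intro sum.cong refl) (simp add: \<phi> sum_distrib_right sum_distrib_left mult_ac)
  also have "\<dots> = (\<Sum>x\<in>A. \<Sum>r<R. \<Sum>y\<in>A. L x y * cnj (\<phi> r x * c x) * (\<phi> r y * c y))"
    by (intro sum.cong refl sum.swap)
  also have "\<dots> = (\<Sum>r<R. \<Sum>x\<in>A. \<Sum>y\<in>A. L x y * cnj (\<phi> r x * c x) * (\<phi> r y * c y))"
    by (rule sum.swap)
  finally have "Re (\<Sum>x\<in>A. \<Sum>y\<in>A. K x y * L x y * cnj (c x) * c y)
      = (\<Sum>r<R. Re (\<Sum>x\<in>A. \<Sum>y\<in>A. L x y * cnj (\<phi> r x * c x) * (\<phi> r y * c y)))"
    by (simp only: Re_sum)
  also have "\<dots> \<ge> 0"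
    by (intro sum_nonneg psd_on_pos[OF L A])
  finally show "0 \<le> Re (\<Sum>x\<in>A. \<Sum>y\<in>A. K x y * L x y * cnj (c x) * c y)" .
qed

lemma psd_on_one: "psd_on S (\<lambda>_ _. 1)"
  unfolding psd_on_def
proof (intro conjI ballI allI impI)
  fix A :: "'a set" and c :: "'a \<Rightarrow> complex"
  have "(\<Sum>x\<in>A. \<Sum>y\<in>A. 1 * cnj (c x) * c y) = cnj (\<Sum>x\<in>A. c x) * (\<Sum>x\<in>A. c x)"
    by (simp add: sum_product)
  also have "\<dots> = of_real ((cmod (\<Sum>x\<in>A. c x))\<^sup>2)"
    by (simp only: complex_norm_square mult.commute)
  finally show "0 \<le> Re (\<Sum>x\<in>A. \<Sum>y\<in>A. 1 * cnj (c x) * c y)"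
    by (simp only: Re_complex_of_real zero_le_power2)
qed simp

lemma psd_on_prod:
  assumes "finite I" "\<And>i. i \<in> I \<Longrightarrow> psd_on S (K i)"
  shows "psd_on S (\<lambda>x y. \<Prod>i\<in>I. K i x y)"
  using assms by (induction I rule: finite_induct) (auto intro: psd_on_one psd_on_mult)

lemma psd_on_image:
  fixes h :: "'a \<Rightarrow> 'b"
  assumes K: "psd_on T K" and h: "\<And>x. x \<in> S \<Longrightarrow> h x \<in> T"
  shows "psd_on S (\<lambda>x y. K (h x) (h y))"
  unfolding psd_on_def
proof (intro conjI ballI allI impI)
  show "K (h y) (h x) = cnj (K (h x) (h y))" if "x \<in> S" "y \<in> S" for x y
    by (intro psd_on_herm[OF K] h that)
  fix A :: "'a set" and c :: "'a \<Rightarrow> complex" assume A: "finite A" "A \<subseteq> S"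
  define d where "d = (\<lambda>z. \<Sum>x | x \<in> A \<and> h x = z. c x)"
  have "(\<Sum>x\<in>A. \<Sum>y\<in>A. K (h x) (h y) * cnj (c x) * c y)
      = (\<Sum>z\<in>h ` A. \<Sum>x | x \<in> A \<and> h x = z. \<Sum>w\<in>h ` A. \<Sum>y | y \<in> A \<and> h y = w.
           K (h x) (h y) * cnj (c x) * c y)"
    by (rule trans[OF sum.image_gen[OF A(1), of _ h]])
       (rule sum.cong[OF refl], rule sum.cong[OF refl], rule sum.image_gen[OF A(1)])
  also have "\<dots> = (\<Sum>z\<in>h ` A. \<Sum>x | x \<in> A \<and> h x = z. \<Sum>w\<in>h ` A. K z w * cnj (c x) * d w)"
    unfolding d_def by (intro sum.cong refl) (auto simp: sum_distrib_left intro!: sum.cong)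
  also have "\<dots> = (\<Sum>z\<in>h ` A. \<Sum>w\<in>h ` A. \<Sum>x | x \<in> A \<and> h x = z. K z w * cnj (c x) * d w)"
    by (intro sum.cong refl sum.swap)
  also have "\<dots> = (\<Sum>z\<in>h ` A. \<Sum>w\<in>h ` A. K z w * cnj (d z) * d w)"
  proof (intro sum.cong refl)
    fix z w
    have "cnj (d z) = (\<Sum>x | x \<in> A \<and> h x = z. cnj (c x))" by (simp add: d_def)
    then show "(\<Sum>x | x \<in> A \<and> h x = z. K z w * cnj (c x) * d w) = K z w * cnj (d z) * d w"
      by (simp only: sum_distrib_left sum_distrib_right)
  qed
  finally show "0 \<le> Re (\<Sum>x\<in>A. \<Sum>y\<in>A. K (h x) (h y) * cnj (c x) * c y)"
    using psd_on_pos[OF K, of "h ` A" d] A h by auto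
qed

section \<open>The one-particle space\<close>

abbreviation half_line :: "real measure" where
  "half_line \<equiv> restrict_space lborel {0..}"

text \<open>Elements of \<open>L\<^sup>2(\<real>\<^sub>+; 'a)\<close> are represented by functions; values on the negative half line
  are irrelevant, and functions that agree almost everywhere are identified later, when null vectors
  are divided out in the construction of the Fock space.\<close>

definition square_integrable ::
    "(real \<Rightarrow> 'a::{real_inner, banach, second_countable_topology}) set" where
  "square_integrable = {f. f \<in> borel_measurable half_line \<and>
                           integrable half_line (\<lambda>s. (norm (f s))\<^sup>2)}"

text \<open>The complexification of a real Hilbert space \<open>'k\<close> is \<open>'k \<times> 'k\<close>, the pair \<open>(x, y)\<close> standing
  for \<open>x + \<i>y\<close>. All complex inner products are conjugate linear in the first argument.\<close>

definition cplx_inner :: "'k::real_inner \<times> 'k \<Rightarrow> 'k \<times> 'k \<Rightarrow> complex" where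
  "cplx_inner z w = Complex (fst z \<bullet> fst w + snd z \<bullet> snd w) (fst z \<bullet> snd w - snd z \<bullet> fst w)"

definition l2_inner ::
    "(real \<Rightarrow> 'k::{real_inner, banach, second_countable_topology} \<times> 'k) \<Rightarrow> (real \<Rightarrow> 'k \<times> 'k) \<Rightarrow> complex"
  where "l2_inner f g = (LINT s|half_line. cplx_inner (f s) (g s))"

lemma cplx_inner_commute: "cplx_inner w z = cnj (cplx_inner z w)"
  by (simp add: cplx_inner_def complex_eq_iff inner_commute)

lemma psd_on_cplx_inner: "psd_on UNIV cplx_inner"
  unfolding psd_on_def
proof (intro conjI ballI allI impI)
  show "cplx_inner y x = cnj (cplx_inner x y)" for x y :: "'a \<times> 'a" by (rule cplx_inner_commute)
  fix A :: "('a \<times> 'a) set" and c :: "'a \<times> 'a \<Rightarrow> complex"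
  define u where "u = (\<Sum>x\<in>A. Re (c x) *\<^sub>R fst x - Im (c x) *\<^sub>R snd x)"
  define v where "v = (\<Sum>x\<in>A. Re (c x) *\<^sub>R snd x + Im (c x) *\<^sub>R fst x)"
  have "u \<bullet> u + v \<bullet> v = (\<Sum>x\<in>A. \<Sum>y\<in>A. Re (cplx_inner x y * cnj (c x) * c y))"
    unfolding u_def v_def inner_sum_left inner_sum_right sum.distrib[symmetric]
    by (intro sum.cong refl)
      (simp add: cplx_inner_def inner_add_left inner_add_right inner_diff_left inner_diff_right
        algebra_simps inner_commute)
  then show "0 \<le> Re (\<Sum>x\<in>A. \<Sum>y\<in>A. cplx_inner x y * cnj (c x) * c y)"
    by (simp only: Re_sum) (metis add_nonneg_nonneg inner_ge_zero)
qed

lemma cplx_inner_bound: "cmod (cplx_inner z w) \<le> 2 * ((norm z)\<^sup>2 + (norm w)\<^sup>2)"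
proof -
  have a: "\<bar>x \<bullet> y\<bar> \<le> ((norm x)\<^sup>2 + (norm y)\<^sup>2) / 2" for x y :: 'a
  proof -
    have "\<bar>x \<bullet> y\<bar> \<le> norm x * norm y" by (rule Cauchy_Schwarz_ineq2)
    moreover have "0 \<le> (norm x - norm y)\<^sup>2" by simp
    ultimately show ?thesis by (simp add: power2_diff field_simps)
  qed
  have n: "(norm p)\<^sup>2 = (norm (fst p))\<^sup>2 + (norm (snd p))\<^sup>2" for p :: "'a \<times> 'a"
    by (simp add: norm_prod_def)
  have "cmod (cplx_inner z w) \<le> \<bar>Re (cplx_inner z w)\<bar> + \<bar>Im (cplx_inner z w)\<bar>" by (rule cmod_le)
  also have "\<dots> \<le> \<bar>fst z \<bullet> fst w\<bar> + \<bar>snd z \<bullet> snd w\<bar> + (\<bar>fst z \<bullet> snd w\<bar> + \<bar>snd z \<bullet> fst w\<bar>)"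
    by (simp add: cplx_inner_def)
  also have "\<dots> \<le> 2 * ((norm z)\<^sup>2 + (norm w)\<^sup>2)"
    using a[of "fst z" "fst w"] a[of "snd z" "snd w"] a[of "fst z" "snd w"] a[of "snd z" "fst w"]
    unfolding n by (simp add: field_simps)
  finally show ?thesis .
qed

lemma integrable_cplx_inner:
  assumes "f \<in> square_integrable" "g \<in> square_integrable"
  shows "integrable half_line (\<lambda>s. cplx_inner (f s) (g s))"
proof (rule Bochner_Integration.integrable_bound)
  show "integrable half_line (\<lambda>s. 2 * ((norm (f s))\<^sup>2 + (norm (g s))\<^sup>2))"
    using assms by (simp add: square_integrable_def)
  have [measurable]: "f \<in> borel_measurable half_line" "g \<in> borel_measurable half_line"
    using assms by (simp_all add: square_integrable_def)
  have m: "(\<lambda>s. fst (h s)) \<in> borel_measurable half_line" "(\<lambda>s. snd (h s)) \<in> borel_measurable half_line"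
    if "h \<in> borel_measurable half_line" for h :: "real \<Rightarrow> 'a \<times> 'a"
    using that by (auto intro!: borel_measurable_continuous_on[where f = fst]
        borel_measurable_continuous_on[where f = snd] continuous_intros)
  have [measurable]: "(\<lambda>s. fst (f s)) \<in> borel_measurable half_line" "(\<lambda>s. snd (f s)) \<in> borel_measurable half_line"
    "(\<lambda>s. fst (g s)) \<in> borel_measurable half_line" "(\<lambda>s. snd (g s)) \<in> borel_measurable half_line"
    by (auto intro!: m)
  show "(\<lambda>s. cplx_inner (f s) (g s)) \<in> borel_measurable half_line"
    unfolding cplx_inner_def borel_measurable_complex_iff by simp
  show "AE s in half_line. norm (cplx_inner (f s) (g s)) \<le> norm (2 * ((norm (f s))\<^sup>2 + (norm (g s))\<^sup>2))"
    using cplx_inner_bound by (intro AE_I2) (simp add: order_trans[OF _ abs_ge_self])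
qed

lemma psd_on_l2_inner: "psd_on square_integrable l2_inner"
  unfolding psd_on_def
proof (intro conjI ballI allI impI)
  show "l2_inner g f = cnj (l2_inner f g)" if "f \<in> square_integrable" "g \<in> square_integrable"
    for f g :: "real \<Rightarrow> 'a \<times> 'a"
  proof -
    have "l2_inner g f = (LINT s|half_line. cnj (cplx_inner (f s) (g s)))"
      unfolding l2_inner_def
      by (rule Bochner_Integration.integral_cong[OF refl]) (rule cplx_inner_commute)
    then show ?thesis by (simp add: l2_inner_def)
  qed
  fix A :: "(real \<Rightarrow> 'a \<times> 'a) set" and c :: "(real \<Rightarrow> 'a \<times> 'a) \<Rightarrow> complex"
  assume A: "finite A" "A \<subseteq> square_integrable"
  have i: "integrable half_line (\<lambda>s. cplx_inner (f s) (g s) * cnj (c f) * c g)"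
    if "f \<in> A" "g \<in> A" for f g
    using integrable_cplx_inner[of f g] that A by (auto simp: subset_eq)
  have "(\<Sum>f\<in>A. \<Sum>g\<in>A. l2_inner f g * cnj (c f) * c g)
      = (\<Sum>f\<in>A. \<Sum>g\<in>A. LINT s|half_line. cplx_inner (f s) (g s) * cnj (c f) * c g)"
    by (intro sum.cong refl) (simp add: l2_inner_def)
  also have "\<dots> = (LINT s|half_line. (\<Sum>f\<in>A. \<Sum>g\<in>A. cplx_inner (f s) (g s) * cnj (c f) * c g))"
    using i by (simp add: Bochner_Integration.integral_sum Bochner_Integration.integrable_sum)
  finally have "Re (\<Sum>f\<in>A. \<Sum>g\<in>A. l2_inner f g * cnj (c f) * c g)
      = (LINT s|half_line. Re (\<Sum>f\<in>A. \<Sum>g\<in>A. cplx_inner (f s) (g s) * cnj (c f) * c g))"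
    using i by (simp only: integral_Re Bochner_Integration.integrable_sum)
  also have "\<dots> \<ge> 0"
  proof (rule Bochner_Integration.integral_nonneg)
    fix s
    have "psd_on A (\<lambda>f g. cplx_inner (f s) (g s))"
      by (rule psd_on_image[OF psd_on_cplx_inner]) simp
    from psd_on_pos[OF this A(1) subset_refl]
    show "0 \<le> Re (\<Sum>f\<in>A. \<Sum>g\<in>A. cplx_inner (f s) (g s) * cnj (c f) * c g)" .
  qed
  finally show "0 \<le> Re (\<Sum>f\<in>A. \<Sum>g\<in>A. l2_inner f g * cnj (c f) * c g)" .
qed

section \<open>The antisymmetric Fock space\<close>

text \<open>\<open>wedge_inner [f\<^sub>1, \<dots>, f\<^sub>m] [g\<^sub>1, \<dots>, g\<^sub>m]\<close> is the inner product of \<open>f\<^sub>1 \<and> \<dots> \<and> f\<^sub>m\<close> and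
  \<open>g\<^sub>1 \<and> \<dots> \<and> g\<^sub>m\<close>, i.e. the determinant of the matrix of inner products; this is the normalisation for
  which the creation operators satisfy the canonical anticommutation relations. The empty list
  corresponds to the vacuum vector.\<close>

definition wedge_inner ::
    "(real \<Rightarrow> 'k::{real_inner, banach, second_countable_topology} \<times> 'k) list \<Rightarrow>
     (real \<Rightarrow> 'k \<times> 'k) list \<Rightarrow> complex" where
  "wedge_inner fs gs =
     (if length fs = length gs
      then \<Sum>p | p permutes {..<length fs}.
             of_int (sign p) * (\<Prod>i<length fs. l2_inner (fs ! i) (gs ! p i))
      else 0)"

lemma psd_on_wedge_inner_length:
  "psd_on {fs \<in> lists square_integrable. length fs = m} wedge_inner"
proof -
  let ?P = "{p. p permutes {..<m}}"
  let ?S = "{fs \<in> lists square_integrable. length fs = m} :: (real \<Rightarrow> 'a \<times> 'a) list set"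
  define G where "G = (\<lambda>(xq :: (real \<Rightarrow> 'a \<times> 'a) list \<times> (nat \<Rightarrow> nat)) yp. \<Prod>i<m. l2_inner (fst xq ! snd xq i) (fst yp ! snd yp i))"
  have fP: "finite ?P" by (rule finite_permutations) simp
  have psdG: "psd_on (?S \<times> ?P) G"
    unfolding G_def
  proof (rule psd_on_prod)
    fix i assume i: "i \<in> {..<m}"
    have nth_in: "fs ! p i \<in> square_integrable"
      if "fs \<in> lists square_integrable" "length fs = m" "p permutes {..<m}"
      for fs :: "(real \<Rightarrow> 'a \<times> 'a) list" and p
    proof -
      have "p i < m" using permutes_in_image[OF that(3), of i] i by simp
      then show ?thesis using that(1,2) nth_mem[of "p i" fs] by auto
    qed
    show "psd_on (?S \<times> ?P) (\<lambda>x y. l2_inner (fst x ! snd x i) (fst y ! snd y i))"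
    proof (rule psd_on_image[OF psd_on_l2_inner, where h = "\<lambda>z. fst z ! snd z i"])
      fix z assume "z \<in> ?S \<times> ?P"
      then show "fst z ! snd z i \<in> square_integrable"
        by (intro nth_in) (simp_all add: mem_Times_iff)
    qed
  qed simp
  have sum_G: "(\<Sum>q\<in>?P. \<Sum>p\<in>?P. G (x, q) (y, p) * of_int (sign q) * of_int (sign p))
      = fact m * wedge_inner x y" if "x \<in> ?S" "y \<in> ?S" for x y
  proof -
    have "(\<Sum>p\<in>?P. G (x, q) (y, p) * of_int (sign q) * of_int (sign p)) = wedge_inner x y"
      if q: "q permutes {..<m}" for q
    proof -
      have "wedge_inner x y = (\<Sum>p\<in>?P. of_int (sign p) * (\<Prod>i<m. l2_inner (x ! i) (y ! p i)))"
        using \<open>x \<in> ?S\<close> \<open>y \<in> ?S\<close> by (simp add: wedge_inner_def)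
      also have "\<dots> = (\<Sum>p\<in>?P. of_int (sign (p \<circ> inv q)) * (\<Prod>i<m. l2_inner (x ! i) (y ! (p \<circ> inv q) i)))"
        by (rule sum_permutations_compose_right[OF permutes_inv[OF q]])
      also have "\<dots> = (\<Sum>p\<in>?P. G (x, q) (y, p) * of_int (sign q) * of_int (sign p))"
      proof (rule sum.cong[OF refl])
        fix p assume "p \<in> ?P"
        then have p: "p permutes {..<m}" by simp
        have perm: "permutation p" "permutation q"
          using p q by (auto intro: permutation_permutes[THEN iffD2])
        have "sign (p \<circ> inv q) = sign q * sign p"
          using perm by (simp add: sign_compose sign_inverse permutation_inverse mult.commute)
        moreover have "(\<Prod>i<m. l2_inner (x ! i) (y ! (p \<circ> inv q) i)) = (\<Prod>i<m. l2_inner (x ! q i) (y ! p i))"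
          by (subst prod.permute[OF q]) (simp add: comp_def permutes_inverses[OF q])
        ultimately show "of_int (sign (p \<circ> inv q)) * (\<Prod>i<m. l2_inner (x ! i) (y ! (p \<circ> inv q) i))
            = G (x, q) (y, p) * of_int (sign q) * of_int (sign p)"
          by (simp add: G_def)
      qed
      finally show ?thesis by simp
    qed
    then show ?thesis by (simp add: card_permutations)
  qed
  show ?thesis
    unfolding psd_on_def
  proof (intro conjI ballI allI impI)
    fix x y assume xy: "x \<in> ?S" "y \<in> ?S"
    have "fact m * wedge_inner y x
        = (\<Sum>q\<in>?P. \<Sum>p\<in>?P. cnj (G (x, p) (y, q)) * of_int (sign q) * of_int (sign p))"
      unfolding sum_G[OF xy(2,1), symmetric]
    proof (intro sum.cong refl)
      fix q p assume "q \<in> ?P" "p \<in> ?P"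
      then have "G (y, q) (x, p) = cnj (G (x, p) (y, q))"
        using xy by (intro psd_on_herm[OF psdG]) auto
      then show "G (y, q) (x, p) * of_int (sign q) * of_int (sign p)
          = cnj (G (x, p) (y, q)) * of_int (sign q) * of_int (sign p)" by simp
    qed
    also have "\<dots> = (\<Sum>p\<in>?P. \<Sum>q\<in>?P. cnj (G (x, p) (y, q) * of_int (sign p) * of_int (sign q)))"
      by (subst sum.swap) (simp add: mult_ac)
    also have "\<dots> = cnj (fact m * wedge_inner x y)"
      unfolding sum_G[OF xy, symmetric] by simp
    finally show "wedge_inner y x = cnj (wedge_inner x y)" by simp
  next
    fix A :: "(real \<Rightarrow> 'a \<times> 'a) list set" and c :: "(real \<Rightarrow> 'a \<times> 'a) list \<Rightarrow> complex"
    assume A: "finite A" "A \<subseteq> ?S"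
    define d where "d = (\<lambda>xq :: (real \<Rightarrow> 'a \<times> 'a) list \<times> (nat \<Rightarrow> nat). c (fst xq) * of_int (sign (snd xq)) :: complex)"
    have "0 \<le> Re (\<Sum>xq\<in>A \<times> ?P. \<Sum>yp\<in>A \<times> ?P. G xq yp * cnj (d xq) * d yp)"
      using A fP by (intro psd_on_pos[OF psdG]) auto
    also have "(\<Sum>xq\<in>A \<times> ?P. \<Sum>yp\<in>A \<times> ?P. G xq yp * cnj (d xq) * d yp)
        = (\<Sum>x\<in>A. \<Sum>q\<in>?P. \<Sum>y\<in>A. \<Sum>p\<in>?P. G (x, q) (y, p) * cnj (d (x, q)) * d (y, p))"
      by (simp add: sum.cartesian_product')
    also have "\<dots> = (\<Sum>x\<in>A. \<Sum>y\<in>A. \<Sum>q\<in>?P. \<Sum>p\<in>?P. G (x, q) (y, p) * cnj (d (x, q)) * d (y, p))"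
      by (rule sum.cong[OF refl], rule sum.swap)
    also have "\<dots> = (\<Sum>x\<in>A. \<Sum>y\<in>A. (\<Sum>q\<in>?P. \<Sum>p\<in>?P. G (x, q) (y, p) * of_int (sign q) * of_int (sign p))
        * (cnj (c x) * c y))"
      unfolding sum_distrib_right by (intro sum.cong refl) (simp add: d_def mult_ac)
    also have "\<dots> = (\<Sum>x\<in>A. \<Sum>y\<in>A. fact m * wedge_inner x y * (cnj (c x) * c y))"
      using A(2) sum_G by (intro sum.cong refl) (auto simp: subset_eq)
    also have "\<dots> = of_real (fact m) * (\<Sum>x\<in>A. \<Sum>y\<in>A. wedge_inner x y * cnj (c x) * c y)"
      by (simp add: sum_distrib_left mult_ac)
    finally have "0 \<le> fact m * Re (\<Sum>x\<in>A. \<Sum>y\<in>A. wedge_inner x y * cnj (c x) * c y)"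
      by (simp only: Re_complex_of_real times_complex.sel Im_complex_of_real mult_zero_left diff_zero)
    then show "0 \<le> Re (\<Sum>x\<in>A. \<Sum>y\<in>A. wedge_inner x y * cnj (c x) * c y)"
      by (meson fact_gt_zero not_le zero_le_mult_iff)
  qed
qed

lemma psd_on_wedge_inner: "psd_on (lists square_integrable) wedge_inner"
  unfolding psd_on_def
proof (intro conjI ballI allI impI)
  fix x y :: "(real \<Rightarrow> 'a \<times> 'a) list"
  assume xy: "x \<in> lists square_integrable" "y \<in> lists square_integrable"
  show "wedge_inner y x = cnj (wedge_inner x y)"
  proof (cases "length x = length y")
    case True
    then show ?thesis 
      using xy by (intro psd_on_herm[OF psd_on_wedge_inner_length[of "length x"]]) auto
  qed (simp add: wedge_inner_def)
next
  fix A :: "(real \<Rightarrow> 'a \<times> 'a) list set" and c :: "(real \<Rightarrow> 'a \<times> 'a) list \<Rightarrow> complex"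
  assume A: "finite A" "A \<subseteq> lists square_integrable"
  define M where "M = length ` A"
  define A' where "A' = (\<lambda>m. {x \<in> A. length x = m})"
  let ?t = "\<lambda>(x :: (real \<Rightarrow> 'a \<times> 'a) list) y. wedge_inner x y * cnj (c x) * c y"
  have fM: "finite M" using A by (simp add: M_def)
  have "(\<Sum>x\<in>A. \<Sum>y\<in>A. ?t x y) = (\<Sum>m\<in>M. \<Sum>x\<in>A' m. \<Sum>y\<in>A. ?t x y)"
    unfolding M_def A'_def by (rule sum.image_gen[OF A(1)])
  also have "\<dots> = (\<Sum>m\<in>M. \<Sum>x\<in>A' m. \<Sum>y\<in>A' m. ?t x y)"
    using A(1) by (intro sum.cong refl sum.mono_neutral_right) (auto simp: A'_def wedge_inner_def)
  finally have "Re (\<Sum>x\<in>A. \<Sum>y\<in>A. ?t x y) = (\<Sum>m\<in>M. Re (\<Sum>x\<in>A' m. \<Sum>y\<in>A' m. ?t x y))"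
    by (simp only: Re_sum)
  also have "\<dots> \<ge> 0"
    using A by (intro sum_nonneg psd_on_pos[OF psd_on_wedge_inner_length]) (auto simp: A'_def)
  finally show "0 \<le> Re (\<Sum>x\<in>A. \<Sum>y\<in>A. ?t x y)" .
qed

interpretation fock: psd_form "finsupp (lists square_integrable)" "kernel_form wedge_inner"
  by (rule psd_form_kernel[OF psd_on_wedge_inner])

quotient_type (overloaded) 'k fock =
    "nat \<Rightarrow> (real \<Rightarrow> 'k::{real_inner, banach, second_countable_topology} \<times> 'k) list \<Rightarrow> complex" /
    partial: "null_equiv (finsupp (lists square_integrable)) (kernel_form wedge_inner)"
  by (rule fock.part_equivp_null_equiv)

class complex_inner = real_inner +
  fixes scaleC :: "complex \<Rightarrow> 'a \<Rightarrow> 'a" (infixr "*\<^sub>C" 75)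
    and cinner :: "'a \<Rightarrow> 'a \<Rightarrow> complex"
  assumes scaleC_add_right: "c *\<^sub>C (x + y) = c *\<^sub>C x + c *\<^sub>C y"
    and scaleC_add_left: "(c + d) *\<^sub>C x = c *\<^sub>C x + d *\<^sub>C x"
    and scaleC_scaleC: "c *\<^sub>C d *\<^sub>C x = (c * d) *\<^sub>C x"
    and scaleR_scaleC: "r *\<^sub>R x = complex_of_real r *\<^sub>C x"
    and cinner_commute: "cinner x y = cnj (cinner y x)"
    and cinner_add_right: "cinner x (y + z) = cinner x y + cinner x z"
    and cinner_scaleC_right: "cinner x (c *\<^sub>C y) = c * cinner x y"
    and inner_cinner: "x \<bullet> y = Re (cinner x y)"

class chilbert_space = complex_inner + complete_space

lemma fock_rel_refl_iff:
  "null_equiv (finsupp (lists square_integrable)) (kernel_form wedge_inner) x x \<longleftrightarrow>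
   x \<in> cauchy_seqs (finsupp (lists square_integrable)) (kernel_form wedge_inner)"
  by (simp add: fock.null_equiv_iff fock.nrm_zero)

instantiation fock :: ("{real_inner, banach, second_countable_topology}") complex_inner
begin

lift_definition zero_fock :: "'a fock" is "\<lambda>_ _. 0"
  using fock.const_cauchy[OF fock.V_zero] by (simp add: fock_rel_refl_iff)

lift_definition plus_fock :: "'a fock \<Rightarrow> 'a fock \<Rightarrow> 'a fock" is "\<lambda>x y n i. x n i + y n i"
  by (rule fock.null_equiv_add)

lift_definition scaleC_fock :: "complex \<Rightarrow> 'a fock \<Rightarrow> 'a fock" is "\<lambda>c x n i. c * x n i"
  by (rule fock.null_equiv_mult)

lift_definition cinner_fock :: "'a fock \<Rightarrow> 'a fock \<Rightarrow> complex" is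
  "\<lambda>x y. lim (\<lambda>n. kernel_form wedge_inner (x n) (y n))"
  by (rule fock.B_lim_cong)

definition uminus_fock :: "'a fock \<Rightarrow> 'a fock" where "uminus_fock x = (-1) *\<^sub>C x"
definition minus_fock :: "'a fock \<Rightarrow> 'a fock \<Rightarrow> 'a fock" where "minus_fock x y = x + - y"
definition scaleR_fock :: "real \<Rightarrow> 'a fock \<Rightarrow> 'a fock" where
  "scaleR_fock r x = complex_of_real r *\<^sub>C x"
definition inner_fock :: "'a fock \<Rightarrow> 'a fock \<Rightarrow> real" where "inner_fock x y = Re (cinner x y)"
definition norm_fock :: "'a fock \<Rightarrow> real" where "norm_fock x = sqrt (x \<bullet> x)"
definition dist_fock :: "'a fock \<Rightarrow> 'a fock \<Rightarrow> real" where "dist_fock x y = norm (x - y)"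
definition sgn_fock :: "'a fock \<Rightarrow> 'a fock" where "sgn_fock x = inverse (norm x) *\<^sub>R x"
definition uniformity_fock :: "('a fock \<times> 'a fock) filter" where
  "uniformity_fock = (INF e\<in>{0<..}. principal {(x, y). dist x y < e})"
definition open_fock :: "'a fock set \<Rightarrow> bool" where
  "open_fock U \<longleftrightarrow> (\<forall>x\<in>U. eventually (\<lambda>(x', y). x' = x \<longrightarrow> y \<in> U) uniformity)"

instance
proof
  let ?c = "cauchy_seqs (finsupp (lists square_integrable)) (kernel_form wedge_inner)"
  let ?r = "null_equiv (finsupp (lists square_integrable)) (kernel_form wedge_inner)"
  have r: "?r x y" if "x = y" "x \<in> ?c" for x y using that by (simp add: fock_rel_refl_iff)
  note c = fock_rel_refl_iff fock.cauchy_add fock.cauchy_mult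
  fix x y z :: "'a fock" and c d :: complex and a b :: real
  show add_assoc: "x + y + z = x + (y + z)" by transfer (auto intro!: r simp: c add.assoc)
  show add_comm: "x + y = y + x" by transfer (auto intro!: r simp: c add.commute)
  show zero: "0 + x = x" by transfer (auto intro!: r simp: c)
  show "x - y = x + - y" by (simp add: minus_fock_def)
  show one: "1 *\<^sub>R x = x" unfolding scaleR_fock_def by transfer (auto intro!: r simp: c)
  show sr: "c *\<^sub>C (x + y) = c *\<^sub>C x + c *\<^sub>C y" for c :: complex and x y :: "'a fock"
    by transfer (auto intro!: r simp: c distrib_left)
  show sl: "(c + d) *\<^sub>C x = c *\<^sub>C x + d *\<^sub>C x" for c d :: complex
    by transfer (auto intro!: r simp: c distrib_right)
  show ss: "c *\<^sub>C d *\<^sub>C x = (c * d) *\<^sub>C x" for c d :: complex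
    by transfer (auto intro!: r simp: c mult.assoc)
  show "a *\<^sub>R x = complex_of_real a *\<^sub>C x" by (rule scaleR_fock_def)
  have z0: "0 *\<^sub>C x = 0" for x :: "'a fock"
    by transfer (auto intro!: r simp: c fock.const_cauchy[OF fock.V_zero])
  have one': "1 *\<^sub>C x = x" using one by (simp add: scaleR_fock_def)
  show "- x + x = 0"
    using sl[of "-1" 1] z0[of x] one' by (simp add: uminus_fock_def)
  show "a *\<^sub>R (x + y) = a *\<^sub>R x + a *\<^sub>R y" by (simp add: scaleR_fock_def sr)
  show "(a + b) *\<^sub>R x = a *\<^sub>R x + b *\<^sub>R x" by (simp add: scaleR_fock_def sl)
  show "a *\<^sub>R b *\<^sub>R x = (a * b) *\<^sub>R x" by (simp add: scaleR_fock_def ss)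
  have com: "cinner x y = cnj (cinner y x)" for x y :: "'a fock"
  proof (transfer fixing: )
    fix x y :: "nat \<Rightarrow> (real \<Rightarrow> 'a \<times> 'a) list \<Rightarrow> complex"
    assume "?r x x" "?r y y"
    then have xy: "x \<in> ?c" "y \<in> ?c" by (simp_all add: c)
    have "(\<lambda>n. kernel_form wedge_inner (x n) (y n)) \<longlonglongrightarrow> cnj (lim (\<lambda>n. kernel_form wedge_inner (y n) (x n)))"
      using tendsto_cnj[OF fock.B_lim[OF xy(2,1)]]
        fock.B_herm[OF fock.cauchy_V[OF xy(2)] fock.cauchy_V[OF xy(1)]] by simp
    then show "lim (\<lambda>n. kernel_form wedge_inner (x n) (y n))
        = cnj (lim (\<lambda>n. kernel_form wedge_inner (y n) (x n)))" by (rule limI)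
  qed
  show "cinner x y = cnj (cinner y x)" by (rule com)
  show add: "cinner x (y + z) = cinner x y + cinner x z" for x y z :: "'a fock"
  proof transfer
    fix x y z :: "nat \<Rightarrow> (real \<Rightarrow> 'a \<times> 'a) list \<Rightarrow> complex"
    assume "?r x x" "?r y y" "?r z z"
    then have xy: "x \<in> ?c" "y \<in> ?c" "z \<in> ?c" by (simp_all add: c)
    note v = xy[THEN fock.cauchy_V]
    show "lim (\<lambda>n. kernel_form wedge_inner (x n) (\<lambda>i. y n i + z n i))
        = lim (\<lambda>n. kernel_form wedge_inner (x n) (y n)) + lim (\<lambda>n. kernel_form wedge_inner (x n) (z n))"
      unfolding fock.B_add[OF v] by (rule limI[OF tendsto_add]) (intro fock.B_lim xy)+
  qed
  show mul: "cinner x (c *\<^sub>C y) = c * cinner x y" for c and x y :: "'a fock"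
  proof transfer
    fix c and x y :: "nat \<Rightarrow> (real \<Rightarrow> 'a \<times> 'a) list \<Rightarrow> complex"
    assume "?r x x" "?r y y"
    then have xy: "x \<in> ?c" "y \<in> ?c" by (simp_all add: c)
    note v = xy[THEN fock.cauchy_V]
    show "lim (\<lambda>n. kernel_form wedge_inner (x n) (\<lambda>i. c * y n i))
        = c * lim (\<lambda>n. kernel_form wedge_inner (x n) (y n))"
      unfolding fock.B_mult[OF v] by (rule limI[OF tendsto_mult_left]) (intro fock.B_lim xy)
  qed
  show "x \<bullet> y = Re (cinner x y)" by (rule inner_fock_def)
  show "x \<bullet> y = y \<bullet> x" using com[of x y] by (simp add: inner_fock_def)
  show "(x + y) \<bullet> z = x \<bullet> z + y \<bullet> z"
    using com[of "x + y" z] com[of x z] com[of y z] add[of z x y] by (simp add: inner_fock_def)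
  show "(a *\<^sub>R x) \<bullet> y = a * (x \<bullet> y)"
    using com[of "complex_of_real a *\<^sub>C x" y] com[of x y] mul[of y "complex_of_real a" x]
    by (simp add: inner_fock_def scaleR_fock_def)
  have pos: "0 \<le> Re (cinner x x) \<and> (cinner x x = 0 \<longrightarrow> x = 0) \<and> Im (cinner x x) = 0"
  proof transfer
    fix x :: "nat \<Rightarrow> (real \<Rightarrow> 'a \<times> 'a) list \<Rightarrow> complex"
    assume "?r x x"
    then have x: "x \<in> ?c" by (simp add: c)
    note v = fock.cauchy_V[OF x]
    let ?l = "lim (\<lambda>n. kernel_form wedge_inner (x n) (x n))"
    have l: "(\<lambda>n. kernel_form wedge_inner (x n) (x n)) \<longlonglongrightarrow> ?l" by (rule fock.B_lim[OF x x])
    have im: "Im (kernel_form wedge_inner (x n) (x n)) = 0" for n by (simp add: fock.B_self[OF v])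
    have "0 \<le> Re ?l" by (rule LIMSEQ_le_const[OF tendsto_Re[OF l]]) (use fock.B_pos[OF v] in blast)
    moreover have "Im ?l = 0"
      using LIMSEQ_unique[OF tendsto_Im[OF l, unfolded im] tendsto_const] .
    moreover have "?r x (\<lambda>_ _. 0)" if "?l = 0"
    proof -
      have "(\<lambda>n. Re (kernel_form wedge_inner (x n - (\<lambda>_. 0)) (x n - (\<lambda>_. 0)))) \<longlonglongrightarrow> 0"
      proof -
        have "x n - (\<lambda>_. 0) = x n" for n by (auto simp: fun_eq_iff)
        then show ?thesis using tendsto_Re[OF l] that by simp
      qed
      then show ?thesis unfolding null_equiv_def
        using x fock.const_cauchy[OF fock.V_zero] by blast
    qed
    ultimately show "0 \<le> Re ?l \<and> (?l = 0 \<longrightarrow> ?r x (\<lambda>_ _. 0)) \<and> Im ?l = 0" by blast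
  qed
  show "0 \<le> x \<bullet> x" using pos by (simp add: inner_fock_def)
  have c0: "cinner x 0 = 0" using mul[of x 0 x] z0[of x] by simp
  show "(x \<bullet> x = 0) = (x = 0)" using pos c0 by (auto simp: inner_fock_def complex_eq_iff)
  show "norm x = sqrt (x \<bullet> x)" by (rule norm_fock_def)
  show "dist x y = norm (x - y)" by (rule dist_fock_def)
  show "sgn x = inverse (norm x) *\<^sub>R x" by (rule sgn_fock_def)
  show "uniformity = (INF e\<in>{0<..}. principal {(x :: 'a fock, y). dist x y < e})"
    by (rule uniformity_fock_def)
  show "open U \<longleftrightarrow> (\<forall>x\<in>U. \<forall>\<^sub>F (x', y) in uniformity. x' = x \<longrightarrow> y \<in> U)" for U :: "'a fock set"
    by (rule open_fock_def)
qed

end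

text \<open>\<open>wedge [f\<^sub>1, \<dots>, f\<^sub>m]\<close> is \<open>f\<^sub>1 \<and> \<dots> \<and> f\<^sub>m\<close>; it is meaningful only for square integrable
  \<open>f\<^sub>i\<close>.\<close>

definition wedge ::
    "(real \<Rightarrow> 'k::{real_inner, banach, second_countable_topology} \<times> 'k) list \<Rightarrow> 'k fock" where
  "wedge fs = abs_fock (\<lambda>_ gs. if gs = fs then 1 else 0)"

abbreviation fock_embed ::
    "((real \<Rightarrow> 'k::{real_inner, banach, second_countable_topology} \<times> 'k) list \<Rightarrow> complex) \<Rightarrow> 'k fock"
  where "fock_embed v \<equiv> abs_fock (\<lambda>_. v)"

lemma abs_fock_minus:
  assumes x: "x \<in> cauchy_seqs (finsupp (lists square_integrable)) (kernel_form wedge_inner)"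
    and y: "y \<in> cauchy_seqs (finsupp (lists square_integrable)) (kernel_form wedge_inner)"
  shows "abs_fock x - abs_fock y = abs_fock (\<lambda>n. x n - y n)"
proof -
  have "abs_fock x - abs_fock y = abs_fock (\<lambda>n i. x n i + (-1) * y n i)"
    using x y fock.cauchy_mult[OF y, of "-1"]
    by (simp add: minus_fock_def uminus_fock_def scaleC_fock.abs_eq plus_fock.abs_eq fock_rel_refl_iff
        del: mult_minus1)
  also have "(\<lambda>n i. x n i + (-1) * y n i) = (\<lambda>n. x n - y n)" by (auto simp: fun_eq_iff)
  finally show ?thesis .
qed

lemma cauchy_seqs_minus:
  assumes x: "x \<in> cauchy_seqs (finsupp (lists square_integrable)) (kernel_form wedge_inner)"
    and y: "y \<in> cauchy_seqs (finsupp (lists square_integrable)) (kernel_form wedge_inner)"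
  shows "(\<lambda>n. x n - y n) \<in> cauchy_seqs (finsupp (lists square_integrable)) (kernel_form wedge_inner)"
proof -
  have "(\<lambda>n. x n - y n) = (\<lambda>n i. x n i + (-1) * y n i)" by (auto simp: fun_eq_iff)
  then show ?thesis using fock.cauchy_add[OF x fock.cauchy_mult[OF y, of "-1"]] by simp
qed

lemma norm_abs_fock:
  assumes x: "x \<in> cauchy_seqs (finsupp (lists square_integrable)) (kernel_form wedge_inner)"
  shows "(\<lambda>n. fock.nrm (x n)) \<longlonglongrightarrow> norm (abs_fock x)"
proof -
  have "cinner (abs_fock x) (abs_fock x) = lim (\<lambda>n. kernel_form wedge_inner (x n) (x n))"
    using x by (simp add: cinner_fock.abs_eq fock_rel_refl_iff)
  then have "norm (abs_fock x) = sqrt (Re (lim (\<lambda>n. kernel_form wedge_inner (x n) (x n))))"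
    by (simp add: norm_fock_def inner_fock_def)
  then show ?thesis
    unfolding fock.nrm_def using tendsto_real_sqrt[OF tendsto_Re[OF fock.B_lim[OF x x]]] by simp
qed

lemma dist_fock_embed:
  assumes "v \<in> finsupp (lists square_integrable)" "w \<in> finsupp (lists square_integrable)"
  shows "dist (fock_embed v) (fock_embed w) = fock.nrm (v - w)"
proof -
  note c = fock.const_cauchy[OF assms(1)] fock.const_cauchy[OF assms(2)]
  have "(\<lambda>n. fock.nrm (v - w)) \<longlonglongrightarrow> norm (abs_fock (\<lambda>n. v - w))"
    by (rule norm_abs_fock) (rule cauchy_seqs_minus[OF c])
  then have "fock.nrm (v - w) = norm (abs_fock (\<lambda>n. v - w))" by (simp add: LIMSEQ_const_iff)
  then show ?thesis by (simp add: dist_fock_def abs_fock_minus[OF c])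
qed

lemma fock_embed_tendsto:
  assumes x: "x \<in> cauchy_seqs (finsupp (lists square_integrable)) (kernel_form wedge_inner)"
  shows "(\<lambda>n. fock_embed (x n)) \<longlonglongrightarrow> abs_fock x"
  unfolding LIMSEQ_def
proof (intro allI impI)
  fix e :: real assume "e > 0"
  then have e2: "e / 2 > 0" by simp
  obtain N where N: "\<And>m n. m \<ge> N \<Longrightarrow> n \<ge> N \<Longrightarrow> fock.nrm (x m - x n) < e / 2"
    using x e2 unfolding fock.cauchy_seqs_iff by blast
  have "dist (fock_embed (x n)) (abs_fock x) < e" if n: "n \<ge> N" for n
  proof -
    note c = fock.const_cauchy[OF fock.cauchy_V[OF x], of n]
    have "(\<lambda>m. fock.nrm (x n - x m)) \<longlonglongrightarrow> dist (fock_embed (x n)) (abs_fock x)"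
      using norm_abs_fock[OF cauchy_seqs_minus[OF c x]] by (simp add: dist_fock_def abs_fock_minus[OF c x])
    then have "dist (fock_embed (x n)) (abs_fock x) \<le> e / 2"
      by (rule LIMSEQ_le_const2) (use N[OF n] less_imp_le in blast)
    then show ?thesis using \<open>e > 0\<close> by simp
  qed
  then show "\<exists>N. \<forall>n\<ge>N. dist (fock_embed (x n)) (abs_fock x) < e" by blast
qed

lemma abs_fock_surj:
  "\<exists>x\<in>cauchy_seqs (finsupp (lists square_integrable)) (kernel_form wedge_inner). X = abs_fock x"
proof
  show "X = abs_fock (rep_fock X)" by (simp add: Quotient_abs_rep[OF Quotient_fock])
  show "rep_fock X \<in> cauchy_seqs (finsupp (lists square_integrable)) (kernel_form wedge_inner)"
    using Quotient_rep_reflp[OF Quotient_fock, of X] by (simp only: fock_rel_refl_iff)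
qed

instance fock :: ("{real_inner, banach, second_countable_topology}") chilbert_space
proof
  fix X :: "nat \<Rightarrow> 'a fock" assume X: "Cauchy X"
  have "\<exists>v\<in>finsupp (lists square_integrable). dist (fock_embed v) (X j) < inverse (real (Suc j))" for j
  proof -
    obtain x where x: "x \<in> cauchy_seqs (finsupp (lists square_integrable)) (kernel_form wedge_inner)"
      "X j = abs_fock x" using abs_fock_surj by blast
    from metric_LIMSEQ_D[OF fock_embed_tendsto[OF x(1)], of "inverse (real (Suc j))"]
    show ?thesis using x(2) fock.cauchy_V[OF x(1)] by (auto simp del: of_nat_Suc)
  qed
  then obtain v where v: "\<And>j. v j \<in> finsupp (lists square_integrable)"
    and d: "\<And>j. dist (fock_embed (v j)) (X j) < inverse (real (Suc j))" by metis
  have lim0: "(\<lambda>j. dist (fock_embed (v j)) (X j)) \<longlonglongrightarrow> 0"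
    by (rule tendsto_sandwich[OF always_eventually[OF allI] always_eventually[OF allI]
          tendsto_const LIMSEQ_inverse_real_of_nat])
       (rule zero_le_dist, rule less_imp_le[OF d])
  have "v \<in> cauchy_seqs (finsupp (lists square_integrable)) (kernel_form wedge_inner)"
    unfolding fock.cauchy_seqs_iff
  proof (intro conjI allI impI v)
    fix e :: real assume "e > 0"
    then have e3: "e / 3 > 0" by simp
    obtain N where N: "\<And>m n. m \<ge> N \<Longrightarrow> n \<ge> N \<Longrightarrow> dist (X m) (X n) < e / 3"
      using X e3 unfolding Cauchy_def by blast
    obtain M where M: "\<And>j. j \<ge> M \<Longrightarrow> dist (fock_embed (v j)) (X j) < e / 3"
      using metric_LIMSEQ_D[OF lim0 e3] by (auto simp: dist_real_def)
    have "fock.nrm (v m - v n) < e" if "m \<ge> max M N" "n \<ge> max M N" for m n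
    proof -
      have "dist (fock_embed (v m)) (fock_embed (v n))
          \<le> dist (fock_embed (v m)) (X m) + dist (X m) (X n) + dist (fock_embed (v n)) (X n)"
        using dist_triangle[of "fock_embed (v m)" "fock_embed (v n)" "X m"]
          dist_triangle2[of "X m" "fock_embed (v n)" "X n"] by simp
      also have "\<dots> < e / 3 + e / 3 + e / 3" using M N that by (intro add_strict_mono) auto
      finally show ?thesis by (simp add: dist_fock_embed[OF v v])
    qed
    then show "\<exists>N. \<forall>m\<ge>N. \<forall>n\<ge>N. fock.nrm (v m - v n) < e" by blast
  qed
  then have "(\<lambda>j. fock_embed (v j)) \<longlonglongrightarrow> abs_fock v" by (rule fock_embed_tendsto)
  then have "(\<lambda>j. dist (fock_embed (v j)) (X j) + dist (fock_embed (v j)) (abs_fock v)) \<longlonglongrightarrow> 0 + 0"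
    by (intro tendsto_add lim0) (simp add: tendsto_dist_iff[symmetric])
  then have "(\<lambda>j. dist (X j) (abs_fock v)) \<longlonglongrightarrow> 0"
    by (intro tendsto_sandwich[of "\<lambda>_. 0" "\<lambda>j. dist (X j) (abs_fock v)" sequentially
          "\<lambda>j. dist (fock_embed (v j)) (X j) + dist (fock_embed (v j)) (abs_fock v)" 0])
      (auto simp: dist_triangle3)
  then have "X \<longlonglongrightarrow> abs_fock v" by (simp add: tendsto_dist_iff[of X])
  then show "convergent X" by (rule convergentI)
qed

lemma cinner_wedge:
  assumes "fs \<in> lists square_integrable" "gs \<in> lists square_integrable"
  shows "cinner (wedge fs) (wedge gs) = wedge_inner fs gs"
proof -
  let ?v = "\<lambda>fs gs :: (real \<Rightarrow> 'a \<times> 'a) list. if gs = fs then (1 :: complex) else 0"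
  have v: "?v fs \<in> finsupp (lists square_integrable)" if "fs \<in> lists square_integrable" for fs
    using that by (auto simp: finsupp_def)
  have "kernel_form wedge_inner (?v fs) (?v gs) = wedge_inner fs gs"
    by (simp add: kernel_form_def)
  then show ?thesis
    unfolding wedge_def using fock.const_cauchy[OF v] assms
    by (simp add: cinner_fock.abs_eq fock_rel_refl_iff)
qed

section \<open>Operators and von Neumann algebras\<close>

definition bounded_clinear :: "('h::complex_inner \<Rightarrow> 'h) \<Rightarrow> bool" where
  "bounded_clinear A \<longleftrightarrow> bounded_linear A \<and> (\<forall>c x. A (c *\<^sub>C x) = c *\<^sub>C A x)"

definition adj :: "('h::chilbert_space \<Rightarrow> 'h) \<Rightarrow> ('h \<Rightarrow> 'h)" where
  "adj A = (THE B. \<forall>x y. cinner (A x) y = cinner x (B y))"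

definition unitary :: "('h::chilbert_space \<Rightarrow> 'h) \<Rightarrow> bool" where
  "unitary U \<longleftrightarrow> bounded_clinear U \<and> adj U \<circ> U = id \<and> U \<circ> adj U = id"

definition commutant :: "('h::chilbert_space \<Rightarrow> 'h) set \<Rightarrow> ('h \<Rightarrow> 'h) set" where
  "commutant S = {A. bounded_clinear A \<and> (\<forall>B\<in>S. A \<circ> B = B \<circ> A)}"

definition von_neumann_algebra :: "('h::chilbert_space \<Rightarrow> 'h) set \<Rightarrow> bool" where
  "von_neumann_algebra M \<longleftrightarrow>
     (\<forall>x\<in>M. bounded_clinear x \<and> adj x \<in> M) \<and> commutant (commutant M) = M"

text \<open>The normal (i.e. \<open>\<sigma>\<close>-weakly continuous) functionals on \<open>M\<close>; only their values on \<open>M\<close> matter.\<close>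

definition predual :: "('h::chilbert_space \<Rightarrow> 'h) set \<Rightarrow> (('h \<Rightarrow> 'h) \<Rightarrow> complex) set" where
  "predual M = {\<rho>. \<exists>\<xi> \<eta>. summable (\<lambda>n. (norm (\<xi> n))\<^sup>2) \<and> summable (\<lambda>n. (norm (\<eta> n))\<^sup>2) \<and>
                     (\<forall>x\<in>M. \<rho> x = (\<Sum>n. cinner (\<xi> n) (x (\<eta> n))))}"

definition normal_unital_endo ::
    "('h::chilbert_space \<Rightarrow> 'h) set \<Rightarrow> (('h \<Rightarrow> 'h) \<Rightarrow> ('h \<Rightarrow> 'h)) \<Rightarrow> bool" where
  "normal_unital_endo M \<theta> \<longleftrightarrow>
     (\<forall>x\<in>M. \<theta> x \<in> M) \<and>
     (\<forall>x\<in>M. \<forall>y\<in>M. \<theta> (\<lambda>v. x v + y v) = (\<lambda>v. \<theta> x v + \<theta> y v)) \<and>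
     (\<forall>c. \<forall>x\<in>M. \<theta> (\<lambda>v. c *\<^sub>C x v) = (\<lambda>v. c *\<^sub>C \<theta> x v)) \<and>
     (\<forall>x\<in>M. \<forall>y\<in>M. \<theta> (x \<circ> y) = \<theta> x \<circ> \<theta> y) \<and>
     (\<forall>x\<in>M. \<theta> (adj x) = adj (\<theta> x)) \<and>
     \<theta> id = id \<and>
     (\<forall>\<rho>\<in>predual M. (\<lambda>x. \<rho> (\<theta> x)) \<in> predual M)"

section \<open>\<open>E\<^sub>0\<close>-semigroups, gauge cocycles and the gauge index\<close>

definition E0_semigroup ::
    "('h::chilbert_space \<Rightarrow> 'h) set \<Rightarrow> (real \<Rightarrow> ('h \<Rightarrow> 'h) \<Rightarrow> ('h \<Rightarrow> 'h)) \<Rightarrow> bool" where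
  "E0_semigroup M \<alpha> \<longleftrightarrow> von_neumann_algebra M \<and>
     (\<forall>t\<ge>0. normal_unital_endo M (\<alpha> t)) \<and>
     (\<forall>x\<in>M. \<alpha> 0 x = x) \<and>
     (\<forall>s\<ge>0. \<forall>t\<ge>0. \<forall>x\<in>M. \<alpha> (s + t) x = \<alpha> s (\<alpha> t x)) \<and>
     (\<forall>t>0. \<alpha> t ` M \<noteq> M) \<and>
     (\<forall>x\<in>M. \<forall>\<rho>\<in>predual M. continuous_on {0..} (\<lambda>t. \<rho> (\<alpha> t x)))"

text \<open>Families indexed by \<open>t \<ge> 0\<close> are functions on \<open>real\<close> that are \<open>undefined\<close> for \<open>t < 0\<close>, so that two
  cocycles are equal iff they agree for all \<open>t \<ge> 0\<close>.\<close>

definition cocycles ::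
    "('h::chilbert_space \<Rightarrow> 'h) set \<Rightarrow> (real \<Rightarrow> ('h \<Rightarrow> 'h) \<Rightarrow> ('h \<Rightarrow> 'h)) \<Rightarrow> (real \<Rightarrow> 'h \<Rightarrow> 'h) set" where
  "cocycles M \<alpha> = {U \<in> extensional {0..}.
     (\<forall>t\<ge>0. U t \<in> M \<and> unitary (U t)) \<and>
     (\<forall>v. continuous_on {0..} (\<lambda>t. U t v)) \<and>
     (\<forall>s\<ge>0. \<forall>t\<ge>0. U s \<circ> \<alpha> s (U t) = U (s + t))}"

definition gauge_group ::
    "('h::chilbert_space \<Rightarrow> 'h) set \<Rightarrow> (real \<Rightarrow> ('h \<Rightarrow> 'h) \<Rightarrow> ('h \<Rightarrow> 'h)) \<Rightarrow> (real \<Rightarrow> 'h \<Rightarrow> 'h) set" where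
  "gauge_group M \<alpha> = {U \<in> cocycles M \<alpha>. \<forall>t\<ge>0. U t \<in> M \<inter> commutant (\<alpha> t ` M)}"

definition c_star ::
    "(('h::chilbert_space \<Rightarrow> 'h) \<Rightarrow> complex) \<Rightarrow> (real \<Rightarrow> 'h \<Rightarrow> 'h) \<Rightarrow> (real \<Rightarrow> 'h \<Rightarrow> 'h) \<Rightarrow> complex" where
  "c_star \<tau> U V = (THE c. \<forall>t\<ge>0. \<tau> (adj (U t) \<circ> V t) = exp (c * complex_of_real t))"

definition zero_sum_functions :: "'a set \<Rightarrow> ('a \<Rightarrow> complex) set" where
  "zero_sum_functions G = {f \<in> finsupp G. (\<Sum>U | f U \<noteq> 0. f U) = 0}"

definition gauge_index ::
    "('h::chilbert_space \<Rightarrow> 'h) set \<Rightarrow> (('h \<Rightarrow> 'h) \<Rightarrow> complex) \<Rightarrow>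
     (real \<Rightarrow> ('h \<Rightarrow> 'h) \<Rightarrow> ('h \<Rightarrow> 'h)) \<Rightarrow> enat" where
  "gauge_index M \<tau> \<alpha> =
     hilbert_dim (hcompletion (zero_sum_functions (gauge_group M \<alpha>)) (kernel_form (c_star \<tau>)))
                 (hcompletion_inner (kernel_form (c_star \<tau>)))"

section \<open>The Clifford flow\<close>

definition creation ::
    "(real \<Rightarrow> 'k::{real_inner, banach, second_countable_topology} \<times> 'k) \<Rightarrow> 'k fock \<Rightarrow> 'k fock" where
  "creation f = (THE A. bounded_clinear A \<and>
                   (\<forall>fs\<in>lists square_integrable. A (wedge fs) = wedge (f # fs)))"

definition clifford_field ::
    "(real \<Rightarrow> 'k::{real_inner, banach, second_countable_topology}) \<Rightarrow> 'k fock \<Rightarrow> 'k fock" where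
  "clifford_field f = (\<lambda>\<psi>. (1 / sqrt 2) *\<^sub>R
     (adj (creation (\<lambda>s. (f s, 0))) \<psi> + creation (\<lambda>s. (f s, 0)) \<psi>))"

definition clifford_algebra ::
    "('k::{real_inner, banach, second_countable_topology} fock \<Rightarrow> 'k fock) set" where
  "clifford_algebra = commutant (commutant (clifford_field ` square_integrable))"

definition vacuum_trace ::
    "('k::{real_inner, banach, second_countable_topology} fock \<Rightarrow> 'k fock) \<Rightarrow> complex" where
  "vacuum_trace x = cinner (wedge []) (x (wedge []))"

definition shift :: "real \<Rightarrow> (real \<Rightarrow> 'a::zero) \<Rightarrow> real \<Rightarrow> 'a" where
  "shift t f = (\<lambda>s. if s < t then 0 else f (s - t))"

definition clifford_product ::
    "(real \<Rightarrow> 'k::{real_inner, banach, second_countable_topology}) list \<Rightarrow> 'k fock \<Rightarrow> 'k fock" where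
  "clifford_product fs = foldr (\<lambda>f x. clifford_field f \<circ> x) fs id"

text \<open>These conditions determine the maps \<open>\<alpha> t\<close> for \<open>t \<ge> 0\<close> on the Clifford algebra; the values
  elsewhere are irrelevant. The rank of the flow is the dimension of \<open>'k\<close>.\<close>

definition clifford_flow ::
    "(real \<Rightarrow> ('k::{real_inner, banach, second_countable_topology} fock \<Rightarrow> 'k fock) \<Rightarrow> ('k fock \<Rightarrow> 'k fock)) \<Rightarrow>
     bool" where
  "clifford_flow \<alpha> \<longleftrightarrow> E0_semigroup clifford_algebra \<alpha> \<and>
     (\<forall>t\<ge>0. \<forall>fs\<in>lists square_integrable.
        \<alpha> t (clifford_product fs) = clifford_product (map (shift t) fs))"

end

theory Submission
  imports Defs "Jordan_Normal_Form.Determinant"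
begin

text \<open>Every gauge cocycle \<open>U\<close> of the Clifford flow is a scalar \<open>U\<^sub>t = e\<^bsup>at\<^esup>\<close>, so
  \<open>c\<^sub>*(U, V)\<close> is the sum of a function of \<open>U\<close> and a function of \<open>V\<close> and the form vanishes on functions
  with sum zero. To see that \<open>U\<^sub>T\<close> is scalar, compare the left and right actions of \<open>u(f)\<close> on the Fock
  space: commutation with \<open>\<alpha>\<^sub>s(M)\<close> forces \<open>U\<^sub>s \<Omega>\<close> to be even and without particles after time
  \<open>s\<close>, and normality of \<open>\<alpha>\<^sub>s\<close> forces the vectors in \<open>\<alpha>\<^sub>s(M) \<Omega>\<close> to have an even number of particles before time \<open>s\<close>. By the
  cocycle identity \<open>U\<^sub>T \<Omega>\<close> is then fixed by the second quantisation of every sign change at a time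
  \<open>s\<close> in \<open>[0, T]\<close>. Products of such sign changes are square waves, which converge weakly to zero when
  the period does, so \<open>U\<^sub>T \<Omega>\<close> is orthogonal to all particle states.\<close>

section \<open>Complex inner product spaces\<close>

text \<open>The flow is prescribed only on products of fields, while a general element of the
  algebra is known only as a member of a double commutant. Statements about alpha_s(x) Omega for all
  x are therefore obtained by duality, from the normal functional y -> <psi, alpha_s(y) Omega> and
  its behaviour under conjugation of y by u(f). If psi contains an odd number of fields before time
  s, this functional changes sign, and a convexity argument makes it vanish. For an even number it
  would be invariant and no sign would be available, so only the parity before s is controlled. This
  is why sign changes appear instead of the projection onto vectors without particles before s.
  Parity suffices because conjugation by a second quantised sign change preserves the algebra and
  the vacuum is separating: U_s commutes with the sign change at s as soon as U_s Omega is fixed by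
  it. Positive rank enters as a nonzero vector \<open>e\<close>, which supplies weakly null
  sequences of test functions of constant norm, supported after any given time.\<close>

context complex_inner
begin

lemma cinner_add_left: "cinner (x + y) z = cinner x z + cinner y z"
  by (metis cinner_add_right cinner_commute complex_cnj_add)

lemma cinner_scaleC_left: "cinner (c *\<^sub>C x) y = cnj c * cinner x y"
  by (metis cinner_commute cinner_scaleC_right complex_cnj_mult)

end

lemma scaleC_one [simp]: "1 *\<^sub>C (x :: 'a :: complex_inner) = x"
  using scaleR_scaleC[of 1 x] by simp

lemma scaleC_zero_left [simp]: "0 *\<^sub>C (x :: 'a :: complex_inner) = 0"
  using scaleR_scaleC[of 0 x] by simp

lemma scaleC_zero_right [simp]: "c *\<^sub>C (0 :: 'a :: complex_inner) = 0"
  using scaleC_add_right[of c "0 :: 'a" 0] by simp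

lemma scaleC_minus_left: "(- c) *\<^sub>C (x :: 'a :: complex_inner) = - (c *\<^sub>C x)"
  using scaleC_add_left[of c "- c" x] by (simp add: eq_neg_iff_add_eq_0 add.commute)

lemma scaleC_minus_right: "c *\<^sub>C (- x :: 'a :: complex_inner) = - (c *\<^sub>C x)"
  using scaleC_add_right[of c x "- x"] by (simp add: eq_neg_iff_add_eq_0 add.commute)

lemma scaleC_diff_right: "c *\<^sub>C (x - y :: 'a :: complex_inner) = c *\<^sub>C x - c *\<^sub>C y"
  using scaleC_add_right[of c x "- y"] by (simp add: scaleC_minus_right)

lemma scaleC_sum_right: "c *\<^sub>C (\<Sum>i\<in>I. f i :: 'a :: complex_inner) = (\<Sum>i\<in>I. c *\<^sub>C f i)"
  by (induction I rule: infinite_finite_induct) (auto simp: scaleC_add_right)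

lemma scaleC_scaleR: "c *\<^sub>C (r *\<^sub>R (x :: 'a :: complex_inner)) = r *\<^sub>R c *\<^sub>C x"
  by (simp add: scaleR_scaleC scaleC_scaleC mult.commute)

lemma cinner_zero_left [simp]: "cinner 0 (x :: 'a :: complex_inner) = 0"
  using cinner_scaleC_left[of 0 "0 :: 'a" x] by simp

lemma cinner_zero_right [simp]: "cinner (x :: 'a :: complex_inner) 0 = 0"
  using cinner_scaleC_right[of x 0 0] by simp

lemma cinner_minus_left: "cinner (- x) (y :: 'a :: complex_inner) = - cinner x y"
  using cinner_add_left[of x "- x" y] by (simp add: eq_neg_iff_add_eq_0 add.commute)

lemma cinner_minus_right: "cinner x (- y :: 'a :: complex_inner) = - cinner x y"
  using cinner_add_right[of x y "- y"] by (simp add: eq_neg_iff_add_eq_0 add.commute)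

lemma cinner_diff_left: "cinner (x - y) (z :: 'a :: complex_inner) = cinner x z - cinner y z"
  using cinner_add_left[of x "- y" z] by (simp add: cinner_minus_left)

lemma cinner_diff_right: "cinner x (y - z :: 'a :: complex_inner) = cinner x y - cinner x z"
  using cinner_add_right[of x y "- z"] by (simp add: cinner_minus_right)

lemma cinner_scaleR_left: "cinner (r *\<^sub>R x) (y :: 'a :: complex_inner) = of_real r * cinner x y"
  by (simp add: scaleR_scaleC cinner_scaleC_left)

lemma cinner_scaleR_right: "cinner x (r *\<^sub>R y :: 'a :: complex_inner) = of_real r * cinner x y"
  by (simp add: scaleR_scaleC cinner_scaleC_right)

lemma cinner_sum_left: "cinner (\<Sum>i\<in>I. f i) (y :: 'a :: complex_inner) = (\<Sum>i\<in>I. cinner (f i) y)"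
  by (induction I rule: infinite_finite_induct) (auto simp: cinner_add_left)

lemma cinner_sum_right: "cinner x (\<Sum>i\<in>I. f i :: 'a :: complex_inner) = (\<Sum>i\<in>I. cinner x (f i))"
  by (induction I rule: infinite_finite_induct) (auto simp: cinner_add_right)

lemmas cinner_simps = cinner_add_left cinner_add_right cinner_diff_left cinner_diff_right
  cinner_scaleR_left cinner_scaleR_right cinner_scaleC_left cinner_scaleC_right
  cinner_minus_left cinner_minus_right

lemma cinner_self: "cinner x x = of_real ((norm (x :: 'a :: complex_inner))\<^sup>2)"
proof -
  have "Im (cinner x x) = 0"
    using cinner_commute[of x x] by (metis cnj.simps(2) neg_equal_zero)
  then show ?thesis
    by (simp add: complex_eq_iff power2_norm_eq_inner inner_cinner)
qed

lemma norm_scaleC: "norm (c *\<^sub>C x) = cmod c * norm (x :: 'a :: complex_inner)"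
proof -
  have "complex_of_real ((norm (c *\<^sub>C x))\<^sup>2) = of_real ((cmod c * norm x)\<^sup>2)"
    unfolding cinner_self[symmetric] cinner_scaleC_left cinner_scaleC_right
    by (simp add: cinner_self power_mult_distrib complex_norm_square[unfolded of_real_power] mult_ac)
  then show ?thesis
    by (simp only: of_real_eq_iff) (metis norm_ge_zero mult_nonneg_nonneg power2_eq_imp_eq)
qed

lemma cinner_Cauchy_Schwarz: "cmod (cinner x y) \<le> norm x * norm (y :: 'a :: complex_inner)"
proof (cases "cinner x y = 0")
  case False
  \<comment> \<open>The phase \<open>c\<close> makes the product real and nonnegative, so the real
    inequality for \<open>inner\<close> applies.\<close>
  define c where "c = cnj (cinner x y) / cmod (cinner x y)"
  have "c * cinner x y = cmod (cinner x y)"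
    using False by (simp add: c_def mult.commute[of "cnj _"] flip: complex_norm_square)
      (simp add: power2_eq_square)
  then have "cmod (cinner x y) = inner x (c *\<^sub>C y)"
    by (simp add: inner_cinner cinner_scaleC_right)
  also have "\<dots> \<le> norm x * norm (c *\<^sub>C y)" by (rule norm_cauchy_schwarz)
  also have "norm (c *\<^sub>C y) = norm y"
    using False by (simp add: norm_scaleC c_def norm_divide)
  finally show ?thesis .
qed simp

lemma bounded_bilinear_cinner: "bounded_bilinear (cinner :: 'a :: complex_inner \<Rightarrow> 'a \<Rightarrow> complex)"
  by unfold_locales
    (auto simp: cinner_simps scaleR_conv_of_real intro!: exI[of _ 1] cinner_Cauchy_Schwarz)

lemmas tendsto_cinner = bounded_bilinear.tendsto[OF bounded_bilinear_cinner]

lemma bounded_linear_scaleC: "bounded_linear (\<lambda>x. c *\<^sub>C (x :: 'a :: complex_inner))"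
  by (rule bounded_linear_intro[where K = "cmod c"])
    (simp_all add: scaleC_add_right scaleC_scaleR norm_scaleC mult.commute)

lemmas tendsto_scaleC = bounded_linear.tendsto[OF bounded_linear_scaleC]

section \<open>Bounded complex linear operators and adjoints\<close>

lemma bounded_clinearD:
  assumes "bounded_clinear T"
  shows "T (x + y) = T x + T y" "T (x - y) = T x - T y" "T (c *\<^sub>C x) = c *\<^sub>C T x"
    "T (r *\<^sub>R x) = r *\<^sub>R T x" "T 0 = 0" "T (- x) = - T x" "bounded_linear T"
    "T (sum h I) = (\<Sum>i\<in>I. T (h i))"
  using assms unfolding bounded_clinear_def
  by (auto dest: bounded_linear.linear simp: linear_add linear_diff linear_scale linear_0 linear_neg linear_sum)

lemma bounded_clinear_compose:
  assumes "bounded_clinear S" "bounded_clinear T"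
  shows "bounded_clinear (\<lambda>x. S (T x))"
  using assms unfolding bounded_clinear_def by (auto intro: bounded_linear_compose)

lemma bounded_clinear_id: "bounded_clinear (\<lambda>x. x)" "bounded_clinear id"
  by (simp_all add: bounded_clinear_def id_def)

lemma bounded_clinear_add: "bounded_clinear S \<Longrightarrow> bounded_clinear T \<Longrightarrow> bounded_clinear (\<lambda>x. S x + T x)"
  unfolding bounded_clinear_def by (auto intro: bounded_linear_add simp: scaleC_add_right)

lemma bounded_clinear_diff: "bounded_clinear S \<Longrightarrow> bounded_clinear T \<Longrightarrow> bounded_clinear (\<lambda>x. S x - T x)"
  unfolding bounded_clinear_def by (auto intro: bounded_linear_sub simp: scaleC_diff_right)

lemma bounded_clinear_scaleC: "bounded_clinear T \<Longrightarrow> bounded_clinear (\<lambda>x. c *\<^sub>C T x)"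
  unfolding bounded_clinear_def
  by (auto intro!: bounded_linear_compose[OF bounded_linear_scaleC] simp: scaleC_scaleC mult.commute)

lemma bounded_clinear_scaleR: "bounded_clinear T \<Longrightarrow> bounded_clinear (\<lambda>x. r *\<^sub>R T x)"
  using bounded_clinear_scaleC[of T "of_real r"] by (simp add: scaleR_scaleC)

text \<open>\<open>adj\<close> is a definite description, and a vector orthogonal to itself
  vanishes, so any candidate satisfying the adjoint relation is its value. The adjoints of creation
  operators and of scalar operators are computed this way.\<close>

lemma adj_eqI:
  assumes "\<And>x y. cinner (A x) y = cinner x (B y)"
  shows "adj A = B"
  unfolding adj_def
proof (rule the_equality)
  show "\<forall>x y. cinner (A x) y = cinner x (B y)" using assms by blast
  fix C assume C: "\<forall>x y. cinner (A x) y = cinner x (C y)"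
  show "C = B"
  proof
    fix y
    have "cinner (C y - B y) (C y - B y) = 0"
      using C assms by (simp add: cinner_diff_right)
    then show "C y = B y" by (simp add: cinner_self)
  qed
qed

section \<open>Operators on the Fock space defined on wedge products\<close>

text \<open>With \<open>h = wedge\<close> this is the vector represented by the coefficients
  \<open>v\<close>. With another \<open>h\<close> it is the value forced there on a linear map that
  sends \<open>wedge fs\<close> to \<open>h fs\<close>.\<close>

definition lincomb :: "('b \<Rightarrow> 'a) \<Rightarrow> ('b \<Rightarrow> complex) \<Rightarrow> 'a::complex_inner" where
  "lincomb h v = (\<Sum>x | v x \<noteq> 0. v x *\<^sub>C h x)"

lemma lincomb_superset:
  assumes "finite A" "{x. v x \<noteq> 0} \<subseteq> A"
  shows "lincomb h v = (\<Sum>x\<in>A. v x *\<^sub>C h x)"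
  unfolding lincomb_def by (rule sum.mono_neutral_left) (use assms in auto)

lemma lincomb_add:
  assumes "v \<in> finsupp S" "w \<in> finsupp S"
  shows "lincomb h (\<lambda>x. v x + w x) = lincomb h v + lincomb h w"
proof -
  define A where "A = {x. v x \<noteq> 0} \<union> {x. w x \<noteq> 0}"
  have A: "finite A" using assms by (auto simp: A_def finsupp_def)
  show ?thesis
    by (subst (1 2 3) lincomb_superset[OF A])
      (auto simp: A_def scaleC_add_left sum.distrib)
qed

lemma lincomb_scale:
  assumes "v \<in> finsupp S"
  shows "lincomb h (\<lambda>x. c * v x) = c *\<^sub>C lincomb h v"
proof -
  have A: "finite {x. v x \<noteq> 0}" using assms by (auto simp: finsupp_def)
  show ?thesis
    by (subst (1 2) lincomb_superset[OF A]) (auto simp: scaleC_scaleC scaleC_sum_right)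
qed

lemma lincomb_diff:
  assumes "v \<in> finsupp S" "w \<in> finsupp S"
  shows "lincomb h (v - w) = lincomb h v - lincomb h w"
proof -
  have "(\<lambda>x. (-1) * w x) \<in> finsupp S" using assms(2) by (auto simp: finsupp_def)
  from lincomb_add[OF assms(1) this, of h]
  show ?thesis unfolding lincomb_scale[OF assms(2)]
    by (simp add: scaleC_minus_left fun_diff_def)
qed

lemma fock_embed_add:
  assumes "v \<in> finsupp (lists square_integrable)" "w \<in> finsupp (lists square_integrable)"
  shows "fock_embed (\<lambda>x. v x + w x) = fock_embed v + fock_embed w"
  using assms[THEN fock.const_cauchy] by (simp add: plus_fock.abs_eq fock_rel_refl_iff)

lemma fock_embed_scale:
  assumes "v \<in> finsupp (lists square_integrable)"
  shows "fock_embed (\<lambda>x. c * v x) = c *\<^sub>C fock_embed v"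
  using assms[THEN fock.const_cauchy] by (simp add: scaleC_fock.abs_eq fock_rel_refl_iff)

text \<open>Replaces classes of Cauchy sequences by limits of finite combinations of wedges, the
  form in which the Fock space is used from here on.\<close>

lemma fock_embed_lincomb:
  assumes "v \<in> finsupp (lists square_integrable)"
  shows "fock_embed v = lincomb wedge v"
proof -
  have "fock_embed (\<lambda>x. if x \<in> A then v x else 0) = (\<Sum>x\<in>A. v x *\<^sub>C wedge x)"
    if "finite A" "A \<subseteq> lists square_integrable" for A
    using that
  proof (induction A rule: finite_induct)
    case empty
    show ?case by (simp add: zero_fock_def)
  next
    case (insert a A)
    let ?d = "\<lambda>x. if x = a then (1::complex) else 0"
    have d: "?d \<in> finsupp (lists square_integrable)" using insert by (auto simp: finsupp_def)
    have vA: "(\<lambda>x. if x \<in> A then v x else 0) \<in> finsupp (lists square_integrable)"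
      using insert by (auto simp: finsupp_def)
    have "(\<lambda>x. if x \<in> insert a A then v x else 0) = (\<lambda>x. v a * ?d x + (if x \<in> A then v x else 0))"
      using insert by (auto simp: fun_eq_iff)
    then show ?case
      using fock_embed_add[OF fock.V_mult[OF d] vA, of "v a"] insert
      by (simp add: fock_embed_scale[OF d] wedge_def)
  qed
  note * = this[of "{x. v x \<noteq> 0}"]
  have e: "(\<lambda>x. if x \<in> {x. v x \<noteq> 0} then v x else 0) = v" by auto
  show ?thesis
    unfolding lincomb_def using *[unfolded e] assms by (simp add: finsupp_def)
qed

lemma fock_lincomb_tendsto:
  obtains y where "\<And>n. y n \<in> finsupp (lists square_integrable)" "(\<lambda>n. lincomb wedge (y n)) \<longlonglongrightarrow> \<psi>"
proof -
  obtain x where x: "x \<in> cauchy_seqs (finsupp (lists square_integrable)) (kernel_form wedge_inner)"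
    "\<psi> = abs_fock x" using abs_fock_surj by blast
  note v = fock.cauchy_V[OF x(1)]
  show ?thesis
    by (rule that[of x, OF v]) (use fock_embed_tendsto[OF x(1)] x(2) in \<open>simp add: fock_embed_lincomb[OF v]\<close>)
qed

lemma fock_ext:
  assumes "\<And>fs. fs \<in> lists square_integrable \<Longrightarrow> cinner (wedge fs) \<zeta> = 0"
  shows "\<zeta> = 0"
proof -
  obtain y where y: "\<And>n. y n \<in> finsupp (lists square_integrable)" "(\<lambda>n. lincomb wedge (y n)) \<longlonglongrightarrow> \<zeta>"
    using fock_lincomb_tendsto[of \<zeta>] by blast
  have "cinner (lincomb wedge (y n)) \<zeta> = 0" for n
    using y(1)[of n] assms
    by (auto simp: lincomb_def cinner_sum_left cinner_scaleC_left finsupp_def subset_eq intro!: sum.neutral)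
  with tendsto_cinner[OF y(2) tendsto_const[of \<zeta>]] have "cinner \<zeta> \<zeta> = 0"
    by (simp add: LIMSEQ_const_iff)
  then show ?thesis by (simp add: cinner_self)
qed

lemma fock_eqI:
  assumes "\<And>fs. fs \<in> lists square_integrable \<Longrightarrow> cinner (wedge fs) \<xi> = cinner (wedge fs) \<eta>"
  shows "\<xi> = \<eta>"
  using fock_ext[of "\<xi> - \<eta>"] assms by (simp add: cinner_diff_right)

text \<open>Totality of the wedges as an induction principle: \<open>L\<close> is typically the set
  of vectors that satisfy a closed linear condition.\<close>

lemma closed_subspace_eq_UNIV:
  fixes L :: "'k::{real_inner, banach, second_countable_topology} fock set"
  assumes "closed L" "0 \<in> L" "\<And>x y. x \<in> L \<Longrightarrow> y \<in> L \<Longrightarrow> x + y \<in> L"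
    and "\<And>c x. x \<in> L \<Longrightarrow> c *\<^sub>C x \<in> L"
    and w: "\<And>fs. fs \<in> lists square_integrable \<Longrightarrow> wedge fs \<in> L"
  shows "L = UNIV"
proof -
  have "\<psi> \<in> L" for \<psi>
  proof -
    obtain y where y: "\<And>n. y n \<in> finsupp (lists square_integrable)" "(\<lambda>n. lincomb wedge (y n)) \<longlonglongrightarrow> \<psi>"
      using fock_lincomb_tendsto[of \<psi>] by blast
    have s: "(\<Sum>x\<in>A. g x) \<in> L" if "finite A" "\<And>x. x \<in> A \<Longrightarrow> g x \<in> L" for A and g :: "'b \<Rightarrow> 'k fock"
      using that by (induction A rule: finite_induct) (auto intro: assms)
    have yL: "lincomb wedge (y n) \<in> L" for n
      unfolding lincomb_def using y(1)[of n] by (intro s assms w) (auto simp: finsupp_def)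
    show ?thesis by (rule closed_sequentially[OF assms(1) yL y(2)])
  qed
  then show ?thesis by blast
qed

lemma clinear_eqI_wedge:
  fixes S T :: "'k::{real_inner, banach, second_countable_topology} fock \<Rightarrow> 'h::complex_inner"
  assumes "bounded_linear S" "\<And>c x. S (c *\<^sub>C x) = c *\<^sub>C S x"
    and "bounded_linear T" "\<And>c x. T (c *\<^sub>C x) = c *\<^sub>C T x"
    and "\<And>fs. fs \<in> lists square_integrable \<Longrightarrow> S (wedge fs) = T (wedge fs)"
  shows "S = T"
proof -
  have "closed {x. S x = T x}"
    using assms by (intro closed_Collect_eq linear_continuous_on)
  then have "{x. S x = T x} = UNIV"
    by (rule closed_subspace_eq_UNIV)
      (use assms in \<open>auto simp: bounded_linear.linear linear_add linear_0\<close>)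
  then show ?thesis by auto
qed

lemma bounded_clinear_eqI:
  fixes S T :: "'k::{real_inner, banach, second_countable_topology} fock \<Rightarrow> 'k fock"
  assumes "bounded_clinear S" "bounded_clinear T"
    and "\<And>fs. fs \<in> lists square_integrable \<Longrightarrow> S (wedge fs) = T (wedge fs)"
  shows "S = T"
  using assms by (intro clinear_eqI_wedge) (auto simp: bounded_clinear_def)

text \<open>Wedges satisfy linear relations, so values prescribed on them must be consistent. The
  norm bound on formal combinations ensures this, since a combination representing zero is sent to
  zero, and it also allows the passage to limits.\<close>

lemma wedge_extension:
  fixes h :: "(real \<Rightarrow> 'k::{real_inner, banach, second_countable_topology} \<times> 'k) list \<Rightarrow> 'k fock"
  assumes le: "\<And>v. v \<in> finsupp (lists square_integrable) \<Longrightarrow> norm (lincomb h v) \<le> C * norm (lincomb wedge v)"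
  obtains T where "bounded_clinear T" "\<And>fs. fs \<in> lists square_integrable \<Longrightarrow> T (wedge fs) = h fs"
    "\<And>\<psi>. norm (T \<psi>) \<le> C * norm \<psi>"
proof -
  define Y where "Y = (\<lambda>\<psi>. SOME y. (\<forall>n. y n \<in> finsupp (lists square_integrable)) \<and> 
    (\<lambda>n. lincomb wedge (y n)) \<longlonglongrightarrow> (\<psi> :: 'k fock))"
  have Y: "Y \<psi> n \<in> finsupp (lists square_integrable)" "(\<lambda>n. lincomb wedge (Y \<psi> n)) \<longlonglongrightarrow> \<psi>" for \<psi> n
  proof -
    have "\<exists>y. (\<forall>n. y n \<in> finsupp (lists square_integrable)) \<and> (\<lambda>n. lincomb wedge (y n)) \<longlonglongrightarrow> \<psi>"
      using fock_lincomb_tendsto[of \<psi>] by metis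
    from someI_ex[OF this] show "Y \<psi> n \<in> finsupp (lists square_integrable)" 
      "(\<lambda>n. lincomb wedge (Y \<psi> n)) \<longlonglongrightarrow> \<psi>"
      unfolding Y_def by blast+
  qed
  have le': "norm (lincomb h v - lincomb h w) \<le> C * norm (lincomb wedge v - lincomb wedge w)"
    if "v \<in> finsupp (lists square_integrable)" "w \<in> finsupp (lists square_integrable)" for v w
    using le[OF fock.V_diff[OF that]] by (simp add: lincomb_diff[OF that])
  define T where "T = (\<lambda>\<psi>. lim (\<lambda>n. lincomb h (Y \<psi> n)))"
  have "Cauchy (\<lambda>n. lincomb h (Y \<psi> n))" for \<psi>
  proof (rule metric_CauchyI)
    fix e :: real assume e: "e > 0"
    have C: "\<bar>C\<bar> + 1 > 0" by simp
    have "Cauchy (\<lambda>n. lincomb wedge (Y \<psi> n))" by (rule LIMSEQ_imp_Cauchy[OF Y(2)])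
    from metric_CauchyD[OF this, of "e / (\<bar>C\<bar> + 1)"]
    obtain M where M: "\<And>m n. m \<ge> M \<Longrightarrow> n \<ge> M \<Longrightarrow>
        dist (lincomb wedge (Y \<psi> m)) (lincomb wedge (Y \<psi> n)) < e / (\<bar>C\<bar> + 1)"
      using e by auto
    have "dist (lincomb h (Y \<psi> m)) (lincomb h (Y \<psi> n)) < e" if "m \<ge> M" "n \<ge> M" for m n
    proof -
      let ?d = "dist (lincomb wedge (Y \<psi> m)) (lincomb wedge (Y \<psi> n))"
      have "dist (lincomb h (Y \<psi> m)) (lincomb h (Y \<psi> n)) \<le> C * ?d"
        using le'[OF Y(1) Y(1)] by (simp add: dist_norm)
      also have "\<dots> \<le> (\<bar>C\<bar> + 1) * ?d" by (rule mult_right_mono) auto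
      also have "\<dots> < e" using M[OF that] C by (simp add: field_simps)
      finally show ?thesis .
    qed
    then show "\<exists>M. \<forall>m\<ge>M. \<forall>n\<ge>M. dist (lincomb h (Y \<psi> m)) (lincomb h (Y \<psi> n)) < e" by blast
  qed
  then have T0: "(\<lambda>n. lincomb h (Y \<psi> n)) \<longlonglongrightarrow> T \<psi>" for \<psi>
    unfolding T_def by (meson Cauchy_convergent convergent_LIMSEQ_iff)
  \<comment> \<open>The limit does not depend on the chosen approximation \<open>Y\<close>;
    additivity and homogeneity follow by comparing two approximations of the same vector.\<close>
  have T: "(\<lambda>n. lincomb h (y n)) \<longlonglongrightarrow> T \<psi>"
    if y: "\<And>n. y n \<in> finsupp (lists square_integrable)" "(\<lambda>n. lincomb wedge (y n)) \<longlonglongrightarrow> \<psi>" for y \<psi>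
  proof -
    have "(\<lambda>n. C * norm (lincomb wedge (y n) - lincomb wedge (Y \<psi> n))) \<longlonglongrightarrow> C * norm (\<psi> - \<psi>)"
      by (intro tendsto_intros y Y)
    then have "(\<lambda>n. lincomb h (y n) - lincomb h (Y \<psi> n)) \<longlonglongrightarrow> 0"
      by (intro Lim_null_comparison[OF always_eventually[OF allI[OF le'[OF y(1) Y(1)]]]]) simp
    from tendsto_add[OF this T0[of \<psi>]] show ?thesis by simp
  qed
  have add: "T (\<psi> + \<phi>) = T \<psi> + T \<phi>" for \<psi> \<phi>
  proof (rule LIMSEQ_unique)
    have "(\<lambda>n. lincomb wedge (\<lambda>x. Y \<psi> n x + Y \<phi> n x)) \<longlonglongrightarrow> \<psi> + \<phi>"
      unfolding lincomb_add[OF Y(1) Y(1)] by (intro tendsto_add Y)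
    from T[OF fock.V_add[OF Y(1) Y(1)] this]
    show "(\<lambda>n. lincomb h (Y \<psi> n) + lincomb h (Y \<phi> n)) \<longlonglongrightarrow> T (\<psi> + \<phi>)"
      unfolding lincomb_add[OF Y(1) Y(1)] .
    show "(\<lambda>n. lincomb h (Y \<psi> n) + lincomb h (Y \<phi> n)) \<longlonglongrightarrow> T \<psi> + T \<phi>"
      by (intro tendsto_add T0)
  qed
  have scale: "T (c *\<^sub>C \<psi>) = c *\<^sub>C T \<psi>" for c \<psi>
  proof (rule LIMSEQ_unique)
    have "(\<lambda>n. lincomb wedge (\<lambda>x. c * Y \<psi> n x)) \<longlonglongrightarrow> c *\<^sub>C \<psi>"
      unfolding lincomb_scale[OF Y(1)] by (intro tendsto_scaleC Y)
    from T[OF fock.V_mult[OF Y(1)] this]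
    show "(\<lambda>n. c *\<^sub>C lincomb h (Y \<psi> n)) \<longlonglongrightarrow> T (c *\<^sub>C \<psi>)"
      unfolding lincomb_scale[OF Y(1)] .
    show "(\<lambda>n. c *\<^sub>C lincomb h (Y \<psi> n)) \<longlonglongrightarrow> c *\<^sub>C T \<psi>"
      by (intro tendsto_scaleC T0)
  qed
  have bd: "norm (T \<psi>) \<le> C * norm \<psi>" for \<psi>
    by (rule LIMSEQ_le[OF tendsto_norm[OF T0] tendsto_mult_left[OF tendsto_norm[OF Y(2)]]])
      (intro exI allI impI le Y(1))
  have "bounded_linear T"
  proof (rule bounded_linear_intro[where K = C])
    show "norm (T x) \<le> norm x * C" for x using bd[of x] by (simp only: mult.commute)
  qed (simp_all only: add scale scaleR_scaleC)
  then have "bounded_clinear T" unfolding bounded_clinear_def using scale by blast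
  moreover have "T (wedge fs) = h fs" if "fs \<in> lists square_integrable" for fs
  proof (rule LIMSEQ_unique)
    let ?d = "\<lambda>x. if x = fs then (1::complex) else 0"
    have d: "?d \<in> finsupp (lists square_integrable)" using that by (auto simp: finsupp_def)
    have l: "lincomb g ?d = g fs" for g :: "_ \<Rightarrow> 'k fock"
      by (subst lincomb_superset[of "{fs}"]) auto
    show "(\<lambda>n. h fs) \<longlonglongrightarrow> T (wedge fs)"
      by (rule T[of "\<lambda>_. ?d" "wedge fs", unfolded l, OF d tendsto_const])
  qed (rule tendsto_const)
  ultimately show ?thesis by (rule that[OF _ _ bd])
qed

text \<open>The norm bounds needed for extension are positive semidefiniteness statements about kernels.\<close>

lemma norm_lincomb_le:
  fixes g :: "'b \<Rightarrow> 'h::complex_inner" and h :: "'b \<Rightarrow> 'g::complex_inner" and q :: "'b \<Rightarrow> 'l::complex_inner"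
  assumes "v \<in> finsupp S" "0 \<le> C"
    and K: "\<And>x y. x \<in> S \<Longrightarrow> y \<in> S \<Longrightarrow>
      of_real (C\<^sup>2) * cinner (g x) (g y) = cinner (h x) (h y) + cinner (q x) (q y)"
  shows "norm (lincomb h v) \<le> C * norm (lincomb g v)"
proof -
  define A where "A = {x. v x \<noteq> 0}"
  have A: "finite A" "A \<subseteq> S" using assms by (auto simp: A_def finsupp_def)
  have e: "cinner (lincomb f v) (lincomb f v) = (\<Sum>x\<in>A. \<Sum>y\<in>A. cnj (v x) * v y * cinner (f x) (f y))"
    for f :: "'b \<Rightarrow> 'm::complex_inner"
    unfolding lincomb_def A_def[symmetric]
    by (subst cinner_sum_left, subst cinner_sum_right)
      (simp only: cinner_scaleC_left cinner_scaleC_right mult_ac)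
  have "of_real (C\<^sup>2) * cinner (lincomb g v) (lincomb g v)
      = cinner (lincomb h v) (lincomb h v) + cinner (lincomb q v) (lincomb q v)"
    unfolding e sum_distrib_left sum.distrib[symmetric]
  proof (intro sum.cong refl)
    fix x y assume "x \<in> A" "y \<in> A"
    then have *: "of_real (C\<^sup>2) * cinner (g x) (g y) = cinner (h x) (h y) + cinner (q x) (q y)"
      using A K by blast
    show "of_real (C\<^sup>2) * (cnj (v x) * v y * cinner (g x) (g y)) =
        cnj (v x) * v y * cinner (h x) (h y) + cnj (v x) * v y * cinner (q x) (q y)"
      using arg_cong[OF *, of "\<lambda>z. cnj (v x) * v y * z"] by (simp add: algebra_simps)
  qed
  then have "of_real ((C * norm (lincomb g v))\<^sup>2)
      = complex_of_real ((norm (lincomb h v))\<^sup>2 + (norm (lincomb q v))\<^sup>2)"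
    by (simp add: cinner_self power_mult_distrib)
  then have "(C * norm (lincomb g v))\<^sup>2 = (norm (lincomb h v))\<^sup>2 + (norm (lincomb q v))\<^sup>2"
    by (simp only: of_real_eq_iff)
  then have "(norm (lincomb h v))\<^sup>2 \<le> (C * norm (lincomb g v))\<^sup>2" by simp
  then show ?thesis by (rule power2_le_imp_le) (simp add: assms(2))
qed

section \<open>Creation and annihilation operators\<close>

abbreviation delete_nth :: "nat \<Rightarrow> 'a list \<Rightarrow> 'a list" where
  "delete_nth j xs \<equiv> take j xs @ drop (Suc j) xs"

lemma nth_delete_nth:
  "j < length xs \<Longrightarrow> i < length xs - 1 \<Longrightarrow> delete_nth j xs ! i = xs ! (if i < j then i else Suc i)"
  by (auto simp: nth_append min_def)

lemma delete_nth_lists: "xs \<in> lists S \<Longrightarrow> delete_nth j xs \<in> lists S"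
  by (auto dest: in_set_takeD in_set_dropD)

lemma wedge_inner_det:
  assumes "length gs = length fs"
  shows "wedge_inner fs gs = det (mat (length fs) (length fs) (\<lambda>(i, j). l2_inner (fs ! i) (gs ! j)))"
proof -
  have "(\<Prod>i<length fs. l2_inner (fs ! i) (gs ! p i)) = 
      (\<Prod>i = 0..<length fs. mat (length fs) (length fs) (\<lambda>(i, j). l2_inner (fs ! i) (gs ! j)) $$ (i, p i))"
    if p: "p permutes {0..<length fs}" for p
  proof (rule prod.cong)
    fix i assume "i \<in> {0..<length fs}"
    moreover have "p i < length fs" using permutes_in_image[OF p, of i] calculation by simp
    ultimately show "l2_inner (fs ! i) (gs ! p i) =
        mat (length fs) (length fs) (\<lambda>(i, j). l2_inner (fs ! i) (gs ! j)) $$ (i, p i)" by simp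
  qed auto
  then show ?thesis
    using assms unfolding wedge_inner_def Determinant.det_def
    by (simp add: atLeast0LessThan)
qed

text \<open>Laplace expansion of the Gram determinant along the row of \<open>f\<close>; for lists
  of incompatible lengths both sides vanish.\<close>

lemma wedge_inner_Cons:
  "wedge_inner (f # fs) gs =
    (\<Sum>j<length gs. (-1) ^ j * l2_inner f (gs ! j) * wedge_inner fs (delete_nth j gs))"
proof (cases "length gs = Suc (length fs)")
  case True
  let ?n = "Suc (length fs)"
  define A where "A = mat ?n ?n (\<lambda>(i, j). l2_inner ((f # fs) ! i) (gs ! j))"
  have "wedge_inner (f # fs) gs = Determinant.det A"
    using True by (simp add: wedge_inner_det A_def)
  also have "\<dots> = (\<Sum>j<?n. A $$ (0, j) * cofactor A 0 j)"
    by (rule laplace_expansion_row) (simp_all add: A_def)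
  also have "\<dots> = (\<Sum>j<?n. (-1) ^ j * l2_inner f (gs ! j) * wedge_inner fs (delete_nth j gs))"
  proof (rule sum.cong[OF refl])
    fix j assume j: "j \<in> {..<?n}"
    have l: "length (delete_nth j gs) = length fs" using True j by simp
    have "mat_delete A 0 j = mat (length fs) (length fs) (\<lambda>(i, k). l2_inner (fs ! i) (delete_nth j gs ! k))"
      using True j nth_delete_nth[of j gs]
      by (intro eq_matI) (auto simp: A_def mat_delete_def)
    then show "A $$ (0, j) * cofactor A 0 j = (-1) ^ j * l2_inner f (gs ! j) * wedge_inner fs (delete_nth j gs)"
      using j unfolding cofactor_def wedge_inner_det[OF l] by (simp add: A_def)
  qed
  finally show ?thesis using True by simp
next
  case False
  have "wedge_inner fs (delete_nth j gs) = 0" if "j < length gs" for j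
  proof -
    have "length (delete_nth j gs) \<noteq> length fs" using False that by auto
    then show ?thesis unfolding wedge_inner_def by simp
  qed
  moreover have "wedge_inner (f # fs) gs = 0" using False by (simp add: wedge_inner_def)
  ultimately show ?thesis by simp
qed

lemma wedge_inner_swap: "wedge_inner (f # g # fs) hs = - wedge_inner (g # f # fs) hs"
proof (cases "length hs = length (f # g # fs)")
  case True
  let ?n = "Suc (Suc (length fs))"
  define A where "A = (\<lambda>f g. mat ?n ?n (\<lambda>(i, j). l2_inner ((f # g # fs) ! i) (hs ! j)))"
  have "A f g = swaprows 0 1 (A g f)"
    by (intro eq_matI) (auto simp: A_def nth_Cons')
  then have "Determinant.det (A f g) = - Determinant.det (A g f)"
    using det_swaprows[of 0 ?n 1 "A g f"] by (simp add: A_def)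
  then show ?thesis using True by (simp add: wedge_inner_det A_def)
qed (simp add: wedge_inner_def)

text \<open>The contraction formula for a(f). At this point it is only an expression in lists, since
  it is not yet known to respect the relations between wedges.\<close>

definition annih_wedge ::
    "(real \<Rightarrow> 'k::{real_inner, banach, second_countable_topology} \<times> 'k) \<Rightarrow> (real \<Rightarrow> 'k \<times> 'k) list \<Rightarrow> 'k fock"
  where "annih_wedge f gs = (\<Sum>j<length gs. ((-1) ^ j * l2_inner f (gs ! j)) *\<^sub>C wedge (delete_nth j gs))"

lemma annih_wedge_Nil [simp]: "annih_wedge f [] = 0"
  by (simp add: annih_wedge_def)

lemma cinner_annih_wedge:
  assumes "fs \<in> lists square_integrable" "gs \<in> lists square_integrable"
  shows "cinner (wedge fs) (annih_wedge f gs) = wedge_inner (f # fs) gs"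
  unfolding annih_wedge_def wedge_inner_Cons
  by (simp add: cinner_sum_right cinner_scaleC_right cinner_wedge[OF assms(1) delete_nth_lists[OF assms(2)]])

definition l2_norm :: "(real \<Rightarrow> 'k::{real_inner, banach, second_countable_topology} \<times> 'k) \<Rightarrow> real" where
  "l2_norm f = sqrt (Re (l2_inner f f))"

lemma l2_inner_commute:
  "f \<in> square_integrable \<Longrightarrow> g \<in> square_integrable \<Longrightarrow> l2_inner g f = cnj (l2_inner f g)"
  by (rule psd_on_herm[OF psd_on_l2_inner])

lemma l2_norm_ge_0: 
  assumes "f \<in> square_integrable"
  shows "0 \<le> l2_norm f" "of_real ((l2_norm f)\<^sup>2) = l2_inner f f"
proof -
  have 1: "0 \<le> Re (l2_inner f f)"
    using psd_on_pos[OF psd_on_l2_inner, of "{f}" "\<lambda>_. 1"] assms by simp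
  then show "0 \<le> l2_norm f" by (simp add: l2_norm_def)
  have "Im (l2_inner f f) = 0"
    using l2_inner_commute[OF assms assms] by (metis cnj.simps(2) neg_equal_zero)
  with 1 show "of_real ((l2_norm f)\<^sup>2) = l2_inner f f"
    by (simp add: l2_norm_def complex_eq_iff)
qed

lemma wedge_inner_commute:
  "fs \<in> lists square_integrable \<Longrightarrow> gs \<in> lists square_integrable \<Longrightarrow> wedge_inner gs fs = cnj (wedge_inner fs gs)"
  by (rule psd_on_herm[OF psd_on_wedge_inner])

lemma sum_delete_nth_Cons:
  "(\<Sum>j<length (f # gs). h j (delete_nth j (f # gs)) :: 'a::comm_monoid_add)
    = h 0 gs + (\<Sum>j<length gs. h (Suc j) (f # delete_nth j gs))"
  by (simp add: sum.lessThan_Suc_shift del: sum.lessThan_Suc)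

text \<open>The anticommutation relation of creation and annihilation by the same \<open>f\<close>,
  read as an identity of kernels before the operators exist. It splits the Gram kernel scaled by the
  squared norm of \<open>f\<close> into two Gram kernels, so either one is dominated and both
  operators exist with norm at most \<open>l2_norm f\<close>.\<close>

lemma creation_kernel:
  assumes f: "f \<in> square_integrable" and fs: "fs \<in> lists square_integrable" and gs: "gs \<in> lists square_integrable"
  shows "of_real ((l2_norm f)\<^sup>2) * cinner (wedge fs) (wedge gs)
    = cinner (wedge (f # fs)) (wedge (f # gs)) + cinner (annih_wedge f fs) (annih_wedge f gs)"
proof -
  have a: "cinner (annih_wedge f fs) (wedge hs) = wedge_inner fs (f # hs)"
    if "hs \<in> lists square_integrable" for hs
    using cinner_annih_wedge[OF that fs, of f] wedge_inner_commute[of "f # hs" fs] that f fs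
      cinner_commute[of "annih_wedge f fs" "wedge hs"] by simp
  have "cinner (wedge (f # fs)) (wedge (f # gs)) = wedge_inner (f # fs) (f # gs)"
    using f fs gs by (intro cinner_wedge) auto
  also have "\<dots> = l2_inner f f * wedge_inner fs gs
      - (\<Sum>j<length gs. (-1) ^ j * l2_inner f (gs ! j) * wedge_inner fs (f # delete_nth j gs))"
    unfolding wedge_inner_Cons
    using sum_delete_nth_Cons[of "\<lambda>j hs. (-1) ^ j * l2_inner f ((f # gs) ! j) * wedge_inner fs hs" f gs]
    by (simp add: sum_negf)
  also have "(\<Sum>j<length gs. (-1) ^ j * l2_inner f (gs ! j) * wedge_inner fs (f # delete_nth j gs))
      = cinner (annih_wedge f fs) (annih_wedge f gs)"
    unfolding annih_wedge_def[of f gs]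
    by (simp add: cinner_sum_right cinner_scaleC_right a[OF delete_nth_lists[OF gs]])
  finally show ?thesis using l2_norm_ge_0[OF f] by (simp add: cinner_wedge[OF fs gs])
qed

lemma adjoint_pairI:
  fixes S T :: "'k::{real_inner, banach, second_countable_topology} fock \<Rightarrow> 'k fock"
  assumes S: "bounded_clinear S" and T: "bounded_clinear T"
    and eq: "\<And>fs gs. fs \<in> lists square_integrable \<Longrightarrow> gs \<in> lists square_integrable \<Longrightarrow>
      cinner (S (wedge fs)) (wedge gs) = cinner (wedge fs) (T (wedge gs))"
  shows "cinner (S x) y = cinner x (T y)"
proof -
  have bl: "bounded_linear S" "bounded_linear T" using S T by (auto simp: bounded_clinear_def)
  have 1: "cinner (S (wedge fs)) y = cinner (wedge fs) (T y)" if fs: "fs \<in> lists square_integrable" for fs y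
  proof -
    have "closed {y. cinner (S (wedge fs)) y = cinner (wedge fs) (T y)}"
      by (intro closed_Collect_eq bounded_bilinear.continuous_on[OF bounded_bilinear_cinner]
          continuous_intros linear_continuous_on bl)
    then have "{y. cinner (S (wedge fs)) y = cinner (wedge fs) (T y)} = UNIV"
      by (rule closed_subspace_eq_UNIV)
        (use eq[OF fs] in \<open>auto simp: bounded_clinearD[OF T] cinner_simps\<close>)
    then show ?thesis by blast
  qed
  have "closed {x. cinner (S x) y = cinner x (T y)}"
    by (intro closed_Collect_eq bounded_bilinear.continuous_on[OF bounded_bilinear_cinner]
          continuous_intros linear_continuous_on bl)
  then have "{x. cinner (S x) y = cinner x (T y)} = UNIV"
    by (rule closed_subspace_eq_UNIV) (use 1 in \<open>auto simp: bounded_clinearD[OF S] cinner_simps\<close>)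
  then show ?thesis by blast
qed

lemma creation_annihilation_exist:
  fixes f :: "real \<Rightarrow> 'k::{real_inner, banach, second_countable_topology} \<times> 'k"
  assumes f: "f \<in> square_integrable"
  obtains A B :: "'k fock \<Rightarrow> 'k fock" where "bounded_clinear A" "bounded_clinear B"
    "\<And>fs. fs \<in> lists square_integrable \<Longrightarrow> A (wedge fs) = wedge (f # fs)"
    "\<And>fs. fs \<in> lists square_integrable \<Longrightarrow> B (wedge fs) = annih_wedge f fs"
    "\<And>\<psi>. norm (A \<psi>) \<le> l2_norm f * norm \<psi>" "\<And>\<psi>. norm (B \<psi>) \<le> l2_norm f * norm \<psi>"
proof -
  have 1: "norm (lincomb (\<lambda>fs. wedge (f # fs)) v) \<le> l2_norm f * norm (lincomb wedge v)"
    if "v \<in> finsupp (lists square_integrable)" for v :: "(real \<Rightarrow> 'k \<times> 'k) list \<Rightarrow> complex"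
    by (rule norm_lincomb_le[where q = "annih_wedge f", OF that l2_norm_ge_0(1)[OF f] creation_kernel[OF f]])
  have 2: "norm (lincomb (annih_wedge f) v) \<le> l2_norm f * norm (lincomb wedge v)"
    if "v \<in> finsupp (lists square_integrable)" for v :: "(real \<Rightarrow> 'k \<times> 'k) list \<Rightarrow> complex"
    by (rule norm_lincomb_le[where q = "\<lambda>fs. wedge (f # fs)", OF that l2_norm_ge_0(1)[OF f]])
      (simp only: creation_kernel[OF f] add.commute)
  obtain A :: "'k fock \<Rightarrow> 'k fock" where A: "bounded_clinear A"
    "\<And>fs. fs \<in> lists square_integrable \<Longrightarrow> A (wedge fs) = wedge (f # fs)"
    "\<And>\<psi>. norm (A \<psi>) \<le> l2_norm f * norm \<psi>"
    using wedge_extension[OF 1] by blast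
  obtain B :: "'k fock \<Rightarrow> 'k fock" where B: "bounded_clinear B"
    "\<And>fs. fs \<in> lists square_integrable \<Longrightarrow> B (wedge fs) = annih_wedge f fs"
    "\<And>\<psi>. norm (B \<psi>) \<le> l2_norm f * norm \<psi>"
    using wedge_extension[OF 2] by blast
  show ?thesis by (rule that[OF A(1) B(1) A(2) B(2) A(3) B(3)])
qed

definition annihilation ::
    "(real \<Rightarrow> 'k::{real_inner, banach, second_countable_topology} \<times> 'k) \<Rightarrow> 'k fock \<Rightarrow> 'k fock" where
  "annihilation f = adj (creation f)"

context
  fixes f :: "real \<Rightarrow> 'k::{real_inner, banach, second_countable_topology} \<times> 'k"
  assumes f: "f \<in> square_integrable"
begin

text \<open>\<open>creation\<close> is a definite description and \<open>annihilation\<close> an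
  adjoint; both are identified here with the operators built from the kernels.\<close>

lemma creation_annihilation_aux:
  "bounded_clinear (creation f) \<and> bounded_clinear (annihilation f) \<and>
   (\<forall>fs\<in>lists square_integrable. creation f (wedge fs) = wedge (f # fs)) \<and>
   (\<forall>fs\<in>lists square_integrable. annihilation f (wedge fs) = annih_wedge f fs) \<and>
   (\<forall>\<psi>. norm (creation f \<psi>) \<le> l2_norm f * norm \<psi>) \<and>
   (\<forall>\<psi>. norm (annihilation f \<psi>) \<le> l2_norm f * norm \<psi>) \<and>
   (\<forall>\<psi> \<phi>. cinner (creation f \<psi>) \<phi> = cinner \<psi> (annihilation f \<phi>))"
proof -
  obtain A B :: "'k fock \<Rightarrow> 'k fock" where AB: "bounded_clinear A" "bounded_clinear B"
    "\<And>fs. fs \<in> lists square_integrable \<Longrightarrow> A (wedge fs) = wedge (f # fs)"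
    "\<And>fs. fs \<in> lists square_integrable \<Longrightarrow> B (wedge fs) = annih_wedge f fs"
    "\<And>\<psi>. norm (A \<psi>) \<le> l2_norm f * norm \<psi>" "\<And>\<psi>. norm (B \<psi>) \<le> l2_norm f * norm \<psi>"
    using creation_annihilation_exist[OF f] by blast
  have A: "creation f = A"
    unfolding creation_def
  proof (rule the_equality)
    show "T = A" if "bounded_clinear T \<and> (\<forall>fs\<in>lists square_integrable. T (wedge fs) = wedge (f # fs))" for T
      using that AB by (intro bounded_clinear_eqI) auto
  qed (use AB in auto)
  have *: "cinner (A x) y = cinner x (B y)" for x y
  proof (rule adjoint_pairI[OF AB(1,2)])
    fix fs gs :: "(real \<Rightarrow> 'k \<times> 'k) list"
    assume *: "fs \<in> lists square_integrable" "gs \<in> lists square_integrable"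
    have "f # fs \<in> lists square_integrable" using * f by simp
    then show "cinner (A (wedge fs)) (wedge gs) = cinner (wedge fs) (B (wedge gs))"
      using * by (simp add: AB cinner_annih_wedge cinner_wedge)
  qed
  then have "annihilation f = B"
    unfolding annihilation_def A by (rule adj_eqI)
  then show ?thesis using A AB * by auto
qed

lemma bounded_clinear_creation: "bounded_clinear (creation f)"
  and bounded_clinear_annihilation: "bounded_clinear (annihilation f)"
  and creation_wedge: "fs \<in> lists square_integrable \<Longrightarrow> creation f (wedge fs) = wedge (f # fs)"
  and annihilation_wedge: "fs \<in> lists square_integrable \<Longrightarrow> annihilation f (wedge fs) = annih_wedge f fs"
  and norm_annihilation: "norm (annihilation f \<psi>) \<le> l2_norm f * norm \<psi>"
  and cinner_creation: "cinner (creation f \<psi>) \<phi> = cinner \<psi> (annihilation f \<phi>)"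
  using creation_annihilation_aux by auto

lemma annihilation_Nil: "annihilation f (wedge []) = 0"
  by (simp add: annihilation_wedge)

lemma cinner_annihilation: "cinner (annihilation f \<psi>) \<phi> = cinner \<psi> (creation f \<phi>)"
proof -
  have "cinner (annihilation f \<psi>) \<phi> = cnj (cinner \<phi> (annihilation f \<psi>))" by (rule cinner_commute)
  also have "\<dots> = cnj (cinner (creation f \<phi>) \<psi>)" by (simp only: cinner_creation)
  also have "\<dots> = cinner \<psi> (creation f \<phi>)" by (rule cinner_commute[symmetric])
  finally show ?thesis .
qed

end

section \<open>The canonical anticommutation relations\<close>

lemma annih_wedge_Cons:
  assumes f: "f \<in> square_integrable" and g: "g \<in> square_integrable" and gs: "gs \<in> lists square_integrable"
  shows "annih_wedge f (g # gs) = l2_inner f g *\<^sub>C wedge gs - creation g (annih_wedge f gs)"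
proof -
  have "creation g (annih_wedge f gs)
      = (\<Sum>j<length gs. ((-1) ^ j * l2_inner f (gs ! j)) *\<^sub>C wedge (g # delete_nth j gs))"
    unfolding annih_wedge_def
    by (simp add: bounded_clinearD[OF bounded_clinear_creation[OF g]] creation_wedge[OF g delete_nth_lists[OF gs]])
  then show ?thesis
    unfolding annih_wedge_def
    using sum_delete_nth_Cons[of "\<lambda>j hs. ((-1) ^ j * l2_inner f ((g # gs) ! j)) *\<^sub>C wedge hs" g gs]
    by (simp add: scaleC_minus_left sum_negf)
qed

lemma annihilation_creation:
  assumes f: "f \<in> square_integrable" and g: "g \<in> square_integrable"
  shows "annihilation f (creation g \<psi>) = l2_inner f g *\<^sub>C \<psi> - creation g (annihilation f \<psi>)"
proof -
  note b = bounded_clinear_creation[OF g] bounded_clinear_annihilation[OF f]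
  have "(\<lambda>\<psi>. annihilation f (creation g \<psi>)) = (\<lambda>\<psi>. l2_inner f g *\<^sub>C \<psi> - creation g (annihilation f \<psi>))"
  proof (rule bounded_clinear_eqI)
    fix gs :: "(real \<Rightarrow> 'a \<times> 'a) list" assume gs: "gs \<in> lists square_integrable"
    moreover have "g # gs \<in> lists square_integrable" using gs g by simp
    ultimately show "annihilation f (creation g (wedge gs)) 
        = l2_inner f g *\<^sub>C wedge gs - creation g (annihilation f (wedge gs))"
      by (simp add: creation_wedge g annihilation_wedge f annih_wedge_Cons)
  qed (rule bounded_clinear_compose[OF b(2,1)]
      bounded_clinear_diff[OF bounded_clinear_scaleC[OF bounded_clinear_id(1)] bounded_clinear_compose[OF b]])+
  from fun_cong[OF this, of \<psi>] show ?thesis .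
qed

lemma creation_anticommute:
  assumes f: "f \<in> square_integrable" and g: "g \<in> square_integrable"
  shows "creation f (creation g \<psi>) = - creation g (creation f \<psi>)"
proof -
  note b = bounded_clinear_creation[OF g] bounded_clinear_creation[OF f]
  have "(\<lambda>\<psi>. creation f (creation g \<psi>)) = (\<lambda>\<psi>. (-1) *\<^sub>C creation g (creation f \<psi>))"
  proof (rule bounded_clinear_eqI)
    fix gs :: "(real \<Rightarrow> 'a \<times> 'a) list" assume gs: "gs \<in> lists square_integrable"
    have l: "g # gs \<in> lists square_integrable" "f # gs \<in> lists square_integrable"
      "f # g # gs \<in> lists square_integrable" "g # f # gs \<in> lists square_integrable" using gs g f by simp_all
    have "wedge (f # g # gs) = - wedge (g # f # gs)"
    proof (rule fock_eqI)
      fix hs :: "(real \<Rightarrow> 'a \<times> 'a) list" assume hs: "hs \<in> lists square_integrable"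
      show "cinner (wedge hs) (wedge (f # g # gs)) = cinner (wedge hs) (- wedge (g # f # gs))"
        unfolding cinner_minus_right cinner_wedge[OF hs l(3)] cinner_wedge[OF hs l(4)]
          wedge_inner_commute[OF l(3) hs] wedge_inner_commute[OF l(4) hs] wedge_inner_swap[of f] by simp
    qed
    then show "creation f (creation g (wedge gs)) = (-1) *\<^sub>C creation g (creation f (wedge gs))"
      using l gs by (simp add: creation_wedge f g scaleC_minus_left)
  qed (rule bounded_clinear_compose[OF b(2,1)] bounded_clinear_scaleC[OF bounded_clinear_compose[OF b]])+
  from fun_cong[OF this, of \<psi>] show ?thesis unfolding scaleC_minus_left scaleC_one .
qed

lemma annihilation_anticommute:
  assumes f: "f \<in> square_integrable" and g: "g \<in> square_integrable"
  shows "annihilation f (annihilation g \<psi>) = - annihilation g (annihilation f \<psi>)"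
proof (rule fock_eqI)
  fix hs :: "(real \<Rightarrow> 'a \<times> 'a) list" assume hs: "hs \<in> lists square_integrable"
  show "cinner (wedge hs) (annihilation f (annihilation g \<psi>)) 
      = cinner (wedge hs) (- annihilation g (annihilation f \<psi>))"
    using creation_anticommute[OF g f, of "wedge hs"]
    by (simp add: cinner_minus_left cinner_minus_right flip: cinner_creation[OF f] cinner_creation[OF g])
qed

section \<open>Square integrable functions on the half line\<close>

text \<open>Representatives are arbitrary on the negative axis. Multiplying by the indicator of the
  half line moves everything to \<open>lborel\<close>, where translation invariance is at hand for
  the shift.\<close>

lemma measurable_half_line_iff:
  fixes f :: "real \<Rightarrow> 'a::{real_inner, banach, second_countable_topology}"
  shows "f \<in> borel_measurable half_line \<longleftrightarrow> (\<lambda>s. indicator {0..} s *\<^sub>R f s) \<in> borel_measurable lborel"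
  by (rule borel_measurable_restrict_space_iff) simp

lemma integrable_half_line_iff:
  fixes f :: "real \<Rightarrow> 'a::{banach, second_countable_topology}"
  shows "integrable half_line f \<longleftrightarrow> integrable lborel (\<lambda>s. indicator {0..} s *\<^sub>R f s)"
  by (rule integrable_restrict_space) simp

lemma integral_half_line:
  fixes f :: "real \<Rightarrow> 'a::{banach, second_countable_topology}"
  shows "(LINT s|half_line. f s) = (LINT s|lborel. indicator {0..} s *\<^sub>R f s)"
  by (rule integral_restrict_space) simp

lemma square_integrable_iff:
  fixes f :: "real \<Rightarrow> 'a::{real_inner, banach, second_countable_topology}"
  shows "f \<in> square_integrable \<longleftrightarrow> (\<lambda>s. indicator {0..} s *\<^sub>R f s) \<in> borel_measurable lborel \<and>
    integrable lborel (\<lambda>s. (norm (indicator {0..} s *\<^sub>R f s))\<^sup>2)"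
proof -
  have "(\<lambda>s. (norm (indicator {0..} s *\<^sub>R f s))\<^sup>2) = (\<lambda>s. indicator {0..} s *\<^sub>R (norm (f s))\<^sup>2)"
    by (auto simp: fun_eq_iff indicator_def)
  then show ?thesis
    unfolding square_integrable_def measurable_half_line_iff integrable_half_line_iff by simp
qed

lemma square_integrable_dominated:
  fixes f :: "real \<Rightarrow> 'a::{real_inner, banach, second_countable_topology}"
    and g :: "real \<Rightarrow> 'b::{real_inner, banach, second_countable_topology}"
  assumes "f \<in> square_integrable" and g: "g \<in> borel_measurable half_line"
    and le: "\<And>s. norm (g s) \<le> C * norm (f s)"
  shows "g \<in> square_integrable"
proof -
  have "integrable half_line (\<lambda>s. (norm (g s))\<^sup>2)"
  proof (rule Bochner_Integration.integrable_bound)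
    show "integrable half_line (\<lambda>s. C\<^sup>2 * (norm (f s))\<^sup>2)"
      using assms(1) by (simp add: square_integrable_def)
    show "(\<lambda>s. (norm (g s))\<^sup>2) \<in> borel_measurable half_line" using g by measurable
    have "(norm (g s))\<^sup>2 \<le> C\<^sup>2 * (norm (f s))\<^sup>2" for s
      using power_mono[OF le[of s], of 2] by (simp add: power_mult_distrib)
    then show "AE s in half_line. norm ((norm (g s))\<^sup>2) \<le> norm (C\<^sup>2 * (norm (f s))\<^sup>2)"
      by (intro AE_I2) simp
  qed
  then show ?thesis using g by (simp add: square_integrable_def)
qed

lemma square_integrable_measurable: "f \<in> square_integrable \<Longrightarrow> f \<in> borel_measurable half_line"
  by (simp add: square_integrable_def)

lemma square_integrable_add:
  assumes f: "f \<in> square_integrable" and g: "g \<in> square_integrable"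
  shows "(\<lambda>s. f s + g s) \<in> square_integrable"
proof -
  note [measurable] = f[THEN square_integrable_measurable] g[THEN square_integrable_measurable]
  have "integrable half_line (\<lambda>s. (norm (f s + g s))\<^sup>2)"
  proof (rule Bochner_Integration.integrable_bound)
    show "integrable half_line (\<lambda>s. 2 * (norm (f s))\<^sup>2 + 2 * (norm (g s))\<^sup>2)"
      using f g by (simp add: square_integrable_def)
    have "(norm (x + y))\<^sup>2 \<le> 2 * (norm x)\<^sup>2 + 2 * (norm y)\<^sup>2" for x y :: 'a
    proof -
      have "(norm (x + y))\<^sup>2 \<le> (norm x + norm y)\<^sup>2"
        by (intro power_mono norm_triangle_ineq) simp
      also have "\<dots> \<le> 2 * (norm x)\<^sup>2 + 2 * (norm y)\<^sup>2"
        using sum_squares_bound[of "norm x" "norm y"] by (simp add: power2_sum)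
      finally show ?thesis .
    qed
    then show "AE s in half_line. norm ((norm (f s + g s))\<^sup>2) \<le> norm (2 * (norm (f s))\<^sup>2 + 2 * (norm (g s))\<^sup>2)"
      by (intro AE_I2) simp
  qed measurable
  then show ?thesis by (simp add: square_integrable_def)
qed

lemma square_integrable_mult:
  fixes f :: "real \<Rightarrow> 'a::{real_inner, banach, second_countable_topology}"
  assumes f: "f \<in> square_integrable" and m: "m \<in> borel_measurable borel" "\<And>s. \<bar>m s\<bar> \<le> 1"
  shows "(\<lambda>s. m s *\<^sub>R f s) \<in> square_integrable"
proof (rule square_integrable_dominated[OF f])
  note [measurable] = f[THEN square_integrable_measurable]
  have [measurable]: "m \<in> borel_measurable half_line"
    using m(1) by (simp add: measurable_restrict_space1)
  show "(\<lambda>s. m s *\<^sub>R f s) \<in> borel_measurable half_line" by measurable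
  show "norm (m s *\<^sub>R f s) \<le> 1 * norm (f s)" for s
    using m(2)[of s] by (simp add: mult_left_le_one_le)
qed

lemma square_integrable_scale:
  fixes f :: "real \<Rightarrow> 'a::{real_inner, banach, second_countable_topology}"
  assumes f: "f \<in> square_integrable"
  shows "(\<lambda>s. c *\<^sub>R f s) \<in> square_integrable"
  using f[THEN square_integrable_measurable]
  by (intro square_integrable_dominated[OF f, where C = "\<bar>c\<bar>"]) auto

lemma square_integrable_complexify:
  fixes f :: "real \<Rightarrow> 'a::{real_inner, banach, second_countable_topology}"
  assumes f: "f \<in> square_integrable"
  shows "(\<lambda>s. (f s, 0 :: 'a)) \<in> square_integrable"
proof (rule square_integrable_dominated[OF f, where C = 1])
  note [measurable] = f[THEN square_integrable_measurable]
  show "(\<lambda>s. (f s, 0 :: 'a)) \<in> borel_measurable half_line" by measurable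
qed (simp add: norm_prod_def)

lemma square_integrable_fst_snd:
  fixes f :: "real \<Rightarrow> 'a::{real_inner, banach, second_countable_topology} \<times> 'a"
  assumes f: "f \<in> square_integrable"
  shows "(\<lambda>s. fst (f s)) \<in> square_integrable" "(\<lambda>s. snd (f s)) \<in> square_integrable"
proof -
  note m = f[THEN square_integrable_measurable]
  have "(\<lambda>s. fst (f s)) \<in> borel_measurable half_line" "(\<lambda>s. snd (f s)) \<in> borel_measurable half_line"
    using m by (auto intro!: borel_measurable_continuous_on[where f = fst]
        borel_measurable_continuous_on[where f = snd] continuous_intros)
  moreover have "norm (fst p) \<le> 1 * norm p" "norm (snd p) \<le> 1 * norm p" for p :: "'a \<times> 'a"
    using norm_fst_le[of "fst p" "snd p"] norm_snd_le[of "snd p" "fst p"] by simp_all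
  ultimately show "(\<lambda>s. fst (f s)) \<in> square_integrable" "(\<lambda>s. snd (f s)) \<in> square_integrable"
    using square_integrable_dominated[OF f] by blast+
qed

section \<open>Translations and the one-particle shift\<close>

lemma integrable_lborel_translate:
  fixes f :: "real \<Rightarrow> 'a::{banach, second_countable_topology}"
  shows "integrable lborel f \<Longrightarrow> integrable lborel (\<lambda>s. f (s + t))"
  using lborel_integrable_real_affine[of f 1 t] by (simp add: add.commute)

lemma integral_lborel_translate:
  fixes f :: "real \<Rightarrow> 'a::{banach, second_countable_topology}"
  shows "(LINT s|lborel. f (s + t)) = (LINT s|lborel. f s)"
  using lborel_integral_real_affine[of 1 f t] by (simp add: add.commute)

lemma square_integrable_shift:
  fixes f :: "real \<Rightarrow> 'a::{real_inner, banach, second_countable_topology}"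
  assumes f: "f \<in> square_integrable" and t: "t \<ge> 0"
  shows "shift t f \<in> square_integrable"
proof -
  have e: "indicator {0..} s *\<^sub>R shift t f s = indicator {0..} (s + - t) *\<^sub>R f (s + - t)" for s
    using t by (auto simp: shift_def indicator_def)
  note * = f[unfolded square_integrable_iff]
  have [measurable]: "(\<lambda>s. indicator {0..} s *\<^sub>R f s) \<in> borel_measurable borel" using * by simp
  have "(\<lambda>s. (\<lambda>s. indicator {0..} s *\<^sub>R f s) (s + - t)) \<in> borel_measurable borel" by measurable
  then show ?thesis
    unfolding square_integrable_iff e using integrable_lborel_translate[OF conjunct2[OF *], of "- t"] by simp
qed

lemma square_integrable_unshift:
  fixes f :: "real \<Rightarrow> 'a::{real_inner, banach, second_countable_topology}"
  assumes f: "f \<in> square_integrable" and t: "t \<ge> 0"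
  shows "(\<lambda>s. f (s + t)) \<in> square_integrable"
proof -
  note * = f[unfolded square_integrable_iff]
  have e: "indicator {0..} s *\<^sub>R f (s + t) = indicator {0..} s *\<^sub>R indicator {0..} (s + t) *\<^sub>R f (s + t)" for s
    using t by (auto simp: indicator_def)
  have [measurable]: "(\<lambda>s. indicator {0..} s *\<^sub>R f s) \<in> borel_measurable borel" using * by simp
  have m: "(\<lambda>s. indicator {0..} s *\<^sub>R (\<lambda>s. indicator {0..} s *\<^sub>R f s) (s + t)) \<in> borel_measurable borel"
    by measurable
  have "integrable lborel (\<lambda>s. (norm (indicator {0..} s *\<^sub>R indicator {0..} (s + t) *\<^sub>R f (s + t)))\<^sup>2)"
  proof (rule Bochner_Integration.integrable_bound[OF integrable_lborel_translate[OF conjunct2[OF *], of t]])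
    show "(\<lambda>s. (norm (indicator {0..} s *\<^sub>R indicator {0..} (s + t) *\<^sub>R f (s + t)))\<^sup>2) \<in> borel_measurable lborel"
      using m by measurable
  qed (auto simp: indicator_def)
  then show ?thesis
    unfolding square_integrable_iff e using m by simp
qed

lemma cplx_inner_add_left: "cplx_inner (y + z) x = cplx_inner y x + cplx_inner z x"
  by (simp add: cplx_inner_def complex_eq_iff inner_add_left)

lemma cplx_inner_scaleR: "cplx_inner (r *\<^sub>R x) y = of_real r * cplx_inner x y"
  "cplx_inner x (r *\<^sub>R y) = of_real r * cplx_inner x y"
  by (simp_all add: cplx_inner_def complex_eq_iff algebra_simps)

lemma l2_inner_add_left:
  assumes "f \<in> square_integrable" "g \<in> square_integrable" "h \<in> square_integrable"
  shows "l2_inner (\<lambda>s. f s + g s) h = l2_inner f h + l2_inner g h"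
  unfolding l2_inner_def cplx_inner_add_left
  by (intro Bochner_Integration.integral_add integrable_cplx_inner assms)

lemma l2_inner_scaleR_left: "l2_inner (\<lambda>s. c *\<^sub>R f s) g = of_real c * l2_inner f g"
  unfolding l2_inner_def cplx_inner_scaleR by simp

lemma l2_inner_mult: "l2_inner (\<lambda>s. m s *\<^sub>R f s) g = l2_inner f (\<lambda>s. m s *\<^sub>R g s)"
  unfolding l2_inner_def cplx_inner_scaleR ..

text \<open>A pair (x, y) means x + i y and the form is conjugate linear on the left, hence the
  minus sign. This is the bridge from complex one-particle functions to the real ones that index the
  Clifford fields.\<close>

lemma l2_inner_complexify:
  fixes f :: "real \<Rightarrow> 'a::{real_inner, banach, second_countable_topology} \<times> 'a"
  assumes "f \<in> square_integrable" "g \<in> square_integrable"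
  shows "l2_inner f g = l2_inner (\<lambda>s. (fst (f s), 0)) g - \<i> * l2_inner (\<lambda>s. (snd (f s), 0)) g"
proof -
  have "cplx_inner (f s) (g s) = cplx_inner (fst (f s), 0) (g s) - \<i> * cplx_inner (snd (f s), 0) (g s)" for s
    by (simp add: cplx_inner_def complex_eq_iff)
  then have "l2_inner f g = (LINT s|half_line. cplx_inner (fst (f s), 0) (g s) - \<i> * cplx_inner (snd (f s), 0) (g s))"
    unfolding l2_inner_def by simp
  also have "\<dots> = (LINT s|half_line. cplx_inner (fst (f s), 0) (g s)) - (LINT s|half_line. \<i> * cplx_inner (snd (f s), 0) (g s))"
    by (intro Bochner_Integration.integral_diff integrable_mult_right integrable_cplx_inner
        square_integrable_complexify square_integrable_fst_snd assms)
  finally show ?thesis by (simp add: l2_inner_def)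
qed

lemma l2_inner_real_commute: "l2_inner (\<lambda>s. (f s, 0)) (\<lambda>s. (g s, 0)) = l2_inner (\<lambda>s. (g s, 0)) (\<lambda>s. (f s, 0))"
  by (simp add: l2_inner_def cplx_inner_def inner_commute)

section \<open>Square waves converge weakly to zero\<close>

definition wave :: "real \<Rightarrow> real \<Rightarrow> real" where
  "wave d t = (if even \<lfloor>t / d\<rfloor> then 1 else - 1)"

lemma abs_wave [simp]: "\<bar>wave d t\<bar> = 1"
  by (simp add: wave_def)

lemma wave_mult_self [simp]: "wave d t * wave d t = 1"
  by (simp add: wave_def)

lemma wave_add: "d > 0 \<Longrightarrow> wave d (t + d) = - wave d t"
  by (simp add: wave_def add_divide_distrib)

lemma measurable_wave [measurable]: "wave d \<in> borel_measurable borel"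
proof -
  have "(\<lambda>t. \<lfloor>t / d\<rfloor>) \<in> borel \<rightarrow>\<^sub>M count_space UNIV" by measurable
  then have "{t. even \<lfloor>t / d\<rfloor>} \<in> sets borel"
    using measurable_sets[of "\<lambda>t. \<lfloor>t / d\<rfloor>" borel "count_space UNIV" "{k. even k}"] by (simp add: vimage_def)
  then show ?thesis unfolding wave_def by measurable
qed

text \<open>The Riemann-Lebesgue property for square waves. Integrability is part of it, so that the
  property can be carried through an induction over sets and over integrable functions.\<close>

definition wave_null :: "(real \<Rightarrow> 'a::{banach, second_countable_topology}) \<Rightarrow> bool" where
  "wave_null h \<longleftrightarrow> integrable lborel h \<and> (\<forall>d. (\<forall>n. 0 < d n) \<longrightarrow> d \<longlonglongrightarrow> 0 \<longrightarrow>
    (\<lambda>n. LINT t|lborel. wave (d n) t *\<^sub>R h t) \<longlonglongrightarrow> 0)"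

lemma integrable_wave:
  fixes h :: "real \<Rightarrow> 'a::{banach, second_countable_topology}"
  assumes "integrable lborel h" shows "integrable lborel (\<lambda>t. wave d t *\<^sub>R h t)"
proof (rule Bochner_Integration.integrable_bound[OF assms])
  have [measurable]: "h \<in> borel_measurable borel" using borel_measurable_integrable[OF assms] by simp
  show "(\<lambda>t. wave d t *\<^sub>R h t) \<in> borel_measurable lborel" by measurable
qed simp

lemma wave_null_add:
  assumes "wave_null g" "wave_null h"
  shows "wave_null (\<lambda>t. g t + h t)"
  unfolding wave_null_def
proof (intro conjI allI impI)
  fix d :: "nat \<Rightarrow> real" assume d: "\<forall>n. 0 < d n" "d \<longlonglongrightarrow> 0"
  have "(\<lambda>n. (LINT t|lborel. wave (d n) t *\<^sub>R g t) + (LINT t|lborel. wave (d n) t *\<^sub>R h t)) \<longlonglongrightarrow> 0 + 0"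
    using assms d by (intro tendsto_add) (auto simp: wave_null_def)
  then show "(\<lambda>n. LINT t|lborel. wave (d n) t *\<^sub>R (g t + h t)) \<longlonglongrightarrow> 0"
    using assms by (simp add: scaleR_add_right integrable_wave wave_null_def)
qed (use assms in \<open>auto simp: wave_null_def\<close>)

lemma wave_null_scale:
  fixes h :: "real \<Rightarrow> real" and c :: "'a::{banach, second_countable_topology}"
  assumes "wave_null h"
  shows "wave_null (\<lambda>t. h t *\<^sub>R c)"
  unfolding wave_null_def
proof (intro conjI allI impI)
  have h: "integrable lborel h" using assms by (simp add: wave_null_def)
  then show "integrable lborel (\<lambda>t. h t *\<^sub>R c)" by simp
  fix d :: "nat \<Rightarrow> real" assume d: "\<forall>n. 0 < d n" "d \<longlonglongrightarrow> 0"
  have "(\<lambda>n. (LINT t|lborel. wave (d n) t *\<^sub>R h t) *\<^sub>R c) \<longlonglongrightarrow> 0 *\<^sub>R c"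
    using assms d by (intro tendsto_scaleR) (auto simp: wave_null_def)
  moreover have "(LINT t|lborel. wave (d n) t *\<^sub>R h t *\<^sub>R c) = (LINT t|lborel. wave (d n) t *\<^sub>R h t) *\<^sub>R c" for n
    using integral_scaleR_left[where f = "\<lambda>t. wave (d n) t *\<^sub>R h t" and c = c and M = lborel]
      integrable_wave[OF h, of "d n"] by simp
  ultimately show "(\<lambda>n. LINT t|lborel. wave (d n) t *\<^sub>R h t *\<^sub>R c) \<longlonglongrightarrow> 0" by simp
qed

lemma wave_null_diff:
  fixes g h :: "real \<Rightarrow> real"
  assumes "wave_null g" "wave_null h"
  shows "wave_null (\<lambda>t. g t - h t)"
  using wave_null_add[OF assms(1) wave_null_scale[OF assms(2), of "-1"]] by simp

text \<open>Dominated convergence gives convergence in L1. Since the wave has modulus one, an L1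
  error changes the integral by at most that error, uniformly in the period.\<close>

lemma wave_null_lim:
  fixes h :: "real \<Rightarrow> 'a::{banach, second_countable_topology}"
  assumes s: "\<And>i. wave_null (s i)" and h: "integrable lborel h"
    and lim: "\<And>t. (\<lambda>i. s i t) \<longlonglongrightarrow> h t" and w: "integrable lborel w" "\<And>i t. norm (s i t) \<le> w t"
  shows "wave_null h"
  unfolding wave_null_def
proof (intro conjI allI impI h)
  fix d :: "nat \<Rightarrow> real" assume d: "\<forall>n. 0 < d n" "d \<longlonglongrightarrow> 0"
  have si: "integrable lborel (s i)" for i using s by (simp add: wave_null_def)
  have hw: "norm (h t) \<le> w t" for t
    by (rule LIMSEQ_le_const2[OF tendsto_norm[OF lim]]) (use w(2) in blast)
  have "(\<lambda>i. LINT t|lborel. norm (s i t - h t)) \<longlonglongrightarrow> integral\<^sup>L lborel (\<lambda>t :: real. 0 :: real)"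
  proof (rule integral_dominated_convergence[where w = "\<lambda>t. 2 * w t"])
    show "AE t in lborel. (\<lambda>i. norm (s i t - h t)) \<longlonglongrightarrow> 0"
      using lim by (intro AE_I2 tendsto_norm_zero) (simp add: LIM_zero_iff)
    show "AE t in lborel. norm (norm (s i t - h t)) \<le> 2 * w t" for i
    proof (intro AE_I2)
      fix t show "norm (norm (s i t - h t)) \<le> 2 * w t"
        using norm_triangle_ineq4[of "s i t" "h t"] w(2)[of i t] hw[of t] by simp
    qed
  qed (use w h si in auto)
  then have l: "(\<lambda>i. LINT t|lborel. norm (s i t - h t)) \<longlonglongrightarrow> 0" by simp
  show "(\<lambda>n. LINT t|lborel. wave (d n) t *\<^sub>R h t) \<longlonglongrightarrow> 0"
  proof (rule LIMSEQ_I)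
    fix e :: real assume "e > 0"
    then have e2: "e / 2 > 0" by simp
    obtain i where "norm ((LINT t|lborel. norm (s i t - h t)) - 0) < e / 2"
      using LIMSEQ_D[OF l e2] by blast
    then have i: "(LINT t|lborel. norm (s i t - h t)) < e / 2" by simp
    have "(\<lambda>n. LINT t|lborel. wave (d n) t *\<^sub>R s i t) \<longlonglongrightarrow> 0"
      using s[of i] d by (simp add: wave_null_def)
    from LIMSEQ_D[OF this e2] obtain N where
      N: "\<And>n. n \<ge> N \<Longrightarrow> norm (LINT t|lborel. wave (d n) t *\<^sub>R s i t) < e / 2" by auto
    have "norm ((LINT t|lborel. wave (d n) t *\<^sub>R h t) - 0) < e" if "n \<ge> N" for n
    proof -
      have "(LINT t|lborel. wave (d n) t *\<^sub>R s i t) - (LINT t|lborel. wave (d n) t *\<^sub>R h t)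
          = (LINT t|lborel. wave (d n) t *\<^sub>R (s i t - h t))"
        by (simp add: scaleR_diff_right integrable_wave si h)
      also have "norm \<dots> \<le> (LINT t|lborel. norm (wave (d n) t *\<^sub>R (s i t - h t)))"
        by (rule integral_norm_bound)
      also have "\<dots> < e / 2" using i by simp
      finally show ?thesis
        using N[OF that] norm_triangle_ineq4[of "LINT t|lborel. wave (d n) t *\<^sub>R s i t"
            "(LINT t|lborel. wave (d n) t *\<^sub>R s i t) - (LINT t|lborel. wave (d n) t *\<^sub>R h t)"] by simp
    qed
    then show "\<exists>N. \<forall>n\<ge>N. norm ((LINT t|lborel. wave (d n) t *\<^sub>R h t) - 0) < e" by blast
  qed
qed

text \<open>Translating by the half period \<open>d\<close> changes the sign of the wave, so twice the integral of the
  wave over an interval is an integral over two intervals of length \<open>d\<close>.\<close>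

lemma wave_null_interval:
  assumes ab: "a \<le> b"
  shows "wave_null (indicator {a..<b} :: real \<Rightarrow> real)"
  unfolding wave_null_def
proof (intro conjI allI impI)
  have ii: "integrable lborel (indicator {x..<y} :: real \<Rightarrow> real)" for x y
    by (cases "x \<le> y") (auto simp: integrable_real_indicator)
  show "integrable lborel (indicator {a..<b} :: real \<Rightarrow> real)" by (rule ii)
  fix d :: "nat \<Rightarrow> real" assume d: "\<forall>n. 0 < d n" "d \<longlonglongrightarrow> 0"
  have "\<bar>LINT t|lborel. wave e t *\<^sub>R indicator {a..<b} t\<bar> \<le> e" if e: "e > 0" for e :: real
  proof -
    let ?I = "LINT t|lborel. wave e t *\<^sub>R (indicator {a..<b} t :: real)"
    let ?J = "LINT t|lborel. wave e t *\<^sub>R (indicator {a + e..<b + e} t :: real)"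
    have "?J = (LINT t|lborel. wave e (t + e) *\<^sub>R indicator {a + e..<b + e} (t + e))"
      by (rule integral_lborel_translate[symmetric])
    also have "(\<lambda>t. wave e (t + e) *\<^sub>R (indicator {a + e..<b + e} (t + e) :: real))
        = (\<lambda>t. - (wave e t *\<^sub>R indicator {a..<b} t))"
      using e by (auto simp: fun_eq_iff wave_add indicator_def)
    finally have "?I - ?J = 2 * ?I" by simp
    moreover have "?I - ?J = (LINT t|lborel. wave e t *\<^sub>R (indicator {a..<b} t - indicator {a + e..<b + e} t))"
      unfolding scaleR_diff_right
      by (rule Bochner_Integration.integral_diff[symmetric]) (intro integrable_wave ii)+
    ultimately have "2 * \<bar>?I\<bar> = norm (LINT t|lborel. wave e t *\<^sub>R (indicator {a..<b} t - indicator {a + e..<b + e} t :: real))"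
      by simp
    also have "\<dots> \<le> (LINT t|lborel. indicator {a..<a + e} t + indicator {b..<b + e} t :: real)"
    proof (rule Bochner_Integration.integral_norm_bound_integral)
      show "integrable lborel (\<lambda>t. wave e t *\<^sub>R (indicator {a..<b} t - indicator {a + e..<b + e} t :: real))"
        by (intro integrable_wave Bochner_Integration.integrable_diff ii)
      show "integrable lborel (\<lambda>t. indicator {a..<a + e} t + indicator {b..<b + e} t :: real)"
        by (intro Bochner_Integration.integrable_add ii)
      show "norm (wave e t *\<^sub>R (indicator {a..<b} t - indicator {a + e..<b + e} t :: real))
          \<le> indicator {a..<a + e} t + indicator {b..<b + e} t" for t
        using ab e by (auto simp: indicator_def)
    qed
    also have "\<dots> = 2 * e" 
      using e ii[of a "a + e"] ii[of b "b + e"] by simp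
    finally show ?thesis by simp
  qed
  then show "(\<lambda>n. LINT t|lborel. wave (d n) t *\<^sub>R (indicator {a..<b} t :: real)) \<longlonglongrightarrow> 0"
    using d by (intro Lim_null_comparison[OF always_eventually d(2)]) simp
qed

text \<open>Induction over the sigma-algebra generated by the half-lines {..<a}, in its version for
  complements and disjoint unions. The window [-K, K) keeps complements integrable and dominates all
  partial unions.\<close>

lemma wave_null_bounded_set:
  assumes A: "A \<in> sets borel"
  shows "wave_null (indicator (A \<inter> {- K..<K}) :: real \<Rightarrow> real)"
proof (cases "K \<ge> 0")
  case K: True
  have S: "integrable lborel (indicator {- K..<K} :: real \<Rightarrow> real)"
    using wave_null_interval[of "- K" K] K by (simp add: wave_null_def)
  have "Int_stable (range (lessThan :: real \<Rightarrow> real set))"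
  proof -
    have "{..<a} \<inter> {..<b} = {..<min a b}" for a b :: real by auto
    then show ?thesis by (auto simp: Int_stable_def)
  qed
  moreover have "range (lessThan :: real \<Rightarrow> real set) \<subseteq> Pow UNIV" by simp
  moreover have "A \<in> sigma_sets UNIV (range lessThan)"
    using A unfolding borel_Iio by simp
  ultimately show ?thesis
  proof (induction A rule: sigma_sets_induct_disjoint)
    case (basic A)
    then obtain a where a: "A = {..<a}" by auto
    have "A \<inter> {- K..<K} = {- K..<max (- K) (min a K)}" using a K by auto
    then show ?case using wave_null_interval[of "- K" "max (- K) (min a K)"] by simp
  next
    case empty
    show ?case by (simp add: wave_null_def)
  next
    case (compl A)
    have "(indicator ((UNIV - A) \<inter> {- K..<K}) :: real \<Rightarrow> real) = 
        (\<lambda>t. indicator {- K..<K} t - indicator (A \<inter> {- K..<K}) t)"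
      by (auto simp: fun_eq_iff indicator_def)
    then show ?case using wave_null_diff[OF wave_null_interval compl(2), of "- K" K] K by simp
  next
    case (union A)
    have fin: "wave_null (indicator ((\<Union>i<n. A i) \<inter> {- K..<K}) :: real \<Rightarrow> real)" for n
    proof (induction n)
      case 0
      show ?case by (simp add: wave_null_def)
    next
      case (Suc n)
      have "A n \<inter> A i = {}" if "i < n" for i
        using disjoint_family_onD[OF union(1), of n i] that by simp
      then have "A n \<inter> (\<Union>i<n. A i) = {}" by auto
      then have "(indicator ((\<Union>i<Suc n. A i) \<inter> {- K..<K}) :: real \<Rightarrow> real) = 
        (\<lambda>t. indicator (A n \<inter> {- K..<K}) t + indicator ((\<Union>i<n. A i) \<inter> {- K..<K}) t)"
        by (auto simp: fun_eq_iff indicator_def lessThan_Suc)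
      then show ?case using wave_null_add[OF union(3)[of n] Suc] by simp
    qed
    have Ai: "A i \<in> sets borel" for i using union(2) unfolding borel_Iio by auto
    show ?case
    proof (rule wave_null_lim[OF fin _ _ S])
      show "integrable lborel (indicator ((\<Union>i. A i) \<inter> {- K..<K}) :: real \<Rightarrow> real)"
        by (rule Bochner_Integration.integrable_bound[OF S]) (use Ai in \<open>auto simp: indicator_def\<close>)
      show "(\<lambda>n. indicator ((\<Union>i<n. A i) \<inter> {- K..<K}) t :: real) \<longlonglongrightarrow> indicator ((\<Union>i. A i) \<inter> {- K..<K}) t" for t
      proof (cases "t \<in> (\<Union>i. A i) \<inter> {- K..<K}")
        case True
        then obtain j where "t \<in> A j" by auto
        then have "indicator ((\<Union>i<n. A i) \<inter> {- K..<K}) t = (1 :: real)" if "n > j" for n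
          using that True by (auto simp: indicator_def)
        then have "\<forall>\<^sub>F n in sequentially. indicator ((\<Union>i<n. A i) \<inter> {- K..<K}) t = (1 :: real)"
          unfolding eventually_sequentially by (intro exI[of _ "Suc j"]) auto
        then show ?thesis using True by (simp add: tendsto_eventually)
      next
        case False
        then have "indicator ((\<Union>i<n. A i) \<inter> {- K..<K}) t = (0 :: real)" for n
          by (auto simp: indicator_def)
        then show ?thesis using False by simp
      qed
      show "norm (indicator ((\<Union>i<n. A i) \<inter> {- K..<K}) t :: real) \<le> indicator {- K..<K} t" for n t
        by (auto simp: indicator_def)
    qed
  qed
next
  case False
  then have "A \<inter> {- K..<K} = {}" by auto
  then show ?thesis using wave_null_interval[of 0 0] by simp
qed

text \<open>For a set of finite measure the windows exhaust it and its own indicator dominates;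
  linearity and dominated limits then reach every integrable function.\<close>

lemma wave_null_integrable:
  fixes h :: "real \<Rightarrow> 'a::{banach, second_countable_topology}"
  assumes "integrable lborel h"
  shows "wave_null h"
  using assms
proof (induction h rule: integrable_induct)
  case (base A c)
  have i: "integrable lborel (indicator A :: real \<Rightarrow> real)"
    using base by (simp add: integrable_real_indicator)
  have "wave_null (indicator A :: real \<Rightarrow> real)"
  proof (rule wave_null_lim[OF wave_null_bounded_set i _ i])
    show "A \<in> sets borel" using base by simp
    show "(\<lambda>n. indicator (A \<inter> {- real n..<real n}) t :: real) \<longlonglongrightarrow> indicator A t" for t
    proof -
      obtain j where "real j > \<bar>t\<bar>" using reals_Archimedean2 by blast
      then have "indicator (A \<inter> {- real n..<real n}) t = (indicator A t :: real)" if "n > j" for n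
        using that by (auto simp: indicator_def)
      then have "\<forall>\<^sub>F n in sequentially. indicator (A \<inter> {- real n..<real n}) t = (indicator A t :: real)"
        unfolding eventually_sequentially by (intro exI[of _ "Suc j"]) auto
      then show ?thesis by (simp add: tendsto_eventually)
    qed
  qed (auto simp: indicator_def)
  then show ?case by (rule wave_null_scale)
next
  case (add f g)
  then show ?case by (intro wave_null_add)
next
  case (lim f s)
  show ?case
    by (rule wave_null_lim[where s = s and w = "\<lambda>t. 2 * norm (f t)"]) (use lim in auto)
qed

lemma l2_inner_wave_tendsto:
  assumes "f \<in> square_integrable" "g \<in> square_integrable" "\<And>n. 0 < d n" "d \<longlonglongrightarrow> 0"
  shows "(\<lambda>n. l2_inner (\<lambda>s. wave (d n) s *\<^sub>R f s) g) \<longlonglongrightarrow> 0"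
proof -
  have "integrable lborel (\<lambda>s. indicator {0..} s *\<^sub>R cplx_inner (f s) (g s))"
    using integrable_cplx_inner[OF assms(1,2)] by (simp add: integrable_half_line_iff)
  from wave_null_integrable[OF this]
  have "(\<lambda>n. LINT t|lborel. wave (d n) t *\<^sub>R indicator {0..} t *\<^sub>R cplx_inner (f t) (g t)) \<longlonglongrightarrow> 0"
    using assms(3,4) by (simp add: wave_null_def)
  moreover have "l2_inner (\<lambda>s. wave (d n) s *\<^sub>R f s) g
      = (LINT t|lborel. wave (d n) t *\<^sub>R indicator {0..} t *\<^sub>R cplx_inner (f t) (g t))" for n
    unfolding l2_inner_def integral_half_line cplx_inner_scaleR by (simp add: scaleR_conv_of_real mult_ac)
  ultimately show ?thesis by simp
qed

section \<open>Linearity of the creation operators and second quantisation of sign changes\<close>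

text \<open>The hypothesis \<open>e\<close> is the weak form of \<open>h\<close> = \<open>a\<close>
  \<open>f\<close> + \<open>b\<close> \<open>g\<close>, with conjugates because
  \<open>l2_inner\<close> is conjugate linear on the left. It is all that the annihilation formula
  sees of \<open>h\<close>, and it makes sense without a complex scalar action on pairs. Creation
  follows by taking adjoints.\<close>

lemma
  fixes f g h :: "real \<Rightarrow> 'k::{real_inner, banach, second_countable_topology} \<times> 'k"
  assumes h: "h \<in> square_integrable" and f: "f \<in> square_integrable" and g: "g \<in> square_integrable"
    and e: "\<And>k. k \<in> square_integrable \<Longrightarrow> l2_inner h k = cnj a * l2_inner f k + cnj b * l2_inner g k"
  shows annihilation_lincomb:
      "annihilation h \<psi> = cnj a *\<^sub>C annihilation f \<psi> + cnj b *\<^sub>C annihilation g \<psi>" (is ?B)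
    and creation_lincomb: "creation h \<psi> = a *\<^sub>C creation f \<psi> + b *\<^sub>C creation g \<psi>" (is ?A)
proof -
  have B: "annihilation h \<psi> = cnj a *\<^sub>C annihilation f \<psi> + cnj b *\<^sub>C annihilation g \<psi>" for \<psi>
  proof -
    note b = bounded_clinear_annihilation[OF f] bounded_clinear_annihilation[OF g]
      bounded_clinear_annihilation[OF h]
    have "annihilation h = (\<lambda>\<psi>. cnj a *\<^sub>C annihilation f \<psi> + cnj b *\<^sub>C annihilation g \<psi>)"
    proof (rule bounded_clinear_eqI)
      show "bounded_clinear (\<lambda>\<psi>. cnj a *\<^sub>C annihilation f \<psi> + cnj b *\<^sub>C annihilation g \<psi>)"
        by (intro bounded_clinear_add bounded_clinear_scaleC b)
      fix gs :: "(real \<Rightarrow> 'k \<times> 'k) list" assume gs: "gs \<in> lists square_integrable"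
      have "gs ! j \<in> square_integrable" if "j < length gs" for j
        using gs that by (auto simp: in_lists_conv_set)
      then show "annihilation h (wedge gs) = cnj a *\<^sub>C annihilation f (wedge gs) + cnj b *\<^sub>C annihilation g (wedge gs)"
        unfolding annihilation_wedge[OF h gs] annihilation_wedge[OF f gs] annihilation_wedge[OF g gs]
          annih_wedge_def scaleC_sum_right sum.distrib[symmetric]
        by (intro sum.cong refl) (simp add: e scaleC_scaleC algebra_simps flip: scaleC_add_left)
    qed (rule b)
    then show ?thesis by simp
  qed
  show ?B by (rule B)
  show ?A
  proof (rule fock_eqI)
    fix hs :: "(real \<Rightarrow> 'k \<times> 'k) list"
    show "cinner (wedge hs) (creation h \<psi>) = cinner (wedge hs) (a *\<^sub>C creation f \<psi> + b *\<^sub>C creation g \<psi>)"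
      by (simp add: cinner_simps B flip: cinner_annihilation[OF f] cinner_annihilation[OF g] cinner_annihilation[OF h])
  qed
qed

lemma
  assumes f: "f \<in> square_integrable"
  shows creation_scaleR: "creation (\<lambda>s. c *\<^sub>R f s) \<psi> = c *\<^sub>R creation f \<psi>"
    and annihilation_scaleR: "annihilation (\<lambda>s. c *\<^sub>R f s) \<psi> = c *\<^sub>R annihilation f \<psi>"
  using creation_lincomb[OF square_integrable_scale[OF f] f f, of c "of_real c" 0]
    annihilation_lincomb[OF square_integrable_scale[OF f] f f, of c "of_real c" 0]
  by (simp_all add: l2_inner_scaleR_left scaleR_scaleC)

lemma
  assumes f: "f \<in> square_integrable" and g: "g \<in> square_integrable"
  shows creation_add: "creation (\<lambda>s. f s + g s) \<psi> = creation f \<psi> + creation g \<psi>"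
    and annihilation_add: "annihilation (\<lambda>s. f s + g s) \<psi> = annihilation f \<psi> + annihilation g \<psi>"
  using creation_lincomb[OF square_integrable_add[OF f g] f g, of 1 1]
    annihilation_lincomb[OF square_integrable_add[OF f g] f g, of 1 1]
  by (simp_all add: l2_inner_add_left f g)

abbreviation complexify :: "(real \<Rightarrow> 'k::zero) \<Rightarrow> real \<Rightarrow> 'k \<times> 'k" where
  "complexify f \<equiv> (\<lambda>s. (f s, 0))"

lemma
  assumes f: "f \<in> square_integrable"
  shows creation_complexify: "creation f \<psi> =
      creation (complexify (\<lambda>s. fst (f s))) \<psi> + \<i> *\<^sub>C creation (complexify (\<lambda>s. snd (f s))) \<psi>"
    and annihilation_complexify: "annihilation f \<psi> =
      annihilation (complexify (\<lambda>s. fst (f s))) \<psi> - \<i> *\<^sub>C annihilation (complexify (\<lambda>s. snd (f s))) \<psi>"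
  using creation_lincomb[OF f square_integrable_complexify[OF square_integrable_fst_snd(1)[OF f]]
      square_integrable_complexify[OF square_integrable_fst_snd(2)[OF f]], of 1 \<i> \<psi>]
    annihilation_lincomb[OF f square_integrable_complexify[OF square_integrable_fst_snd(1)[OF f]]
      square_integrable_complexify[OF square_integrable_fst_snd(2)[OF f]], of 1 \<i> \<psi>]
    l2_inner_complexify[OF f]
  by (simp_all add: scaleC_minus_left)

section \<open>Second quantisation of multiplication by a sign\<close>

definition sign_function :: "(real \<Rightarrow> real) \<Rightarrow> bool" where
  "sign_function m \<longleftrightarrow> m \<in> borel_measurable borel \<and> (\<forall>s. m s * m s = 1)"

lemma square_integrable_sign:
  fixes f :: "real \<Rightarrow> 'a::{real_inner, banach, second_countable_topology}"
  assumes "sign_function m" "f \<in> square_integrable"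
  shows "(\<lambda>s. m s *\<^sub>R f s) \<in> square_integrable"
proof (rule square_integrable_mult[OF assms(2)])
  show "\<bar>m s\<bar> \<le> 1" for s
    using assms(1) by (metis sign_function_def abs_mult_self_eq abs_square_le_1 order_refl power2_eq_square)
qed (use assms(1) in \<open>simp add: sign_function_def\<close>)

definition sign_op :: "(real \<Rightarrow> real) \<Rightarrow> 'k::{real_inner, banach, second_countable_topology} fock \<Rightarrow> 'k fock" where
  "sign_op m = (THE T. bounded_clinear T \<and>
     (\<forall>fs\<in>lists square_integrable. T (wedge fs) = wedge (map (\<lambda>f s. m s *\<^sub>R f s) fs)))"

context
  fixes m :: "real \<Rightarrow> real"
  assumes m: "sign_function m"
begin

lemma map_sign_lists:
  fixes fs :: "(real \<Rightarrow> 'a::{real_inner, banach, second_countable_topology}) list"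
  shows "fs \<in> lists square_integrable \<Longrightarrow> map (\<lambda>f s. m s *\<^sub>R f s) fs \<in> lists square_integrable"
  by (induction fs) (auto intro!: square_integrable_sign[OF m])

lemma map_sign_involution:
  "map (\<lambda>f s. m s *\<^sub>R f s) (map (\<lambda>f s. m s *\<^sub>R f s) fs) = (fs :: (real \<Rightarrow> 'a::real_vector) list)"
  using m by (induction fs) (simp_all add: sign_function_def)

lemma wedge_inner_sign: 
  "wedge_inner (map (\<lambda>f s. m s *\<^sub>R f s) fs) (map (\<lambda>f s. m s *\<^sub>R f s) gs) = wedge_inner fs gs"
proof -
  have "l2_inner (\<lambda>s. m s *\<^sub>R f s) (\<lambda>s. m s *\<^sub>R g s) = l2_inner f g" for f g :: "real \<Rightarrow> 'a \<times> 'a"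
    using m by (simp add: l2_inner_mult sign_function_def)
  moreover have "p i < length fs" if "p permutes {..<length fs}" "i < length fs" for p i
    using permutes_in_image[OF that(1), of i] that(2) by simp
  ultimately show ?thesis
    unfolding wedge_inner_def by (auto intro!: sum.cong prod.cong)
qed

lemma sign_op_aux:
  "bounded_clinear (sign_op m :: 'k::{real_inner, banach, second_countable_topology} fock \<Rightarrow> 'k fock) \<and>
   (\<forall>fs\<in>lists square_integrable. sign_op m (wedge fs :: 'k fock) = wedge (map (\<lambda>f s. m s *\<^sub>R f s) fs)) \<and>
   (\<forall>\<psi> :: 'k fock. norm (sign_op m \<psi>) \<le> norm \<psi>)"
proof -
  have "norm (lincomb (\<lambda>fs. wedge (map (\<lambda>f s. m s *\<^sub>R f s) fs)) v) \<le> 1 * norm (lincomb wedge v :: 'k fock)"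
    if "v \<in> finsupp (lists square_integrable)" for v
    \<comment> \<open>The Gram kernel is preserved exactly, so the remainder \<open>q\<close> is
      zero and the bound holds with constant 1.\<close>
    by (rule norm_lincomb_le[where q = "\<lambda>_. 0 :: 'k fock", OF that])
      (simp_all add: cinner_wedge map_sign_lists wedge_inner_sign)
  then obtain T :: "'k fock \<Rightarrow> 'k fock" where T: "bounded_clinear T"
    "\<And>fs. fs \<in> lists square_integrable \<Longrightarrow> T (wedge fs) = wedge (map (\<lambda>f s. m s *\<^sub>R f s) fs)"
    "\<And>\<psi>. norm (T \<psi>) \<le> 1 * norm \<psi>"
    using wedge_extension[of "\<lambda>fs. wedge (map (\<lambda>f s. m s *\<^sub>R f s) fs) :: 'k fock" 1] by blast
  have "sign_op m = T"
    unfolding sign_op_def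
  proof (rule the_equality)
    show "S = T" if "bounded_clinear S \<and>
      (\<forall>fs\<in>lists square_integrable. S (wedge fs) = wedge (map (\<lambda>f s. m s *\<^sub>R f s) fs))" for S
      using that T by (intro bounded_clinear_eqI) auto
  qed (use T in auto)
  then show ?thesis using T by auto
qed

lemma bounded_clinear_sign_op: "bounded_clinear (sign_op m)"
  and sign_op_wedge: "fs \<in> lists square_integrable \<Longrightarrow> sign_op m (wedge fs) = wedge (map (\<lambda>f s. m s *\<^sub>R f s) fs)"
  and norm_sign_op: "norm (sign_op m \<psi>) \<le> norm \<psi>"
  using sign_op_aux by auto

lemma sign_op_Nil [simp]: "sign_op m (wedge []) = wedge []"
  by (simp add: sign_op_wedge)

lemma sign_op_involution [simp]:
  fixes \<psi> :: "'k::{real_inner, banach, second_countable_topology} fock"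
  shows "sign_op m (sign_op m \<psi>) = \<psi>"
proof -
  have "(\<lambda>\<psi> :: 'k fock. sign_op m (sign_op m \<psi>)) = (\<lambda>\<psi>. \<psi>)"
  proof (rule bounded_clinear_eqI)
    fix fs :: "(real \<Rightarrow> 'k \<times> 'k) list" assume fs: "fs \<in> lists square_integrable"
    show "sign_op m (sign_op m (wedge fs)) = wedge fs"
      by (simp only: sign_op_wedge[OF fs] sign_op_wedge[OF map_sign_lists[OF fs]] map_sign_involution)
  qed (rule bounded_clinear_compose[OF bounded_clinear_sign_op bounded_clinear_sign_op] bounded_clinear_id)+
  from fun_cong[OF this, of \<psi>] show ?thesis .
qed

lemma cinner_sign_op:
  fixes \<psi> \<phi> :: "'k::{real_inner, banach, second_countable_topology} fock"
  shows "cinner (sign_op m \<psi>) \<phi> = cinner \<psi> (sign_op m \<phi>)"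
proof (rule adjoint_pairI[OF bounded_clinear_sign_op bounded_clinear_sign_op])
  fix fs gs :: "(real \<Rightarrow> 'k \<times> 'k) list" assume l: "fs \<in> lists square_integrable" "gs \<in> lists square_integrable"
  have "wedge_inner (map (\<lambda>f s. m s *\<^sub>R f s) fs) gs = wedge_inner fs (map (\<lambda>f s. m s *\<^sub>R f s) gs)"
    using wedge_inner_sign[of fs "map (\<lambda>f s. m s *\<^sub>R f s) gs"] unfolding map_sign_involution .
  then show "cinner (sign_op m (wedge fs)) (wedge gs) = cinner (wedge fs) (sign_op m (wedge gs))"
    by (simp add: sign_op_wedge l cinner_wedge map_sign_lists)
qed

lemma sign_op_creation:
  fixes f :: "real \<Rightarrow> 'k::{real_inner, banach, second_countable_topology} \<times> 'k"
  assumes f: "f \<in> square_integrable"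
  shows "sign_op m (creation f \<psi>) = creation (\<lambda>s. m s *\<^sub>R f s) (sign_op m \<psi>)"
proof -
  note mf = square_integrable_sign[OF m f]
  have "(\<lambda>\<psi>. sign_op m (creation f \<psi>)) = (\<lambda>\<psi>. creation (\<lambda>s. m s *\<^sub>R f s) (sign_op m \<psi>))"
  proof (rule bounded_clinear_eqI)
    fix fs :: "(real \<Rightarrow> 'k \<times> 'k) list" assume fs: "fs \<in> lists square_integrable"
    have "f # fs \<in> lists square_integrable" using f fs by simp
    then show "sign_op m (creation f (wedge fs)) = creation (\<lambda>s. m s *\<^sub>R f s) (sign_op m (wedge fs))"
      using map_sign_lists[OF fs] fs by (simp add: sign_op_wedge creation_wedge f mf)
  qed (rule bounded_clinear_compose[OF bounded_clinear_sign_op bounded_clinear_creation[OF f]]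
      bounded_clinear_compose[OF bounded_clinear_creation[OF mf] bounded_clinear_sign_op])+
  from fun_cong[OF this, of \<psi>] show ?thesis .
qed

lemma sign_op_annihilation:
  fixes f :: "real \<Rightarrow> 'k::{real_inner, banach, second_countable_topology} \<times> 'k"
  assumes f: "f \<in> square_integrable"
  shows "sign_op m (annihilation f \<psi>) = annihilation (\<lambda>s. m s *\<^sub>R f s) (sign_op m \<psi>)"
proof (rule fock_eqI)
  fix hs :: "(real \<Rightarrow> 'k \<times> 'k) list"
  note mf = square_integrable_sign[OF m f]
  have "sign_op m (creation (\<lambda>s. m s *\<^sub>R f s) (wedge hs)) = creation (\<lambda>s. m s *\<^sub>R m s *\<^sub>R f s) (sign_op m (wedge hs))"
    by (rule sign_op_creation[OF mf])
  moreover have "(\<lambda>s. m s *\<^sub>R m s *\<^sub>R f s) = f" using m by (simp add: sign_function_def)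
  ultimately have "sign_op m (creation (\<lambda>s. m s *\<^sub>R f s) (wedge hs)) = creation f (sign_op m (wedge hs))" by simp
  then show "cinner (wedge hs) (sign_op m (annihilation f \<psi>)) =
      cinner (wedge hs) (annihilation (\<lambda>s. m s *\<^sub>R f s) (sign_op m \<psi>))"
    by (simp flip: cinner_sign_op cinner_creation[OF f] cinner_creation[OF mf])
qed

end

abbreviation parity :: "'k::{real_inner, banach, second_countable_topology} fock \<Rightarrow> 'k fock" where
  "parity \<equiv> sign_op (\<lambda>_. -1)"

lemma sign_function_minus_one [simp]: "sign_function (\<lambda>_. -1)"
  by (simp add: sign_function_def)

lemmas bounded_clinear_parity = bounded_clinear_sign_op[OF sign_function_minus_one]
lemmas parity_linear = bounded_clinearD[OF bounded_clinear_parity]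

lemma
  assumes f: "f \<in> square_integrable"
  shows parity_creation: "parity (creation f \<psi>) = - creation f (parity \<psi>)"
    and parity_annihilation: "parity (annihilation f \<psi>) = - annihilation f (parity \<psi>)"
  using sign_op_creation[OF sign_function_minus_one f] sign_op_annihilation[OF sign_function_minus_one f]
    creation_scaleR[OF f, of "-1"] annihilation_scaleR[OF f, of "-1"] by simp_all

lemma parity_wedge: "fs \<in> lists square_integrable \<Longrightarrow> parity (wedge fs) = (-1) ^ length fs *\<^sub>R wedge fs"
proof (induction fs)
  case (Cons f fs)
  then have f: "f \<in> square_integrable" and fs: "fs \<in> lists square_integrable" by auto
  show ?case
    using parity_creation[OF f, of "wedge fs"] Cons.IH[OF fs] creation_wedge[OF f fs]
      bounded_clinearD[OF bounded_clinear_creation[OF f]] by simp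
qed simp

section \<open>The left and right Clifford fields\<close>

text \<open>\<open>right_field\<close> gives the right multiplications \<open>x \<Omega> \<mapsto> x u(f) \<Omega>\<close>; they lie in the commutant of the
  Clifford algebra.\<close>

definition right_field ::
    "(real \<Rightarrow> 'k::{real_inner, banach, second_countable_topology}) \<Rightarrow> 'k fock \<Rightarrow> 'k fock" where
  "right_field f = (\<lambda>\<psi>. (1 / sqrt 2) *\<^sub>R
     (creation (complexify f) (parity \<psi>) - annihilation (complexify f) (parity \<psi>)))"

lemma clifford_field_eq:
  "clifford_field f \<psi> = (1 / sqrt 2) *\<^sub>R (annihilation (complexify f) \<psi> + creation (complexify f) \<psi>)"
  by (simp add: clifford_field_def annihilation_def)

lemma clifford_field_add:
  fixes f :: "real \<Rightarrow> 'k::{real_inner, banach, second_countable_topology}"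
  assumes f: "f \<in> square_integrable" and g: "g \<in> square_integrable"
  shows "clifford_field (\<lambda>s. f s + g s) \<psi> = clifford_field f \<psi> + clifford_field g \<psi>"
  using creation_add[OF square_integrable_complexify[OF f] square_integrable_complexify[OF g], of \<psi>]
    annihilation_add[OF square_integrable_complexify[OF f] square_integrable_complexify[OF g], of \<psi>]
  by (simp add: clifford_field_eq flip: scaleR_add_right)

lemma eq_neg_imp_zero: "x = 0" if "x = - x" for x :: "'a::real_vector"
proof -
  have "2 *\<^sub>R x = 0" unfolding scaleR_2 using that by (simp add: eq_neg_iff_add_eq_0)
  then show ?thesis by simp
qed

lemma inverse_sqrt2_sq: "(1 / sqrt 2) *\<^sub>R (1 / sqrt 2) *\<^sub>R x = (1 / 2 :: real) *\<^sub>R (x :: 'a :: real_vector)"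
proof -
  have "(1 / sqrt 2) * (1 / sqrt 2) = (1 / 2 :: real)" by simp
  then show ?thesis by (simp only: scaleR_scaleR)
qed

context
  fixes f :: "real \<Rightarrow> 'k::{real_inner, banach, second_countable_topology}"
  assumes f: "f \<in> square_integrable"
begin

lemmas creation_linear = bounded_clinearD[OF bounded_clinear_creation[OF square_integrable_complexify[OF f]]]
lemmas annihilation_linear = bounded_clinearD[OF bounded_clinear_annihilation[OF square_integrable_complexify[OF f]]]

lemma bounded_clinear_clifford_field: "bounded_clinear (clifford_field f)"
  unfolding clifford_field_eq[abs_def]
  by (intro bounded_clinear_scaleR bounded_clinear_add bounded_clinear_creation
      bounded_clinear_annihilation square_integrable_complexify[OF f])

lemma bounded_clinear_right_field: "bounded_clinear (right_field f)"
  unfolding right_field_def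
  by (rule bounded_clinear_scaleR bounded_clinear_diff
      bounded_clinear_compose[OF bounded_clinear_creation[OF square_integrable_complexify[OF f]] bounded_clinear_parity]
      bounded_clinear_compose[OF bounded_clinear_annihilation[OF square_integrable_complexify[OF f]] bounded_clinear_parity])+

lemma cinner_clifford_field: "cinner (clifford_field f \<psi>) \<phi> = cinner \<psi> (clifford_field f \<phi>)"
  by (simp add: clifford_field_eq cinner_simps cinner_creation[OF square_integrable_complexify[OF f]] cinner_annihilation[OF square_integrable_complexify[OF f]])

lemma cinner_right_field: "cinner (right_field f \<psi>) \<phi> = cinner \<psi> (right_field f \<phi>)"
  by (simp add: right_field_def cinner_simps cinner_creation[OF square_integrable_complexify[OF f]] cinner_annihilation[OF square_integrable_complexify[OF f]]
      cinner_sign_op parity_creation[OF square_integrable_complexify[OF f]] parity_annihilation[OF square_integrable_complexify[OF f]])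

lemma right_field_vacuum: "right_field f (wedge []) = clifford_field f (wedge [])"
  by (simp add: right_field_def clifford_field_eq annihilation_Nil[OF square_integrable_complexify[OF f]])

lemma sign_op_clifford_field:
  assumes m: "sign_function m"
  shows "sign_op m (clifford_field f \<psi>) = clifford_field (\<lambda>s. m s *\<^sub>R f s) (sign_op m \<psi>)"
proof -
  have e: "(\<lambda>s. m s *\<^sub>R (f s, 0)) = complexify (\<lambda>s. m s *\<^sub>R f s)"
    by (simp add: fun_eq_iff)
  show ?thesis
    by (simp add: clifford_field_eq bounded_clinearD[OF bounded_clinear_sign_op[OF m]]
        sign_op_creation[OF m square_integrable_complexify[OF f]] sign_op_annihilation[OF m square_integrable_complexify[OF f]] e)
qed

end

lemma clifford_field_anticommute:
  fixes f g :: "real \<Rightarrow> 'k::{real_inner, banach, second_countable_topology}"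
  assumes f: "f \<in> square_integrable" and g: "g \<in> square_integrable"
  shows "clifford_field f (clifford_field g \<psi>) + clifford_field g (clifford_field f \<psi>)
    = l2_inner (complexify f) (complexify g) *\<^sub>C \<psi>"
proof -
  note fc = square_integrable_complexify[OF f] and gc = square_integrable_complexify[OF g]
  have "clifford_field f (clifford_field g \<psi>) + clifford_field g (clifford_field f \<psi>) = (1/2) *\<^sub>R
      (annihilation (complexify f) (annihilation (complexify g) \<psi>)
      + annihilation (complexify f) (creation (complexify g) \<psi>)
      + (creation (complexify f) (annihilation (complexify g) \<psi>)
      + creation (complexify f) (creation (complexify g) \<psi>))
      + (annihilation (complexify g) (annihilation (complexify f) \<psi>)
      + annihilation (complexify g) (creation (complexify f) \<psi>)
      + (creation (complexify g) (annihilation (complexify f) \<psi>)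
      + creation (complexify g) (creation (complexify f) \<psi>))))"
    unfolding clifford_field_eq creation_linear(4)[OF f] creation_linear(4)[OF g] annihilation_linear(4)[OF f] annihilation_linear(4)[OF g]
      creation_linear(1)[OF f] creation_linear(1)[OF g] annihilation_linear(1)[OF f] annihilation_linear(1)[OF g]
      scaleR_add_right[symmetric] inverse_sqrt2_sq ..
  also have "\<dots> = (1/2) *\<^sub>R (l2_inner (complexify f) (complexify g) *\<^sub>C \<psi> + l2_inner (complexify f) (complexify g) *\<^sub>C \<psi>)"
    unfolding annihilation_creation[OF fc gc] annihilation_creation[OF gc fc]
      annihilation_anticommute[OF fc gc] creation_anticommute[OF fc gc] l2_inner_real_commute[of g f]
    by simp
  also have "\<dots> = l2_inner (complexify f) (complexify g) *\<^sub>C \<psi>"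
    by (simp flip: scaleR_2)
  finally show ?thesis .
qed

text \<open>Without the parity in \<open>right_field\<close> the two fields anticommute: the scalar
  terms cancel because the inner product of real functions is symmetric. The parity anticommutes
  with every field and so turns this into commutation.\<close>

lemma clifford_field_right_field:
  fixes f g :: "real \<Rightarrow> 'k::{real_inner, banach, second_countable_topology}"
  assumes f: "f \<in> square_integrable" and g: "g \<in> square_integrable"
  shows "clifford_field f (right_field g \<psi>) = right_field g (clifford_field f \<psi>)"
proof -
  note fc = square_integrable_complexify[OF f] and gc = square_integrable_complexify[OF g]
  define \<phi> where "\<phi> = parity \<psi>"
  let ?Bf = "annihilation (complexify f)" and ?Bg = "annihilation (complexify g)"
  let ?Af = "creation (complexify f)" and ?Ag = "creation (complexify g)"
  have "clifford_field f (right_field g \<psi>) = (1/2) *\<^sub>R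
      (?Bf (?Ag \<phi>) - ?Bf (?Bg \<phi>) + (?Af (?Ag \<phi>) - ?Af (?Bg \<phi>)))"
    unfolding clifford_field_eq right_field_def creation_linear(4)[OF f] annihilation_linear(4)[OF f]
      creation_linear(2)[OF f] annihilation_linear(2)[OF f] scaleR_add_right[symmetric] inverse_sqrt2_sq \<phi>_def ..
  also have "\<dots> = (1/2) *\<^sub>R (- ?Ag (?Bf \<phi>) - ?Ag (?Af \<phi>) - (- ?Bg (?Bf \<phi>) - ?Bg (?Af \<phi>)))"
    unfolding annihilation_creation[OF fc gc] annihilation_creation[OF gc fc]
      annihilation_anticommute[OF fc gc] creation_anticommute[OF fc gc] l2_inner_real_commute[of g f]
    by simp
  also have "\<dots> = right_field g (clifford_field f \<psi>)"
    unfolding clifford_field_eq right_field_def parity_linear(4) parity_linear(1)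
      parity_creation[OF fc] parity_annihilation[OF fc]
      creation_linear(4)[OF g] annihilation_linear(4)[OF g] creation_linear(1)[OF g] annihilation_linear(1)[OF g] creation_linear(6)[OF g] annihilation_linear(6)[OF g]
      scaleR_diff_right[symmetric] inverse_sqrt2_sq \<phi>_def by simp
  finally show ?thesis .
qed

lemma clifford_field_square:
  fixes f :: "real \<Rightarrow> 'k::{real_inner, banach, second_countable_topology}"
  assumes f: "f \<in> square_integrable"
  shows "clifford_field f (clifford_field f \<psi>) = (1/2) *\<^sub>R l2_inner (complexify f) (complexify f) *\<^sub>C \<psi>"
  using clifford_field_anticommute[OF f f, of \<psi>] by (simp flip: scaleR_2 add: scaleR_scaleC scaleC_scaleC)
    (metis (no_types, lifting) divide_self_if mult.commute mult_1 scaleC_one scaleC_scaleC times_divide_eq_left zero_neq_numeral)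

lemma right_field_square:
  fixes f :: "real \<Rightarrow> 'k::{real_inner, banach, second_countable_topology}"
  assumes f: "f \<in> square_integrable"
  shows "right_field f (right_field f \<psi>) = (1/2) *\<^sub>R l2_inner (complexify f) (complexify f) *\<^sub>C \<psi>"
proof -
  note fc = square_integrable_complexify[OF f]
  let ?B = "annihilation (complexify f)" and ?A = "creation (complexify f)"
  have AA: "?A (?A \<psi>) = 0" "?B (?B \<psi>) = 0"
    by (rule eq_neg_imp_zero creation_anticommute[OF fc fc] annihilation_anticommute[OF fc fc])+
  have "right_field f (right_field f \<psi>) = (1/2) *\<^sub>R (- ?A (?A \<psi>) + ?A (?B \<psi>) - (- ?B (?A \<psi>) + ?B (?B \<psi>)))"
    unfolding right_field_def parity_linear(4) parity_linear(2) parity_creation[OF fc] parity_annihilation[OF fc]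
      creation_linear(4)[OF f] annihilation_linear(4)[OF f] creation_linear(2)[OF f] annihilation_linear(2)[OF f] creation_linear(6)[OF f] annihilation_linear(6)[OF f]
      sign_op_involution[OF sign_function_minus_one] scaleR_diff_right[symmetric] inverse_sqrt2_sq by simp
  also have "\<dots> = (1/2) *\<^sub>R l2_inner (complexify f) (complexify f) *\<^sub>C \<psi>"
    unfolding annihilation_creation[OF fc fc] AA by simp
  finally show ?thesis .
qed

section \<open>The Clifford algebra and its commutant\<close>

abbreviation vacuum :: "'k::{real_inner, banach, second_countable_topology} fock" where
  "vacuum \<equiv> wedge []"

lemma cinner_vacuum [simp]: "cinner vacuum vacuum = 1"
  by (simp add: cinner_wedge wedge_inner_def sign_id permutes_empty)

lemma commutant_iff: "A \<in> commutant S \<longleftrightarrow> bounded_clinear A \<and> (\<forall>B\<in>S. \<forall>\<psi>. A (B \<psi>) = B (A \<psi>))"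
  by (auto simp: commutant_def fun_eq_iff)

lemma commutant_compose: "A \<in> commutant S \<Longrightarrow> B \<in> commutant S \<Longrightarrow> A \<circ> B \<in> commutant S"
  by (simp add: commutant_iff o_def bounded_clinear_compose)

lemma commutant_id: "id \<in> commutant S"
  by (simp add: commutant_iff bounded_clinear_id)

lemma commutant_add:
  "(\<And>B. B \<in> S \<Longrightarrow> bounded_clinear B) \<Longrightarrow> A \<in> commutant S \<Longrightarrow> A' \<in> commutant S \<Longrightarrow> (\<lambda>\<psi>. A \<psi> + A' \<psi>) \<in> commutant S"
  by (simp add: commutant_iff bounded_clinear_add bounded_clinearD)

lemma commutant_scaleC:
  "(\<And>B. B \<in> S \<Longrightarrow> bounded_clinear B) \<Longrightarrow> A \<in> commutant S \<Longrightarrow> (\<lambda>\<psi>. c *\<^sub>C A \<psi>) \<in> commutant S"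
  by (simp add: commutant_iff bounded_clinear_scaleC bounded_clinearD)

lemma clifford_algebraI:
  assumes "bounded_clinear x"
    and "\<And>y \<psi>. y \<in> commutant (clifford_field ` square_integrable) \<Longrightarrow> x (y \<psi>) = y (x \<psi>)"
  shows "x \<in> clifford_algebra"
  using assms unfolding clifford_algebra_def by (simp add: commutant_iff)

lemma clifford_algebra_commute:
  assumes "x \<in> clifford_algebra" "y \<in> commutant (clifford_field ` square_integrable)"
  shows "x (y \<psi>) = y (x \<psi>)"
  using assms unfolding clifford_algebra_def by (simp add: commutant_iff[of x])

lemma bounded_clinear_algebra: "x \<in> clifford_algebra \<Longrightarrow> bounded_clinear x"
  by (simp add: clifford_algebra_def commutant_iff)

lemma bounded_clinear_commutant: "x \<in> commutant S \<Longrightarrow> bounded_clinear x"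
  by (simp add: commutant_iff)

lemma clifford_algebra_compose: "x \<in> clifford_algebra \<Longrightarrow> y \<in> clifford_algebra \<Longrightarrow> x \<circ> y \<in> clifford_algebra"
  unfolding clifford_algebra_def by (rule commutant_compose)

lemma clifford_algebra_id: "id \<in> clifford_algebra"
  unfolding clifford_algebra_def by (rule commutant_id)

lemma clifford_algebra_add: 
  "x \<in> clifford_algebra \<Longrightarrow> y \<in> clifford_algebra \<Longrightarrow> (\<lambda>\<psi>. x \<psi> + y \<psi>) \<in> clifford_algebra"
  unfolding clifford_algebra_def by (intro commutant_add bounded_clinear_commutant)

lemma clifford_algebra_scaleC: "x \<in> clifford_algebra \<Longrightarrow> (\<lambda>\<psi>. c *\<^sub>C x \<psi>) \<in> clifford_algebra"
  unfolding clifford_algebra_def by (intro commutant_scaleC bounded_clinear_commutant)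

lemma clifford_field_algebra: "f \<in> square_integrable \<Longrightarrow> clifford_field f \<in> clifford_algebra"
  by (rule clifford_algebraI) (auto simp: bounded_clinear_clifford_field commutant_iff)

lemma right_field_commutant: 
  "f \<in> square_integrable \<Longrightarrow> right_field f \<in> commutant (clifford_field ` square_integrable)"
  by (auto simp: commutant_iff bounded_clinear_right_field clifford_field_right_field)

lemma algebra_right_field:
  "x \<in> clifford_algebra \<Longrightarrow> f \<in> square_integrable \<Longrightarrow> x (right_field f \<psi>) = right_field f (x \<psi>)"
  by (rule clifford_algebra_commute[OF _ right_field_commutant])

text \<open>Conjugation by \<open>sign_op m\<close> sends the generator of \<open>f\<close> to that
  of \<open>m\<close> times \<open>f\<close>, so it permutes the generators. Hence it preserves
  their commutant and, being an involution, the double commutant.\<close>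

lemma sign_op_conj_algebra:
  fixes x :: "'k::{real_inner, banach, second_countable_topology} fock \<Rightarrow> 'k fock"
  assumes m: "sign_function m" and x: "x \<in> clifford_algebra"
  shows "(\<lambda>\<psi>. sign_op m (x (sign_op m \<psi>))) \<in> clifford_algebra"
proof (rule clifford_algebraI)
  note b = bounded_clinear_sign_op[OF m]
  show "bounded_clinear (\<lambda>\<psi>. sign_op m (x (sign_op m \<psi>)))"
    by (rule bounded_clinear_compose[OF b bounded_clinear_compose[OF bounded_clinear_algebra[OF x] b]])
  fix y :: "'k fock \<Rightarrow> 'k fock" and \<psi> assume y: "y \<in> commutant (clifford_field ` square_integrable)"
  have y': "(\<lambda>\<psi>. sign_op m (y (sign_op m \<psi>))) \<in> commutant (clifford_field ` square_integrable)"
    unfolding commutant_iff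
  proof (intro conjI ballI allI)
    show "bounded_clinear (\<lambda>\<psi>. sign_op m (y (sign_op m \<psi>)))"
      by (rule bounded_clinear_compose[OF b bounded_clinear_compose[OF bounded_clinear_commutant[OF y] b]])
    fix B :: "'k fock \<Rightarrow> 'k fock" and \<psi> assume "B \<in> clifford_field ` square_integrable"
    then obtain f where f: "f \<in> square_integrable" "B = clifford_field f" by blast
    note mf = square_integrable_sign[OF m f(1)]
    have mm: "(\<lambda>s. m s *\<^sub>R m s *\<^sub>R f s) = f" using m by (simp add: sign_function_def)
    have "sign_op m (y (sign_op m (B \<psi>))) = sign_op m (y (clifford_field (\<lambda>s. m s *\<^sub>R f s) (sign_op m \<psi>)))"
      by (simp add: f(2) sign_op_clifford_field[OF f(1) m])
    also have "\<dots> = sign_op m (clifford_field (\<lambda>s. m s *\<^sub>R f s) (y (sign_op m \<psi>)))"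
      using y mf by (simp add: commutant_iff)
    also have "\<dots> = B (sign_op m (y (sign_op m \<psi>)))"
      using sign_op_clifford_field[OF mf m] unfolding f(2) mm .
    finally show "sign_op m (y (sign_op m (B \<psi>))) = B (sign_op m (y (sign_op m \<psi>)))" .
  qed
  show "sign_op m (x (sign_op m (y \<psi>))) = y (sign_op m (x (sign_op m \<psi>)))"
    using clifford_algebra_commute[OF x y', of "sign_op m \<psi>"]
    by (simp add: sign_op_involution[OF m])
qed

subsection \<open>The vacuum is cyclic\<close>

text \<open>\<open>N\<close> plays the orthogonal complement of a subspace that contains the vacuum
  and is invariant under the fields. In the induction on length, creation on a wedge is sqrt 2 times
  the field, which moves over to \<open>\<zeta>\<close>, minus a contraction, which has shorter
  wedges only.\<close>

lemma cyclic_orthogonal: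
  fixes N :: "'k::{real_inner, banach, second_countable_topology} fock set"
  assumes vac: "\<And>\<zeta>. \<zeta> \<in> N \<Longrightarrow> cinner vacuum \<zeta> = 0"
    and inv: "\<And>f \<zeta>. f \<in> square_integrable \<Longrightarrow> \<zeta> \<in> N \<Longrightarrow> clifford_field f \<zeta> \<in> N"
    and "\<zeta> \<in> N"
  shows "\<zeta> = 0"
proof (rule fock_ext)
  have *: "\<forall>\<zeta>\<in>N. cinner (wedge fs) \<zeta> = 0" if "fs \<in> lists square_integrable" for fs :: "(real \<Rightarrow> 'k \<times> 'k) list"
    using that
  proof (induction fs rule: length_induct)
    case (1 fs)
    show ?case
    proof (cases fs)
      case Nil
      then show ?thesis using vac by simp
    next
      case (Cons f gs)
      then have f: "f \<in> square_integrable" and gs: "gs \<in> lists square_integrable" using 1 by auto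
      have IH: "cinner (wedge hs) \<zeta> = 0"
        if "length hs \<le> length gs" "hs \<in> lists square_integrable" "\<zeta> \<in> N" for hs \<zeta>
        using 1(1) Cons that by (auto simp: less_Suc_eq_le)
      have r: "cinner (creation (complexify h) (wedge gs)) \<zeta> = 0"
        if h: "h \<in> square_integrable" and z: "\<zeta> \<in> N" for h :: "real \<Rightarrow> 'k" and \<zeta>
      proof -
        have "creation (complexify h) (wedge gs) = sqrt 2 *\<^sub>R clifford_field h (wedge gs) - annih_wedge (complexify h) gs"
          by (simp add: clifford_field_eq annihilation_wedge[OF square_integrable_complexify[OF h] gs])
        moreover have "cinner (clifford_field h (wedge gs)) \<zeta> = 0"
          unfolding cinner_clifford_field[OF h] by (rule IH[OF _ gs inv[OF h z]]) simp
        moreover have "cinner (annih_wedge (complexify h) gs) \<zeta> = 0"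
          unfolding annih_wedge_def
          using IH[OF _ delete_nth_lists[OF gs] z]
          by (auto simp: cinner_sum_left cinner_scaleC_left intro!: sum.neutral)
        ultimately show ?thesis by (simp add: cinner_simps)
      qed
      show ?thesis
        unfolding Cons creation_wedge[OF f gs, symmetric] creation_complexify[OF f]
        using r[OF square_integrable_fst_snd(1)[OF f]] r[OF square_integrable_fst_snd(2)[OF f]]
        by (simp add: cinner_simps)
    qed
  qed
  show "cinner (wedge fs) \<zeta> = 0" if "fs \<in> lists square_integrable" for fs
    using * that assms(3) by blast
qed

text \<open>The same triangular recursion with right fields in place of left ones. Since right
  fields commute with the algebra, a condition on an algebra element that holds on the vacuum
  spreads from there to all vectors.\<close>

lemma right_cyclic:
  fixes L :: "'k::{real_inner, banach, second_countable_topology} fock set"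
  assumes L: "closed L" "\<And>x y. x \<in> L \<Longrightarrow> y \<in> L \<Longrightarrow> x + y \<in> L" "\<And>c x. x \<in> L \<Longrightarrow> c *\<^sub>C x \<in> L"
    and vac: "vacuum \<in> L"
    and inv: "\<And>f \<psi>. f \<in> square_integrable \<Longrightarrow> \<psi> \<in> L \<Longrightarrow> right_field f \<psi> \<in> L"
  shows "L = UNIV"
proof (rule closed_subspace_eq_UNIV[OF L(1) _ L(2) L(3)])
  show zero: "0 \<in> L" using L(3)[OF vac, of 0] by simp
  have sum: "(\<Sum>j\<in>J. c j *\<^sub>C g j) \<in> L" if "finite J" "\<And>j. j \<in> J \<Longrightarrow> g j \<in> L" for J c and g :: "nat \<Rightarrow> 'k fock"
    using that by (induction J rule: finite_induct) (auto intro: zero L)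
  show "wedge fs \<in> L" if "fs \<in> lists square_integrable" for fs :: "(real \<Rightarrow> 'k \<times> 'k) list"
    using that
  proof (induction fs rule: length_induct)
    case (1 fs)
    show ?case
    proof (cases fs)
      case Nil
      then show ?thesis using vac by simp
    next
      case (Cons f gs)
      then have f: "f \<in> square_integrable" and gs: "gs \<in> lists square_integrable" using 1 by auto
      have IH: "wedge hs \<in> L"
        if "length hs \<le> length gs" "hs \<in> lists square_integrable" for hs
        using 1(1) Cons that by (auto simp: less_Suc_eq_le)
      have r: "creation (complexify h) (wedge gs) \<in> L" if h: "h \<in> square_integrable" for h :: "real \<Rightarrow> 'k"
      proof -
        have sq: "((- 1) ^ length gs :: real) * (- 1) ^ length gs = 1"
          by (simp flip: power_add)
        have "right_field h (wedge gs) = (1 / sqrt 2) *\<^sub>R (-1) ^ length gs *\<^sub>R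
            (creation (complexify h) (wedge gs) - annih_wedge (complexify h) gs)"
          by (simp add: right_field_def parity_wedge[OF gs] annihilation_wedge[OF square_integrable_complexify[OF h] gs]
              creation_linear(4)[OF h] annihilation_linear(4)[OF h] scaleR_diff_right)
        then have "(sqrt 2 * (-1) ^ length gs) *\<^sub>R right_field h (wedge gs)
            = creation (complexify h) (wedge gs) - annih_wedge (complexify h) gs"
          using sq by simp
        then have "creation (complexify h) (wedge gs)
            = complex_of_real (sqrt 2 * (-1) ^ length gs) *\<^sub>C right_field h (wedge gs) + annih_wedge (complexify h) gs"
          by (simp add: scaleR_scaleC)
        moreover have "annih_wedge (complexify h) gs \<in> L"
          unfolding annih_wedge_def by (rule sum) (auto intro!: IH delete_nth_lists[OF gs])
        ultimately show ?thesis using L inv[OF h IH[OF order_refl gs]] by simp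
      qed
      show ?thesis
        unfolding Cons creation_wedge[OF f gs, symmetric] creation_complexify[OF f]
        by (intro L r square_integrable_fst_snd f)
    qed
  qed
qed

text \<open>The vacuum is separating because it is cyclic for right fields.\<close>

lemma algebra_eqI:
  assumes x: "x \<in> clifford_algebra" and y: "y \<in> clifford_algebra" and eq: "x vacuum = y vacuum"
  shows "x = y"
proof -
  note b = bounded_clinearD[OF bounded_clinear_algebra[OF x]] bounded_clinearD[OF bounded_clinear_algebra[OF y]]
  have "closed {\<psi>. x \<psi> = y \<psi>}"
    by (intro closed_Collect_eq linear_continuous_on b)
  then have "{\<psi>. x \<psi> = y \<psi>} = UNIV"
    by (rule right_cyclic) (use eq in \<open>auto simp: b algebra_right_field[OF x] algebra_right_field[OF y]\<close>)
  then show ?thesis by auto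
qed

section \<open>Vectors on which left and right fields agree up to sign\<close>

text \<open>Write u, v for the left and right field, a, c for annihilation and creation by
  \<open>f\<close>, and G for \<open>parity\<close>. Up to the factor sqrt 2, u - v = a (1 + G) + c
  (1 - G) and u + v = c (1 + G) + a (1 - G). In each sum, applied to \<open>\<xi>\<close>, the first
  term is odd and the second even, so they vanish separately.\<close>

lemma left_right_field_parity:
  fixes f :: "real \<Rightarrow> 'k::{real_inner, banach, second_countable_topology}"
  assumes f: "f \<in> square_integrable"
  shows "clifford_field f \<xi> = right_field f \<xi> \<Longrightarrow> annihilation (complexify f) (\<xi> + parity \<xi>) = 0"
    and "clifford_field f \<xi> = right_field f \<xi> \<Longrightarrow> creation (complexify f) (\<xi> - parity \<xi>) = 0"
    and "clifford_field f \<xi> = - right_field f \<xi> \<Longrightarrow> annihilation (complexify f) (\<xi> - parity \<xi>) = 0"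
    and "clifford_field f \<xi> = - right_field f \<xi> \<Longrightarrow> creation (complexify f) (\<xi> + parity \<xi>) = 0"
proof -
  note fc = square_integrable_complexify[OF f]
  let ?B = "annihilation (complexify f)" and ?A = "creation (complexify f)" and ?G = parity
  have split: "x = 0 \<and> y = 0" if "x + y = 0" "?G x = - x" "?G y = y" for x y :: "'k fock"
  proof -
    have "?G (x + y) = y - x" using that(2,3) by (simp add: parity_linear(1))
    then have "y - x = 0" using that(1) by (simp add: parity_linear(5))
    with that(1) show ?thesis using eq_neg_imp_zero[of x] by (simp add: eq_neg_iff_add_eq_0)
  qed
  have G: "?G (\<xi> + ?G \<xi>) = \<xi> + ?G \<xi>" "?G (\<xi> - ?G \<xi>) = - (\<xi> - ?G \<xi>)"
    by (simp_all add: parity_linear(1) parity_linear(2))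
  have s: "(1 / sqrt 2) *\<^sub>R (x :: 'k fock) = 0 \<longleftrightarrow> x = 0" for x by simp
  {
    assume "clifford_field f \<xi> = right_field f \<xi>"
    then have "(1 / sqrt 2) *\<^sub>R (?B (\<xi> + ?G \<xi>) + ?A (\<xi> - ?G \<xi>)) = 0"
      unfolding clifford_field_eq right_field_def annihilation_linear(1)[OF f] creation_linear(2)[OF f]
      by (simp add: algebra_simps)
    then have "?B (\<xi> + ?G \<xi>) + ?A (\<xi> - ?G \<xi>) = 0" unfolding s .
    from split[OF this] show "?B (\<xi> + ?G \<xi>) = 0" "?A (\<xi> - ?G \<xi>) = 0"
      unfolding parity_creation[OF fc] parity_annihilation[OF fc] G creation_linear(6)[OF f] by simp_all
  next
    assume "clifford_field f \<xi> = - right_field f \<xi>"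
    then have "(1 / sqrt 2) *\<^sub>R (?A (\<xi> + ?G \<xi>) + ?B (\<xi> - ?G \<xi>)) = 0"
      unfolding clifford_field_eq right_field_def creation_linear(1)[OF f] annihilation_linear(2)[OF f]
      by (simp add: algebra_simps)
    then have "?A (\<xi> + ?G \<xi>) + ?B (\<xi> - ?G \<xi>) = 0" unfolding s .
    from split[OF this] show "?B (\<xi> - ?G \<xi>) = 0" "?A (\<xi> + ?G \<xi>) = 0"
      unfolding parity_creation[OF fc] parity_annihilation[OF fc] G annihilation_linear(6)[OF f] by simp_all
  }
qed

lemma l2_inner_step_function:
  fixes e :: "'k::{real_inner, banach, second_countable_topology}"
  assumes "0 \<le> s"
  defines "f \<equiv> \<lambda>t. indicator {s..<s + 1} t *\<^sub>R e"
  shows "f \<in> square_integrable" "l2_inner (complexify f) (complexify f) = of_real ((norm e)\<^sup>2)"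
proof -
  have e: "indicator {0..} t *\<^sub>R f t = f t" for t
    using assms by (auto simp: indicator_def)
  have i: "integrable lborel (indicator {s..<s + 1} :: real \<Rightarrow> real)"
    by (simp add: integrable_real_indicator)
  have n: "(norm (f t))\<^sup>2 = indicator {s..<s + 1} t * (norm e)\<^sup>2" for t
    by (simp add: f_def indicator_def)
  show "f \<in> square_integrable"
    unfolding square_integrable_iff e n using i by (simp add: f_def)
  have "indicator {0..} t *\<^sub>R cplx_inner (f t, 0) (f t, 0) = complex_of_real (indicator {s..<s + 1} t * (norm e)\<^sup>2)" for t
    using assms by (simp add: cplx_inner_def f_def complex_eq_iff power2_norm_eq_inner indicator_def)
  then have "l2_inner (complexify f) (complexify f) = (LINT t|lborel. complex_of_real (indicator {s..<s + 1} t * (norm e)\<^sup>2))"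
    unfolding l2_inner_def integral_half_line by simp
  also have "\<dots> = of_real ((norm e)\<^sup>2)" using i by simp
  finally show "l2_inner (complexify f) (complexify f) = of_real ((norm e)\<^sup>2)" .
qed

text \<open>A weakly null sequence of test functions \<open>F\<^sub>n\<close> of constant norm has \<open>a(F\<^sub>n) \<rightarrow> 0\<close> strongly, so
  \<open>a\<^sup>*(F\<^sub>n) \<eta> = 0\<close> for all \<open>n\<close> contradicts the canonical anticommutation relation unless \<open>\<eta> = 0\<close>.\<close>

lemma creation_kernel_trivial:
  fixes \<eta> :: "'k::{real_inner, banach, second_countable_topology} fock" and e :: 'k
  assumes s: "0 \<le> s" and e: "e \<noteq> 0"
    and 0: "\<And>F. F \<in> square_integrable \<Longrightarrow> (\<And>t. t < s \<Longrightarrow> F t = 0) \<Longrightarrow>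
      l2_inner (complexify F) (complexify F) = 2 \<Longrightarrow> creation (complexify F) \<eta> = 0"
  shows "\<eta> = 0"
proof (rule fock_ext)
  fix gs :: "(real \<Rightarrow> 'k \<times> 'k) list" assume gs: "gs \<in> lists square_integrable"
  \<comment> \<open>A unit interval times \<open>e'\<close> gets squared norm 2, the normalisation
    for which the Clifford field squares to the identity.\<close>
  define e' where "e' = (sqrt 2 / norm e) *\<^sub>R e"
  have e': "(norm e')\<^sup>2 = 2" using e by (simp add: e'_def)
  define f where "f = (\<lambda>t. indicator {s..<s + 1} t *\<^sub>R e')"
  define F where "F = (\<lambda>n t. wave (1 / real (Suc n)) t *\<^sub>R f t)"
  have f: "f \<in> square_integrable" "l2_inner (complexify f) (complexify f) = 2"
    using l2_inner_step_function[OF s, of e'] e' by (simp_all add: f_def)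
  have F: "F n \<in> square_integrable" for n
    unfolding F_def by (rule square_integrable_mult[OF f(1)]) auto
  have Fc: "complexify (F n) = (\<lambda>t. wave (1 / real (Suc n)) t *\<^sub>R complexify f t)" for n
    by (simp add: F_def fun_eq_iff)
  have FF: "l2_inner (complexify (F n)) (complexify (F n)) = 2" for n
    unfolding Fc l2_inner_mult by (simp add: f(2))
  have F0: "F n t = 0" if "t < s" for n t using that by (simp add: F_def f_def)
  note z = 0[OF F F0 FF]
  have d: "(\<lambda>n. 1 / real (Suc n)) \<longlonglongrightarrow> 0"
    using LIMSEQ_inverse_real_of_nat by (simp add: inverse_eq_divide)
  have w: "(\<lambda>n. l2_inner (complexify (F n)) g) \<longlonglongrightarrow> 0" if "g \<in> square_integrable" for g
    unfolding Fc by (rule l2_inner_wave_tendsto[OF square_integrable_complexify[OF f(1)] that _ d]) simp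
  have l: "(\<lambda>n. annih_wedge (complexify (F n)) gs) \<longlonglongrightarrow> 0"
    unfolding annih_wedge_def
  proof (rule tendsto_null_sum)
    fix j assume j: "j \<in> {..<length gs}"
    have "gs ! j \<in> square_integrable" using gs j by (auto simp: in_lists_conv_set)
    then have "(\<lambda>n. cmod (((-1) ^ j * l2_inner (complexify (F n)) (gs ! j))) * norm (wedge (delete_nth j gs))) \<longlonglongrightarrow> 0"
      by (intro tendsto_mult_left_zero tendsto_norm_zero tendsto_mult_right_zero w)
    then show "(\<lambda>n. ((-1) ^ j * l2_inner (complexify (F n)) (gs ! j)) *\<^sub>C wedge (delete_nth j gs)) \<longlonglongrightarrow> 0"
      unfolding tendsto_norm_zero_iff[symmetric, where f = "\<lambda>n. _ n *\<^sub>C _"] norm_scaleC .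
  qed
  have b: "cmod (2 * cinner (wedge gs) \<eta>) \<le> norm (annih_wedge (complexify (F n)) gs) * (sqrt 2 * norm \<eta>)" for n
  proof -
    note c = square_integrable_complexify[OF F[of n]]
    \<comment> \<open>The anticommutation relation with the term
      \<open>creation (complexify (F n)) \<eta>\<close> equal to zero.\<close>
    have "2 *\<^sub>C \<eta> = creation (complexify (F n)) (annihilation (complexify (F n)) \<eta>)"
      using annihilation_creation[OF c c, of \<eta>] z[of n] bounded_clinearD(5)[OF bounded_clinear_annihilation[OF c]]
      by (simp add: FF)
    then have "2 * cinner (wedge gs) \<eta> = cinner (wedge gs) (creation (complexify (F n)) (annihilation (complexify (F n)) \<eta>))"
      by (metis cinner_scaleC_right)
    also have "\<dots> = cinner (annih_wedge (complexify (F n)) gs) (annihilation (complexify (F n)) \<eta>)"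
      by (simp add: annihilation_wedge[OF c gs] flip: cinner_annihilation[OF c])
    also have "cmod \<dots> \<le> norm (annih_wedge (complexify (F n)) gs) * norm (annihilation (complexify (F n)) \<eta>)"
      by (rule cinner_Cauchy_Schwarz)
    also have "\<dots> \<le> norm (annih_wedge (complexify (F n)) gs) * (sqrt 2 * norm \<eta>)"
      using norm_annihilation[OF c, of \<eta>] by (intro mult_left_mono) (auto simp: l2_norm_def FF)
    finally show ?thesis .
  qed
  have "(\<lambda>n. norm (annih_wedge (complexify (F n)) gs) * (sqrt 2 * norm \<eta>)) \<longlonglongrightarrow> 0"
    by (intro tendsto_mult_left_zero tendsto_norm_zero l)
  then have "cmod (2 * cinner (wedge gs) \<eta>) \<le> 0"
    by (rule LIMSEQ_le_const) (use b in blast)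
  then show "cinner (wedge gs) \<eta> = 0" by simp
qed

text \<open>For \<open>x\<close> in the relative commutant, \<open>u(F) x \<Omega> = x u(F) \<Omega> = v(F) x \<Omega>\<close>: so \<open>x \<Omega>\<close> is even and has
  no particles in \<open>[s, \<infinity>)\<close>.\<close>

lemma relative_commutant_vacuum:
  fixes x :: "'k::{real_inner, banach, second_countable_topology} fock \<Rightarrow> 'k fock" and e :: 'k
  assumes s: "0 \<le> s" and e: "e \<noteq> 0" and x: "x \<in> clifford_algebra"
    and comm: "\<And>F \<psi>. F \<in> square_integrable \<Longrightarrow> (\<And>t. t < s \<Longrightarrow> F t = 0) \<Longrightarrow>
      x (clifford_field F \<psi>) = clifford_field F (x \<psi>)"
  shows "parity (x vacuum) = x vacuum"
    and "\<And>F. F \<in> square_integrable \<Longrightarrow> (\<And>t. t < s \<Longrightarrow> F t = 0) \<Longrightarrow> annihilation (complexify F) (x vacuum) = 0"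
proof -
  let ?\<xi> = "x vacuum"
  have *: "clifford_field F ?\<xi> = right_field F ?\<xi>"
    if F: "F \<in> square_integrable" "\<And>t. t < s \<Longrightarrow> F t = 0" for F
  proof -
    have "clifford_field F ?\<xi> = x (clifford_field F vacuum)" using comm[OF F] by simp
    also have "\<dots> = x (right_field F vacuum)" by (simp add: right_field_vacuum[OF F(1)])
    also have "\<dots> = right_field F ?\<xi>" by (rule algebra_right_field[OF x F(1)])
    finally show ?thesis .
  qed
  have "?\<xi> - parity ?\<xi> = 0"
    by (rule creation_kernel_trivial[OF s e]) (use left_right_field_parity(2)[OF _ *] in blast)
  then show p: "parity ?\<xi> = ?\<xi>" by simp
  fix F :: "real \<Rightarrow> 'k" assume F: "F \<in> square_integrable" "\<And>t. t < s \<Longrightarrow> F t = 0"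
  have "2 *\<^sub>R annihilation (complexify F) ?\<xi> = 0"
    using left_right_field_parity(1)[OF F(1) *[OF F]] unfolding p annihilation_linear(1)[OF F(1)] scaleR_2 .
  then show "annihilation (complexify F) ?\<xi> = 0" by simp
qed

text \<open>Weak form of invariance under the second quantisation of \<open>m\<close>. It also
  covers multipliers that are not signs, such as the indicator of an initial interval, without
  constructing their operators.\<close>

definition multiplier_invariant :: "(real \<Rightarrow> real) \<Rightarrow> 'k::{real_inner, banach, second_countable_topology} fock \<Rightarrow> bool" where
  "multiplier_invariant m \<xi> \<longleftrightarrow> m \<in> borel_measurable borel \<and> (\<forall>s. \<bar>m s\<bar> \<le> 1) \<and>
    (\<forall>fs\<in>lists square_integrable. cinner (wedge (map (\<lambda>f s. m s *\<^sub>R f s) fs)) \<xi> = cinner (wedge fs) \<xi>)"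

lemma multiplier_invariant_mult:
  assumes "multiplier_invariant m \<xi>" "multiplier_invariant m' \<xi>"
  shows "multiplier_invariant (\<lambda>s. m s * m' s) \<xi>"
proof -
  have [measurable]: "m \<in> borel_measurable borel" "m' \<in> borel_measurable borel"
    using assms by (auto simp: multiplier_invariant_def)
  have le: "\<bar>m s\<bar> \<le> 1" "\<bar>m' s\<bar> \<le> 1" for s using assms by (auto simp: multiplier_invariant_def)
  have l: "map (\<lambda>f s. m' s *\<^sub>R f s) fs \<in> lists square_integrable" if "fs \<in> lists square_integrable"
    for fs :: "(real \<Rightarrow> 'a \<times> 'a) list"
    using that by (induction fs) (auto intro!: square_integrable_mult le)
  have e: "map (\<lambda>f s. (m s * m' s) *\<^sub>R f s) fs = map (\<lambda>f s. m s *\<^sub>R f s) (map (\<lambda>f s. m' s *\<^sub>R f s) fs)"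
    for fs :: "(real \<Rightarrow> 'a \<times> 'a) list" by simp
  have "\<bar>m s * m' s\<bar> \<le> 1" for s
    using mult_mono[OF le[of s]] by (simp add: abs_mult)
  then show ?thesis
    using assms l unfolding multiplier_invariant_def e by (auto simp del: map_map)
qed

lemma multiplier_invariant_sign_op:
  assumes "sign_function m"
  shows "multiplier_invariant m \<xi> \<longleftrightarrow> sign_op m \<xi> = \<xi>"
proof -
  have "\<bar>m s\<bar> \<le> 1" for s
    using assms by (metis sign_function_def abs_square_le_1 order_refl power2_eq_square)
  then have "multiplier_invariant m \<xi> \<longleftrightarrow> (\<forall>fs\<in>lists square_integrable. cinner (wedge fs) (sign_op m \<xi>) = cinner (wedge fs) \<xi>)"
    using assms unfolding multiplier_invariant_def
    by (simp add: sign_op_wedge[OF assms, symmetric] cinner_sign_op[OF assms] sign_function_def)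
  also have "\<dots> \<longleftrightarrow> sign_op m \<xi> = \<xi>" by (auto intro: fock_eqI)
  finally show ?thesis .
qed

text \<open>Factors are peeled off one at a time. The difference of \<open>f\<close> and
  \<open>m\<close> times \<open>f\<close> vanishes before \<open>s\<close>, so both have the same
  annihilation operator on \<open>\<xi>\<close>. By anticommutation the vector
  \<open>annihilation f \<xi>\<close> inherits the hypothesis, which is why \<open>\<xi>\<close>
  varies in the induction.\<close>

lemma multiplier_invariant_outside:
  fixes \<xi> :: "'k::{real_inner, banach, second_countable_topology} fock"
  assumes m: "m \<in> borel_measurable borel" "\<And>t. \<bar>m t\<bar> \<le> 1" "\<And>t. t < s \<Longrightarrow> m t = 1"
    and 0: "\<And>F. F \<in> square_integrable \<Longrightarrow> (\<And>t. t < s \<Longrightarrow> F t = 0) \<Longrightarrow> annihilation (complexify F) \<xi> = 0"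
  shows "multiplier_invariant m \<xi>"
proof -
  have "cinner (wedge (map (\<lambda>f s. m s *\<^sub>R f s) fs)) \<xi> = cinner (wedge fs) \<xi>"
    if "fs \<in> lists square_integrable" for fs
    using that 0
  proof (induction fs arbitrary: \<xi> rule: list.induct)
    case (Cons f fs)
    have f: "f \<in> square_integrable" and fs: "fs \<in> lists square_integrable" using Cons.prems(1) by auto
    note mf = square_integrable_mult[OF f m(1,2)]
    have mfs: "map (\<lambda>f s. m s *\<^sub>R f s) fs \<in> lists square_integrable"
      using fs by (induction fs) (auto intro!: square_integrable_mult m)
    define h where "h = (\<lambda>t. f t + (-1) *\<^sub>R m t *\<^sub>R f t)"
    have h: "h \<in> square_integrable"
      unfolding h_def by (intro square_integrable_add square_integrable_scale f mf)
    have h0: "h t = 0" if "t < s" for t using m(3)[OF that] by (simp add: h_def)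
    have "annihilation h \<xi> = 0"
      unfolding annihilation_complexify[OF h]
      using Cons.prems(2)[OF square_integrable_fst_snd(1)[OF h]] Cons.prems(2)[OF square_integrable_fst_snd(2)[OF h]]
      by (simp add: h0)
    moreover have "f = (\<lambda>t. m t *\<^sub>R f t + h t)" by (simp add: h_def fun_eq_iff)
    ultimately have a: "annihilation f \<xi> = annihilation (\<lambda>t. m t *\<^sub>R f t) \<xi>"
      using annihilation_add[OF mf h, of \<xi>] by simp
    have c: "annihilation (complexify F) (annihilation f \<xi>) = 0"
      if "F \<in> square_integrable" "\<And>t. t < s \<Longrightarrow> F t = 0" for F
      using annihilation_anticommute[OF square_integrable_complexify[OF that(1)] f, of \<xi>] Cons.prems(2)[OF that]
        bounded_clinearD(5)[OF bounded_clinear_annihilation[OF f]] by simp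
    have "cinner (wedge (map (\<lambda>f s. m s *\<^sub>R f s) (f # fs))) \<xi>
        = cinner (wedge (map (\<lambda>f s. m s *\<^sub>R f s) fs)) (annihilation f \<xi>)"
      unfolding list.map creation_wedge[OF mf mfs, symmetric] cinner_creation[OF mf] a ..
    also have "\<dots> = cinner (wedge fs) (annihilation f \<xi>)" by (rule Cons.IH[OF fs c])
    also have "\<dots> = cinner (wedge (f # fs)) \<xi>"
      unfolding creation_wedge[OF f fs, symmetric] cinner_creation[OF f] ..
    finally show ?case .
  qed simp
  then show ?thesis using m by (simp add: multiplier_invariant_def)
qed

section \<open>Normal functionals that are negated by the generators vanish\<close>

text \<open>The parallelogram law makes minimising sequences of a midpoint convex set Cauchy.
  \<open>S\<close> need not be closed, and the sequence itself is returned because the operators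
  realising its members are needed later, not only the limit.\<close>

lemma minimal_norm_sequence:
  fixes S :: "'a::{real_inner, complete_space} set"
  assumes ne: "S \<noteq> {}" and mid: "\<And>x y. x \<in> S \<Longrightarrow> y \<in> S \<Longrightarrow> (1/2) *\<^sub>R (x + y) \<in> S"
  obtains s \<xi> where "\<And>n. s n \<in> S" "s \<longlonglongrightarrow> \<xi>" "\<And>y. y \<in> S \<Longrightarrow> norm \<xi> \<le> norm y"
proof -
  define d where "d = Inf (norm ` S)"
  have bdd: "bdd_below (norm ` S)" by (intro bdd_belowI[of _ 0]) auto
  have d: "d \<le> norm y" if "y \<in> S" for y
    unfolding d_def using that by (intro cInf_lower bdd) auto
  have d0: "0 \<le> d" unfolding d_def using ne by (intro cInf_greatest) auto
  have "\<exists>y\<in>S. norm y < d + 1 / real (Suc n)" for n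
  proof -
    have "Inf (norm ` S) < d + 1 / real (Suc n)" by (simp add: d_def)
    then show ?thesis using ne bdd by (subst (asm) cInf_less_iff) auto
  qed
  then obtain s where s: "\<And>n. s n \<in> S" "\<And>n. norm (s n) < d + 1 / real (Suc n)" by metis
  have close: "(norm (s m - s n))\<^sup>2 \<le> 4 * (2 * d + 1) / real (Suc N)" if "m \<ge> N" "n \<ge> N" for m n N
  proof -
    define r where "r = 1 / real (Suc N)"
    have r: "0 < r" "r \<le> 1" by (auto simp: r_def)
    have le: "(norm (s k))\<^sup>2 \<le> (d + r)\<^sup>2" if "k \<ge> N" for k
    proof -
      have "1 / real (Suc k) \<le> r" unfolding r_def using that by (intro divide_left_mono) auto
      then have "norm (s k) \<le> d + r" using s(2)[of k] by linarith
      then show ?thesis by (intro power_mono) auto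
    qed
    have "d \<le> norm ((1/2) *\<^sub>R (s m + s n))" by (intro d mid s)
    then have "(2 * d)\<^sup>2 \<le> (norm (s m + s n))\<^sup>2" using d0 by (intro power_mono) auto
    moreover have "(norm (s m - s n))\<^sup>2 + (norm (s m + s n))\<^sup>2 = 2 * (norm (s m))\<^sup>2 + 2 * (norm (s n))\<^sup>2"
      by (simp add: power2_norm_eq_inner inner_add_left inner_add_right inner_diff_left inner_diff_right inner_commute)
    ultimately have "(norm (s m - s n))\<^sup>2 \<le> 4 * (d + r)\<^sup>2 - (2 * d)\<^sup>2"
      using le[OF that(1)] le[OF that(2)] by linarith
    also have "\<dots> = 4 * (2 * d + r) * r" by (simp add: power2_eq_square algebra_simps)
    also have "\<dots> \<le> 4 * (2 * d + 1) * r" using r by (intro mult_right_mono) auto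
    finally show ?thesis by (simp add: r_def)
  qed
  have "Cauchy s"
  proof (rule metric_CauchyI)
    fix e :: real assume e: "e > 0"
    obtain N where N: "4 * (2 * d + 1) / e\<^sup>2 < real N" using reals_Archimedean2 by blast
    have "4 * (2 * d + 1) / e\<^sup>2 < real (Suc N)" using N by simp
    then have N': "4 * (2 * d + 1) / real (Suc N) < e\<^sup>2"
      using e by (simp add: field_simps del: of_nat_Suc)
    have "dist (s m) (s n) < e" if "m \<ge> N" "n \<ge> N" for m n
    proof -
      have "(norm (s m - s n))\<^sup>2 < e\<^sup>2" using close[OF that] N' by linarith
      then show ?thesis using e by (simp add: dist_norm power2_less_imp_less)
    qed
    then show "\<exists>M. \<forall>m\<ge>M. \<forall>n\<ge>M. dist (s m) (s n) < e" by blast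
  qed
  then obtain \<xi> where \<xi>: "s \<longlonglongrightarrow> \<xi>" by (meson Cauchy_convergent convergent_def)
  have d1: "(\<lambda>n. d + 1 / real (Suc n)) \<longlonglongrightarrow> d + 0"
    using LIMSEQ_inverse_real_of_nat by (intro tendsto_intros) (simp add: inverse_eq_divide)
  have le: "norm (s n) \<le> d + 1 / real (Suc n)" for n using s(2)[of n] by simp
  have "norm \<xi> \<le> d + 0"
    by (rule LIMSEQ_le[OF tendsto_norm[OF \<xi>] d1]) (intro exI allI impI le)
  then have "norm \<xi> \<le> norm y" if "y \<in> S" for y using d[OF that] by simp
  then show ?thesis by (rule that[OF s(1) \<xi>])
qed

text \<open>Uniform boundedness lets pointwise convergence to zero pass from a total set to all
  vectors; it serves for operators and for functionals alike.\<close>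

lemma closed_null_set:
  fixes T :: "nat \<Rightarrow> 'a::real_normed_vector \<Rightarrow> 'b::real_normed_vector"
  assumes bd: "\<And>n x. norm (T n x) \<le> C * norm x" and diff: "\<And>n x y. T n (x - y) = T n x - T n y"
  shows "closed {x. (\<lambda>n. T n x) \<longlonglongrightarrow> 0}"
  unfolding closed_sequential_limits
proof (intro allI impI, elim conjE)
  fix x l assume x: "\<forall>j. x j \<in> {x. (\<lambda>n. T n x) \<longlonglongrightarrow> 0}" and l: "x \<longlonglongrightarrow> l"
  have "(\<lambda>n. T n l) \<longlonglongrightarrow> 0"
  proof (rule LIMSEQ_I)
    fix e :: real assume e: "e > 0"
    have C: "\<bar>C\<bar> + 1 > 0" by simp
    have "e / 2 / (\<bar>C\<bar> + 1) > 0" using e C by simp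
    from LIMSEQ_D[OF l this] obtain j where j: "norm (x j - l) < e / 2 / (\<bar>C\<bar> + 1)" by blast
    have "(\<lambda>n. T n (x j)) \<longlonglongrightarrow> 0" using x by blast
    from LIMSEQ_D[OF this, of "e / 2"] e obtain N where N: "\<And>n. n \<ge> N \<Longrightarrow> norm (T n (x j)) < e / 2" by auto
    have "norm (T n l - 0) < e" if "n \<ge> N" for n
    proof -
      have "T n l = T n (x j) - T n (x j - l)" by (simp add: diff)
      then have "norm (T n l) \<le> norm (T n (x j)) + norm (T n (x j - l))" using norm_triangle_ineq4 by metis
      moreover have "norm (T n (x j - l)) \<le> (\<bar>C\<bar> + 1) * norm (x j - l)"
        by (rule order_trans[OF bd mult_right_mono]) auto
      moreover have "(\<bar>C\<bar> + 1) * norm (x j - l) < e / 2" using j C by (simp add: field_simps)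
      ultimately show ?thesis using N[OF that] by simp
    qed
    then show "\<exists>N. \<forall>n\<ge>N. norm (T n l - 0) < e" by blast
  qed
  then show "l \<in> {x. (\<lambda>n. T n x) \<longlonglongrightarrow> 0}" by blast
qed

lemma summable_cinner_bound:
  fixes \<xi> \<eta> :: "nat \<Rightarrow> 'h::complex_inner"
  assumes "summable (\<lambda>n. (norm (\<xi> n))\<^sup>2)" "summable (\<lambda>n. (norm (\<eta> n))\<^sup>2)"
  shows "summable (\<lambda>n. C * ((norm (\<xi> n))\<^sup>2 + (norm (\<eta> n))\<^sup>2))"
  by (intro summable_mult summable_add assms)

text \<open>A crude bound whose right side depends on the operator through \<open>C\<close> only, so
  it majorises the series of a normal functional uniformly on a ball of operators.\<close>

lemma cinner_operator_bound:
  fixes \<xi> \<eta> :: "'h::complex_inner"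
  assumes "\<And>\<psi>. norm (x \<psi>) \<le> C * norm \<psi>" "0 \<le> C"
  shows "norm (cinner \<xi> (x \<eta>)) \<le> C * ((norm \<xi>)\<^sup>2 + (norm \<eta>)\<^sup>2)"
proof -
  have "norm (cinner \<xi> (x \<eta>)) \<le> norm \<xi> * norm (x \<eta>)" by (rule cinner_Cauchy_Schwarz)
  also have "\<dots> \<le> norm \<xi> * (C * norm \<eta>)" by (intro mult_left_mono assms) auto
  also have "\<dots> = C * (norm \<xi> * norm \<eta>)" by simp
  also have "\<dots> \<le> C * ((norm \<xi>)\<^sup>2 + (norm \<eta>)\<^sup>2)"
  proof (rule mult_left_mono[OF _ assms(2)])
    have "2 * norm \<xi> * norm \<eta> \<le> (norm \<xi>)\<^sup>2 + (norm \<eta>)\<^sup>2" by (rule sum_squares_bound)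
    moreover have "0 \<le> norm \<xi> * norm \<eta>" by simp
    ultimately show "norm \<xi> * norm \<eta> \<le> (norm \<xi>)\<^sup>2 + (norm \<eta>)\<^sup>2" by linarith
  qed
  finally show ?thesis .
qed

lemma bounded_clinear_bound:
  assumes "bounded_clinear x"
  obtains C where "0 \<le> C" "\<And>\<psi>. norm (x \<psi>) \<le> C * norm \<psi>"
  using bounded_linear.nonneg_bounded[OF bounded_clinearD(7)[OF assms]] by (auto simp: mult.commute)

lemma predual_summable:
  fixes \<xi> \<eta> :: "nat \<Rightarrow> 'h::complex_inner"
  assumes "summable (\<lambda>n. (norm (\<xi> n))\<^sup>2)" "summable (\<lambda>n. (norm (\<eta> n))\<^sup>2)" "bounded_clinear x"
  shows "summable (\<lambda>n. cinner (\<xi> n) (x (\<eta> n)))"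
proof -
  obtain C where C: "0 \<le> C" "\<And>\<psi>. norm (x \<psi>) \<le> C * norm \<psi>"
    using bounded_clinear_bound[OF assms(3)] by blast
  show ?thesis
    by (rule summable_comparison_test'[OF summable_cinner_bound[OF assms(1,2), of C]])
      (rule cinner_operator_bound[OF C(2,1)])
qed

text \<open>The operators \<open>x'\<close> with \<open>\<rho> x' = \<rho> x\<close> and norm at most \<open>C\<close> form a convex set that is invariant
  under \<open>x' \<mapsto> (x' - w x' w) / 2\<close>, \<open>w = u(f)\<close>. On the vacuum this map is the projection \<open>(1 - w v(f)) / 2\<close>,
  so a vector of minimal norm in the closure of this set applied to the vacuum satisfies
  \<open>u(f) \<xi> = - v(f) \<xi>\<close> for all \<open>f\<close>, and must vanish.\<close>

lemma anti_invariant_normal_zero: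
  fixes \<rho> :: "('k::{real_inner, banach, second_countable_topology} fock \<Rightarrow> 'k fock) \<Rightarrow> complex" and e :: 'k
  assumes e: "e \<noteq> 0" and \<rho>: "\<rho> \<in> predual clifford_algebra" and x: "x \<in> clifford_algebra"
    and anti: "\<And>f y. f \<in> square_integrable \<Longrightarrow> l2_inner (complexify f) (complexify f) = 2 \<Longrightarrow>
      y \<in> clifford_algebra \<Longrightarrow> \<rho> (clifford_field f \<circ> y \<circ> clifford_field f) = - \<rho> y"
  shows "\<rho> x = 0"
proof -
  obtain \<xi> \<eta> where sum: "summable (\<lambda>n. (norm (\<xi> n))\<^sup>2)" "summable (\<lambda>n. (norm (\<eta> n))\<^sup>2)"
    and \<rho>_eq: "\<And>y. y \<in> clifford_algebra \<Longrightarrow> \<rho> y = (\<Sum>n. cinner (\<xi> n) (y (\<eta> n)))"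
    using \<rho> unfolding predual_def by blast
  have \<rho>_add: "\<rho> (\<lambda>\<psi>. y \<psi> + z \<psi>) = \<rho> y + \<rho> z"
    if y: "y \<in> clifford_algebra" and z: "z \<in> clifford_algebra" for y z
    unfolding \<rho>_eq[OF y] \<rho>_eq[OF z] \<rho>_eq[OF clifford_algebra_add[OF y z]] cinner_add_right
    by (rule suminf_add[symmetric]) (intro predual_summable sum bounded_clinear_algebra y z)+
  have \<rho>_scale: "\<rho> (\<lambda>\<psi>. c *\<^sub>C y \<psi>) = c * \<rho> y" if y: "y \<in> clifford_algebra" for c y
    unfolding \<rho>_eq[OF y] \<rho>_eq[OF clifford_algebra_scaleC[OF y]] cinner_scaleC_right
    by (rule suminf_mult) (intro predual_summable sum bounded_clinear_algebra y)
  obtain C where C: "0 \<le> C" "\<And>\<psi>. norm (x \<psi>) \<le> C * norm \<psi>"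
    using bounded_clinear_bound[OF bounded_clinear_algebra[OF x]] by blast
  \<comment> \<open>The common bound \<open>C\<close> is kept so that the series for
    \<open>\<rho> (y n)\<close> has a summable majorant independent of \<open>n\<close>.\<close>
  define K where "K = {y \<in> clifford_algebra. \<rho> y = \<rho> x \<and> (\<forall>\<psi>. norm (y \<psi>) \<le> C * norm \<psi>)}"
  have K: "y \<in> clifford_algebra" "\<rho> y = \<rho> x" "norm (y \<psi>) \<le> C * norm \<psi>" if "y \<in> K" for y \<psi>
    using that by (auto simp: K_def)
  have xK: "x \<in> K" using x C by (simp add: K_def)
  have avg: "(\<lambda>\<psi>. (1/2) *\<^sub>R (y \<psi> + z \<psi>)) \<in> K"
    if y: "y \<in> clifford_algebra" and z: "z \<in> clifford_algebra" and r: "\<rho> y = \<rho> x" "\<rho> z = \<rho> x"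
      and b: "\<And>\<psi>. norm (y \<psi>) \<le> C * norm \<psi>" "\<And>\<psi>. norm (z \<psi>) \<le> C * norm \<psi>" for y z
  proof -
    note yz = clifford_algebra_add[OF y z]
    have "norm ((1/2) *\<^sub>R (y \<psi> + z \<psi>)) \<le> C * norm \<psi>" for \<psi>
      using norm_triangle_ineq[of "y \<psi>" "z \<psi>"] b[of \<psi>] by simp
    then show ?thesis
      using clifford_algebra_scaleC[OF yz, of "1/2"] \<rho>_scale[OF yz, of "1/2"] \<rho>_add[OF y z] r
      by (simp add: K_def scaleR_scaleC)
  qed
  define S where "S = (\<lambda>y. y vacuum) ` K"
  have mid: "(1/2) *\<^sub>R (a + b) \<in> S" if ab: "a \<in> S" "b \<in> S" for a b
  proof -
    obtain y z where yz: "y \<in> K" "z \<in> K" "a = y vacuum" "b = z vacuum"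
      using ab by (auto simp: S_def)
    have "(\<lambda>\<psi>. (1/2) *\<^sub>R (y \<psi> + z \<psi>)) \<in> K" by (rule avg) (use K yz in auto)
    then show ?thesis unfolding S_def yz(3,4) by (rule rev_image_eqI) simp
  qed
  have Sne: "S \<noteq> {}" using xK by (auto simp: S_def)
  obtain s \<xi>0 where s: "\<And>n. s n \<in> S" "s \<longlonglongrightarrow> \<xi>0" "\<And>y. y \<in> S \<Longrightarrow> norm \<xi>0 \<le> norm y"
    using minimal_norm_sequence[OF Sne mid] by blast
  have "\<exists>y\<in>K. s n = y vacuum" for n using s(1)[of n] by (auto simp: S_def)
  then obtain y where y: "\<And>n. y n \<in> K" "\<And>n. s n = y n vacuum" by metis
  have sign: "clifford_field f \<xi>0 = - right_field f \<xi>0"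
    if f: "f \<in> square_integrable" "l2_inner (complexify f) (complexify f) = 2" for f
  proof -
    note u = bounded_clinear_clifford_field[OF f(1)] and v = bounded_clinear_right_field[OF f(1)]
    have uu: "clifford_field f (clifford_field f \<psi>) = \<psi>" for \<psi>
      unfolding clifford_field_square[OF f(1)] f(2) by (simp add: scaleR_scaleC scaleC_scaleC)
    have vv: "right_field f (right_field f \<psi>) = \<psi>" for \<psi>
      unfolding right_field_square[OF f(1)] f(2) by (simp add: scaleR_scaleC scaleC_scaleC)
    have nu: "norm (clifford_field f \<psi>) = norm \<psi>" for \<psi>
    proof -
      have "cinner (clifford_field f \<psi>) (clifford_field f \<psi>) = cinner \<psi> \<psi>"
        unfolding cinner_clifford_field[OF f(1)] uu ..
      then show ?thesis by (simp add: norm_eq_sqrt_inner inner_cinner)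
    qed
    have nv: "norm (right_field f \<psi>) = norm \<psi>" for \<psi>
    proof -
      have "cinner (right_field f \<psi>) (right_field f \<psi>) = cinner \<psi> \<psi>"
        unfolding cinner_right_field[OF f(1)] vv ..
      then show ?thesis by (simp add: norm_eq_sqrt_inner inner_cinner)
    qed
    let ?V = "\<lambda>\<psi>. clifford_field f (right_field f \<psi>)"
    have "norm \<xi>0 \<le> norm ((1/2) *\<^sub>R (s n - ?V (s n)))" for n
    proof (rule s(3))
      \<comment> \<open>With u, v for the left and right field of \<open>f\<close>, this is -u y u.
        It has the right value under \<open>\<rho>\<close> by \<open>anti\<close>, and its norm
        bound is unchanged as u is isometric. On the vacuum u agrees with v, and v commutes with
        \<open>y n\<close>, which gives -u v applied to \<open>s n\<close>.\<close>
      let ?z = "\<lambda>\<psi>. (-1) *\<^sub>C (clifford_field f \<circ> y n \<circ> clifford_field f) \<psi>"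
      note cf = clifford_field_algebra[OF f(1)]
      have z: "?z \<in> clifford_algebra"
        by (intro clifford_algebra_scaleC clifford_algebra_compose cf K(1) y)
      have rz: "\<rho> ?z = \<rho> x"
        using \<rho>_scale[OF clifford_algebra_compose[OF clifford_algebra_compose[OF cf K(1)[OF y(1)]] cf], of "-1" n]
          anti[OF f K(1)[OF y(1)], of n] K(2)[OF y(1)[of n]] by simp
      have bz: "norm (?z \<psi>) \<le> C * norm \<psi>" for \<psi>
        using K(3)[OF y(1), of n "clifford_field f \<psi>"] by (simp add: norm_scaleC nu)
      have zK: "(\<lambda>\<psi>. (1/2) *\<^sub>R (y n \<psi> + ?z \<psi>)) \<in> K"
        by (rule avg[OF K(1)[OF y(1)] z K(2)[OF y(1)] rz K(3)[OF y(1)] bz])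
      have zv: "?z vacuum = - ?V (s n)"
        using algebra_right_field[OF K(1)[OF y(1)] f(1), of n vacuum]
        by (simp add: scaleC_minus_left y(2) flip: right_field_vacuum[OF f(1)])
      show "(1/2) *\<^sub>R (s n - ?V (s n)) \<in> S"
        unfolding S_def by (rule rev_image_eqI[OF zK]) (simp only: zv y(2) add_uminus_conv_diff)
    qed
    moreover have "(\<lambda>n. norm ((1/2) *\<^sub>R (s n - ?V (s n)))) \<longlonglongrightarrow> norm ((1/2) *\<^sub>R (\<xi>0 - ?V \<xi>0))"
      by (intro tendsto_intros s(2) bounded_linear.tendsto[OF bounded_clinearD(7)[OF u]]
          bounded_linear.tendsto[OF bounded_clinearD(7)[OF v]])
    ultimately have "norm \<xi>0 \<le> norm ((1/2) *\<^sub>R (\<xi>0 - ?V \<xi>0))"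
      by (intro LIMSEQ_le_const) auto
    \<comment> \<open>By minimality, (1 - V)/2 does not shorten the minimal vector. As V preserves
      norms, the parallelogram law leaves no room for 1 + V on it.\<close>
    then have "(2 * norm \<xi>0)\<^sup>2 \<le> (norm (\<xi>0 - ?V \<xi>0))\<^sup>2"
      by (intro power_mono) auto
    moreover have "(norm (\<xi>0 - ?V \<xi>0))\<^sup>2 + (norm (\<xi>0 + ?V \<xi>0))\<^sup>2 = 2 * (norm \<xi>0)\<^sup>2 + 2 * (norm (?V \<xi>0))\<^sup>2"
      by (simp add: power2_norm_eq_inner inner_add_left inner_add_right inner_diff_left inner_diff_right inner_commute)
    moreover have "norm (?V \<xi>0) = norm \<xi>0" "(2 * norm \<xi>0)\<^sup>2 = 4 * (norm \<xi>0)\<^sup>2"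
      by (simp_all add: nu nv power_mult_distrib)
    ultimately have "(norm (\<xi>0 + ?V \<xi>0))\<^sup>2 \<le> 0" by (simp only:)
    then have "?V \<xi>0 = - \<xi>0" by (simp add: eq_neg_iff_add_eq_0 add.commute)
    then have "clifford_field f (?V \<xi>0) = - clifford_field f \<xi>0"
      by (simp add: bounded_clinearD(6)[OF u])
    then show ?thesis by (simp add: uu)
  qed
  have p: "\<xi>0 + parity \<xi>0 = 0"
    by (rule creation_kernel_trivial[OF order_refl e]) (use left_right_field_parity(4) sign in blast)
  define q where "q = \<xi>0 - parity \<xi>0"
  \<comment> \<open>\<open>sign\<close> is available for squared norm 2 only, to which scaling by
    \<open>c\<close> reduces; functions of norm zero are covered by the norm bound of
    \<open>annihilation\<close>.\<close>
  have Bq: "annihilation (complexify f) q = 0" if f: "f \<in> square_integrable" for f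
  proof (cases "l2_norm (complexify f) = 0")
    case True
    then show ?thesis using norm_annihilation[OF square_integrable_complexify[OF f], of q] by simp
  next
    case False
    define c where "c = sqrt 2 / l2_norm (complexify f)"
    have c: "c \<noteq> 0" using False by (simp add: c_def)
    note cf = square_integrable_scale[OF f, of c]
    have e: "complexify (\<lambda>s. c *\<^sub>R f s) = (\<lambda>s. c *\<^sub>R complexify f s)" by (simp add: fun_eq_iff)
    have "l2_inner (complexify (\<lambda>s. c *\<^sub>R f s)) (complexify (\<lambda>s. c *\<^sub>R f s))
        = of_real c * of_real c * of_real ((l2_norm (complexify f))\<^sup>2)"
      unfolding e l2_inner_scaleR_left l2_inner_mult[of "\<lambda>_. c", symmetric] l2_norm_ge_0(2)[OF square_integrable_complexify[OF f]]
      by simp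
    also have "\<dots> = of_real ((c * l2_norm (complexify f))\<^sup>2)" by (simp add: power2_eq_square mult_ac)
    also have "\<dots> = 2" using False by (simp add: c_def)
    finally have "annihilation (complexify (\<lambda>s. c *\<^sub>R f s)) q = 0"
      unfolding q_def by (intro left_right_field_parity(3)[OF cf sign[OF cf]])
    then show ?thesis using c unfolding e annihilation_scaleR[OF square_integrable_complexify[OF f]] by simp
  qed
  \<comment> \<open>Killed by all annihilation operators, \<open>q\<close> is orthogonal to wedges
    of positive length; being odd, it is orthogonal to the vacuum as well.\<close>
  have "q = 0"
  proof (rule fock_ext)
    fix fs :: "(real \<Rightarrow> 'k \<times> 'k) list" assume fs: "fs \<in> lists square_integrable"
    show "cinner (wedge fs) q = 0"
    proof (cases fs)
      case Nil
      have "cinner vacuum q = cinner vacuum \<xi>0 - cinner (parity vacuum) \<xi>0"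
        by (simp only: q_def cinner_diff_right cinner_sign_op[OF sign_function_minus_one])
      then show ?thesis by (simp add: Nil)
    next
      case (Cons f gs)
      then have f: "f \<in> square_integrable" and gs: "gs \<in> lists square_integrable" using fs by auto
      have "annihilation f q = 0"
        unfolding annihilation_complexify[OF f]
        by (simp add: Bq square_integrable_fst_snd[OF f])
      then show ?thesis
        unfolding Cons creation_wedge[OF f gs, symmetric] cinner_creation[OF f] by simp
    qed
  qed
  then have "2 *\<^sub>R \<xi>0 = 0" using p unfolding q_def scaleR_2 by (metis add_0_right eq_iff_diff_eq_0)
  then have \<xi>0: "(\<lambda>n. y n vacuum) \<longlonglongrightarrow> 0" using s(2) unfolding y(2)[symmetric] by simp
  have bl: "bounded_clinear (y n)" for n by (rule bounded_clinear_algebra[OF K(1)[OF y(1)]])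
  \<comment> \<open>The \<open>y n\<close> commute with right fields and are uniformly bounded, so
    their convergence to zero on the vacuum spreads to every vector. Then
    \<open>\<rho> (y n)\<close>, constantly \<open>\<rho> x\<close>, tends to zero.\<close>
  have "closed {\<psi>. (\<lambda>n. y n \<psi>) \<longlonglongrightarrow> 0}"
    by (rule closed_null_set[where C = C]) (simp_all add: K(3)[OF y(1)] bounded_clinearD(2)[OF bl])
  then have "{\<psi>. (\<lambda>n. y n \<psi>) \<longlonglongrightarrow> 0} = UNIV"
  proof (rule right_cyclic)
    show "vacuum \<in> {\<psi>. (\<lambda>n. y n \<psi>) \<longlonglongrightarrow> 0}" using \<xi>0 by simp
    fix a b :: "'k fock" and c :: complex and f :: "real \<Rightarrow> 'k"
    assume a: "a \<in> {\<psi>. (\<lambda>n. y n \<psi>) \<longlonglongrightarrow> 0}"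
    show "a + b \<in> {\<psi>. (\<lambda>n. y n \<psi>) \<longlonglongrightarrow> 0}" if "b \<in> {\<psi>. (\<lambda>n. y n \<psi>) \<longlonglongrightarrow> 0}"
      using a that by (simp add: bounded_clinearD(1)[OF bl] tendsto_add_zero)
    show "c *\<^sub>C a \<in> {\<psi>. (\<lambda>n. y n \<psi>) \<longlonglongrightarrow> 0}"
      using a tendsto_scaleC[of "\<lambda>n. y n a" 0 sequentially c] by (simp add: bounded_clinearD(3)[OF bl])
    assume f: "f \<in> square_integrable"
    note v = bounded_clinearD[OF bounded_clinear_right_field[OF f]]
    show "right_field f a \<in> {\<psi>. (\<lambda>n. y n \<psi>) \<longlonglongrightarrow> 0}"
      using a bounded_linear.tendsto[OF v(7), of "\<lambda>n. y n a" 0]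
      by (simp add: algebra_right_field[OF K(1)[OF y(1)] f] v(5))
  qed
  then have lim: "(\<lambda>n. y n \<psi>) \<longlonglongrightarrow> 0" for \<psi> by blast
  have "(\<lambda>n. \<Sum>k. cinner (\<xi> k) (y n (\<eta> k))) \<longlonglongrightarrow> (\<Sum>k. 0)"
  proof (rule conjunct2[OF conjunct2[OF tannerys_theorem]])
    show "(\<lambda>n. cinner (\<xi> k) (y n (\<eta> k))) \<longlonglongrightarrow> 0" for k
      using tendsto_cinner[OF tendsto_const lim] by simp
    show "summable (\<lambda>n. C * ((norm (\<xi> n))\<^sup>2 + (norm (\<eta> n))\<^sup>2))" by (rule summable_cinner_bound[OF sum])
    show "\<forall>\<^sub>F (k, n) in at_top \<times>\<^sub>F sequentially. norm (cinner (\<xi> k) (y n (\<eta> k))) \<le> C * ((norm (\<xi> k))\<^sup>2 + (norm (\<eta> k))\<^sup>2)"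
      by (intro always_eventually) (auto intro!: cinner_operator_bound K(3)[OF y(1)] C(1))
  qed simp
  then have "(\<lambda>n. \<rho> (y n)) \<longlonglongrightarrow> 0" by (simp add: \<rho>_eq[OF K(1)[OF y(1)]])
  then show ?thesis by (simp add: K(2)[OF y(1)] LIMSEQ_const_iff)
qed

section \<open>The Clifford flow\<close>

lemma clifford_product_simps [simp]:
  "clifford_product [] = id" "clifford_product (f # fs) = clifford_field f \<circ> clifford_product fs"
  by (simp_all add: clifford_product_def)

lemma clifford_product_algebra: "fs \<in> lists square_integrable \<Longrightarrow> clifford_product fs \<in> clifford_algebra"
  by (induction fs rule: list.induct)
    (auto simp del: comp_apply intro!: clifford_algebra_id clifford_algebra_compose clifford_field_algebra)

lemma clifford_product_append: "clifford_product (fs @ gs) = clifford_product fs \<circ> clifford_product gs"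
  by (induction fs) (simp_all add: o_assoc)

lemma cinner_clifford_product:
  "fs \<in> lists square_integrable \<Longrightarrow>
   cinner (clifford_product fs \<psi>) \<phi> = cinner \<psi> (clifford_product (rev fs) \<phi>)"
  by (induction fs arbitrary: \<phi> rule: list.induct)
    (auto simp: clifford_product_append cinner_clifford_field)

definition supported_before ::
    "real \<Rightarrow> (real \<Rightarrow> 'k::{real_inner, banach, second_countable_topology}) set" where
  "supported_before s = {f \<in> square_integrable. \<forall>t\<ge>s. f t = 0}"

lemma shift_unshift:
  assumes "\<And>t. t < s \<Longrightarrow> f t = 0"
  shows "shift s (\<lambda>t. f (t + s)) = f"
  using assms by (auto simp: shift_def fun_eq_iff)

lemma l2_inner_disjoint_supports:
  assumes "g \<in> supported_before s"
  shows "l2_inner (complexify (shift s h)) (complexify g) = 0"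
proof -
  have "cplx_inner (shift s h t, 0) (g t, 0) = 0" for t
    using assms by (cases "t < s") (auto simp: cplx_inner_def shift_def supported_before_def complex_eq_iff)
  then show ?thesis by (simp add: l2_inner_def)
qed

definition flip :: "real \<Rightarrow> real \<Rightarrow> real" where
  "flip s t = (if t < s then - 1 else 1)"

lemma sign_function_flip: "sign_function (flip s)"
proof -
  have "flip s = (\<lambda>t. if t < s then - 1 else 1)" by (simp add: flip_def fun_eq_iff)
  then show ?thesis by (simp add: sign_function_def)
qed

text \<open>Separates the global parity from a multiplier equal to 1 before \<open>s\<close>; gauge
  cocycles at time \<open>s\<close> are controlled under each of the two.\<close>

lemma flip_eq: "flip s = (\<lambda>t. (if t < s then 1 else - 1) * (- 1))"
  by (auto simp: flip_def fun_eq_iff)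

locale clifford_flow_locale =
  fixes \<alpha> :: "real \<Rightarrow> ('k::{real_inner, banach, second_countable_topology} fock \<Rightarrow> 'k fock) \<Rightarrow> ('k fock \<Rightarrow> 'k fock)"
    and e :: 'k
  assumes flow: "clifford_flow \<alpha>" and e: "e \<noteq> 0"
begin

lemma E0: "E0_semigroup clifford_algebra \<alpha>"
  using flow by (simp add: clifford_flow_def)

lemma endo: "t \<ge> 0 \<Longrightarrow> normal_unital_endo clifford_algebra (\<alpha> t)"
  using E0 by (simp add: E0_semigroup_def)

lemma \<alpha>_algebra: "t \<ge> 0 \<Longrightarrow> x \<in> clifford_algebra \<Longrightarrow> \<alpha> t x \<in> clifford_algebra"
  and \<alpha>_compose: "t \<ge> 0 \<Longrightarrow> x \<in> clifford_algebra \<Longrightarrow> y \<in> clifford_algebra \<Longrightarrow> \<alpha> t (x \<circ> y) = \<alpha> t x \<circ> \<alpha> t y"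
  and \<alpha>_scaleC: "t \<ge> 0 \<Longrightarrow> x \<in> clifford_algebra \<Longrightarrow> \<alpha> t (\<lambda>v. c *\<^sub>C x v) = (\<lambda>v. c *\<^sub>C \<alpha> t x v)"
  and \<alpha>_id: "t \<ge> 0 \<Longrightarrow> \<alpha> t id = id"
  and \<alpha>_predual: "t \<ge> 0 \<Longrightarrow> \<rho> \<in> predual clifford_algebra \<Longrightarrow> (\<lambda>x. \<rho> (\<alpha> t x)) \<in> predual clifford_algebra"
  using endo[of t] unfolding normal_unital_endo_def by auto

lemma \<alpha>_product:
  "t \<ge> 0 \<Longrightarrow> fs \<in> lists square_integrable \<Longrightarrow> \<alpha> t (clifford_product fs) = clifford_product (map (shift t) fs)"
  using flow by (simp add: clifford_flow_def)

lemma \<alpha>_field: "t \<ge> 0 \<Longrightarrow> f \<in> square_integrable \<Longrightarrow> \<alpha> t (clifford_field f) = clifford_field (shift t f)"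
  using \<alpha>_product[of t "[f]"] by simp

lemma clifford_field_shift_product:
  assumes s: "s \<ge> 0" and h: "h \<in> square_integrable" and gs: "gs \<in> lists (supported_before s)"
  shows "clifford_field (shift s h) (clifford_product gs \<psi>)
    = (-1) ^ length gs *\<^sub>R clifford_product gs (clifford_field (shift s h) \<psi>)"
  using gs
proof (induction gs rule: list.induct)
  case (Cons g gs)
  then have g: "g \<in> supported_before s" "g \<in> square_integrable" and gs: "gs \<in> lists (supported_before s)"
    by (auto simp: supported_before_def)
  note sh = square_integrable_shift[OF h s]
  have "clifford_field (shift s h) (clifford_field g \<phi>) = - clifford_field g (clifford_field (shift s h) \<phi>)" for \<phi>
    using clifford_field_anticommute[OF sh g(2), of \<phi>] l2_inner_disjoint_supports[OF g(1), of h]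
    by (simp add: eq_neg_iff_add_eq_0)
  then show ?case
    using Cons.IH[OF gs] bounded_clinearD[OF bounded_clinear_clifford_field[OF g(2)]] by simp
qed simp

lemma clifford_field_product_shift:
  assumes s: "s \<ge> 0" and g: "g \<in> supported_before s" and hs: "hs \<in> lists square_integrable"
  shows "clifford_field g (clifford_product (map (shift s) hs) \<psi>)
    = (-1) ^ length hs *\<^sub>R clifford_product (map (shift s) hs) (clifford_field g \<psi>)"
  using hs
proof (induction hs rule: list.induct)
  case (Cons h hs)
  then have h: "h \<in> square_integrable" and hs: "hs \<in> lists square_integrable" by auto
  have g': "g \<in> square_integrable" using g by (simp add: supported_before_def)
  note sh = square_integrable_shift[OF h s]
  have "clifford_field g (clifford_field (shift s h) \<phi>) = - clifford_field (shift s h) (clifford_field g \<phi>)" for \<phi>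
    using clifford_field_anticommute[OF sh g', of \<phi>] l2_inner_disjoint_supports[OF g, of h]
    by (simp add: eq_neg_iff_add_eq_0 add.commute)
  then show ?case
    using Cons.IH[OF hs] bounded_clinearD[OF bounded_clinear_clifford_field[OF sh]] by simp
qed simp

lemma supported_before_lists: "gs \<in> lists (supported_before s) \<Longrightarrow> gs \<in> lists square_integrable"
  by (auto simp: supported_before_def)

lemma shift_lists: "s \<ge> 0 \<Longrightarrow> hs \<in> lists square_integrable \<Longrightarrow> map (shift s) hs \<in> lists square_integrable"
  by (auto intro!: square_integrable_shift)

text \<open>Conjugating \<open>x\<close> by u(f) conjugates alpha_s(x) by u(T_s f), which
  anticommutes with each early field in \<open>gs\<close>. An odd number of them makes the
  functional anti-invariant.\<close>

lemma odd_product_orthogonal: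
  assumes s: "s \<ge> 0" and gs: "gs \<in> lists (supported_before s)" and odd: "odd (length gs)"
    and x: "x \<in> clifford_algebra"
  shows "cinner (clifford_product gs vacuum) (\<alpha> s x vacuum) = 0"
proof -
  define \<psi> where "\<psi> = clifford_product gs vacuum"
  define \<rho> where "\<rho> = (\<lambda>x :: 'k fock \<Rightarrow> 'k fock. cinner \<psi> (x vacuum))"
  \<comment> \<open>Sequences with a single nonzero term represent a vector functional. That it
    stays in the predual after composition with \<open>\<alpha> s\<close> is the use of
    normality.\<close>
  have "\<rho> \<in> predual clifford_algebra"
    unfolding predual_def mem_Collect_eq
  proof (rule exI[of _ "\<lambda>n. if n = 0 then \<psi> else 0"], rule exI[of _ "\<lambda>n. if n = 0 then vacuum else 0"],
      intro conjI ballI)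
    show "\<rho> y = (\<Sum>n. cinner (if n = 0 then \<psi> else 0) (y (if n = 0 then vacuum else 0)))" for y
      by (subst suminf_finite[of "{0 :: nat}"]) (auto simp: \<rho>_def)
  qed (auto intro!: summable_finite[of "{0 :: nat}"] split: if_splits)
  then have r: "(\<lambda>x. \<rho> (\<alpha> s x)) \<in> predual clifford_algebra" by (rule \<alpha>_predual[OF s])
  have "\<rho> (\<alpha> s x) = 0"
  proof (rule anti_invariant_normal_zero[OF e r x])
    fix f :: "real \<Rightarrow> 'k" and y assume f: "f \<in> square_integrable" "l2_inner (complexify f) (complexify f) = 2"
      and y: "(y :: 'k fock \<Rightarrow> 'k fock) \<in> clifford_algebra"
    note u = clifford_field_algebra[OF f(1)] and sf = square_integrable_shift[OF f(1) s]
    let ?u = "clifford_field (shift s f)" and ?v = "right_field (shift s f)"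
    have "clifford_field f \<circ> clifford_field f = id"
      unfolding fun_eq_iff o_def clifford_field_square[OF f(1)] f(2) by (simp add: scaleR_scaleC scaleC_scaleC)
    \<comment> \<open>The square is transported by the homomorphism \<open>\<alpha> s\<close> rather
      than recomputed from the norm of the shifted function.\<close>
    then have "?u \<circ> ?u = id"
      using \<alpha>_compose[OF s u u] by (simp add: \<alpha>_id[OF s] \<alpha>_field[OF s f(1)])
    then have uu: "?u (?u \<phi>) = \<phi>" for \<phi> by (metis comp_apply id_apply)
    \<comment> \<open>The left field passes an odd number of early fields, which gives the sign, and
      becomes the right field on the vacuum. The right fields commute with
      \<open>clifford_product gs\<close> and square to the identity there.\<close>
    have "?v (?u \<psi>) = - ?v (clifford_product gs (?u vacuum))"
      using odd clifford_field_shift_product[OF s f(1) gs, of vacuum]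
      by (simp add: \<psi>_def bounded_clinearD(6)[OF bounded_clinear_right_field[OF sf]])
    also have "\<dots> = - clifford_product gs (?v (?v vacuum))"
      unfolding algebra_right_field[OF clifford_product_algebra[OF supported_before_lists[OF gs]] sf, symmetric]
        right_field_vacuum[OF sf, symmetric] ..
    also have "?v (?v vacuum) = ?u (?u vacuum)"
      unfolding right_field_vacuum[OF sf] clifford_field_right_field[OF sf sf, symmetric] ..
    finally have vu: "?v (?u \<psi>) = - \<psi>" by (simp add: uu \<psi>_def)
    have "\<alpha> s (clifford_field f \<circ> y \<circ> clifford_field f) = ?u \<circ> \<alpha> s y \<circ> ?u"
      by (simp add: \<alpha>_compose[OF s] u y clifford_algebra_compose \<alpha>_field[OF s f(1)])
    then have "\<rho> (\<alpha> s (clifford_field f \<circ> y \<circ> clifford_field f)) = cinner (?u \<psi>) (\<alpha> s y (?v vacuum))"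
      by (simp add: \<rho>_def cinner_clifford_field[OF sf] right_field_vacuum[OF sf])
    also have "\<dots> = cinner (?v (?u \<psi>)) (\<alpha> s y vacuum)"
      by (simp add: algebra_right_field[OF \<alpha>_algebra[OF s y] sf] cinner_right_field[OF sf])
    also have "\<dots> = - \<rho> (\<alpha> s y)" by (simp add: vu \<rho>_def cinner_minus_left)
    finally show "\<rho> (\<alpha> s (clifford_field f \<circ> y \<circ> clifford_field f)) = - \<rho> (\<alpha> s y)" .
  qed
  then show ?thesis by (simp add: \<rho>_def \<psi>_def)
qed

lemma flip_product:
  assumes s: "s \<ge> 0" and hs: "hs \<in> lists square_integrable" and gs: "gs \<in> lists (supported_before s)"
  shows "sign_op (flip s) (clifford_product (map (shift s) hs) (clifford_product gs vacuum))
    = (-1) ^ length gs *\<^sub>R clifford_product (map (shift s) hs) (clifford_product gs vacuum)"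
proof -
  note m = sign_function_flip[of s]
  have g: "sign_op (flip s) (clifford_product gs vacuum) = (-1) ^ length gs *\<^sub>R clifford_product gs vacuum"
    using gs
  proof (induction gs rule: list.induct)
    case (Cons g gs)
    then have g: "g \<in> supported_before s" "g \<in> square_integrable" and gs: "gs \<in> lists (supported_before s)"
      by (auto simp: supported_before_def)
    have "(\<lambda>t. flip s t *\<^sub>R g t) = (\<lambda>t. (-1) *\<^sub>R g t)"
      using g(1) by (auto simp: fun_eq_iff flip_def supported_before_def)
    moreover have "clifford_field (\<lambda>t. (-1) *\<^sub>R g t) \<phi> = - clifford_field g \<phi>" for \<phi>
      using creation_scaleR[OF square_integrable_complexify[OF g(2)], of "-1" \<phi>] annihilation_scaleR[OF square_integrable_complexify[OF g(2)], of "-1" \<phi>]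
      by (simp add: clifford_field_eq scaleR_add_right scaleR_diff_right)
    ultimately show ?case
      using Cons.IH[OF gs] sign_op_clifford_field[OF g(2) m]
        bounded_clinearD[OF bounded_clinear_clifford_field[OF g(2)]] by simp
  qed (simp add: sign_op_Nil[OF m])
  show ?thesis
    using hs
  proof (induction hs rule: list.induct)
    case (Cons h hs)
    then have h: "h \<in> square_integrable" and hs: "hs \<in> lists square_integrable" by auto
    note sh = square_integrable_shift[OF h s]
    have "(\<lambda>t. flip s t *\<^sub>R shift s h t) = shift s h"
      by (auto simp: fun_eq_iff flip_def shift_def)
    then show ?case
      using Cons.IH[OF hs] sign_op_clifford_field[OF sh m]
        bounded_clinearD[OF bounded_clinear_clifford_field[OF sh]] by simp
  qed (simp add: g)
qed

text \<open>The vectors \<open>u(h\<^sub>1) \<dots> u(h\<^sub>j) u(g\<^sub>1) \<dots> u(g\<^sub>i) \<Omega>\<close>, with \<open>h\<close>s supported in \<open>[s, \<infinity>)\<close> and \<open>g\<close>s in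
  \<open>[0, s)\<close>, are total and are eigenvectors of the flip; those with eigenvalue \<open>-1\<close> are orthogonal to
  \<open>\<alpha>\<^sub>s(x) \<Omega>\<close>.\<close>

lemma flip_range:
  assumes s: "s \<ge> 0" and x: "x \<in> clifford_algebra"
  shows "sign_op (flip s) (\<alpha> s x vacuum) = \<alpha> s x vacuum"
proof -
  note m = sign_function_flip[of s]
  define N where "N = {\<zeta> :: 'k fock. \<forall>hs\<in>lists square_integrable. \<forall>gs\<in>lists (supported_before s).
    cinner (clifford_product (map (shift s) hs) (clifford_product gs vacuum)) \<zeta> = 0}"
  have "\<alpha> s x vacuum - sign_op (flip s) (\<alpha> s x vacuum) \<in> N"
    unfolding N_def mem_Collect_eq
  proof (intro ballI)
    fix hs gs :: "(real \<Rightarrow> 'k) list"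
    assume hs: "hs \<in> lists square_integrable" and gs: "gs \<in> lists (supported_before s)"
    define \<phi> where "\<phi> = clifford_product (map (shift s) hs) (clifford_product gs vacuum)"
    have \<phi>: "sign_op (flip s) \<phi> = (-1) ^ length gs *\<^sub>R \<phi>"
      unfolding \<phi>_def by (rule flip_product[OF s hs gs])
    \<comment> \<open>The fields are self-adjoint, so the late ones move to the other side in
      reversed order, where they form alpha_s of a product and are absorbed into
      \<open>x\<close>.\<close>
    have "cinner \<phi> (\<alpha> s x vacuum) = 0" if "odd (length gs)"
    proof -
      have r: "rev hs \<in> lists square_integrable" using hs by auto
      have "cinner \<phi> (\<alpha> s x vacuum) = cinner (clifford_product gs vacuum) (clifford_product (map (shift s) (rev hs)) (\<alpha> s x vacuum))"
        unfolding \<phi>_def cinner_clifford_product[OF shift_lists[OF s hs]] by (simp add: rev_map)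
      also have "\<dots> = cinner (clifford_product gs vacuum) (\<alpha> s (clifford_product (rev hs) \<circ> x) vacuum)"
        by (simp add: \<alpha>_compose[OF s clifford_product_algebra[OF r] x] \<alpha>_product[OF s r])
      also have "\<dots> = 0"
        by (rule odd_product_orthogonal[OF s gs that clifford_algebra_compose[OF clifford_product_algebra[OF r] x]])
      finally show ?thesis .
    qed
    then have "cinner \<phi> (\<alpha> s x vacuum) - cinner (sign_op (flip s) \<phi>) (\<alpha> s x vacuum) = 0"
      unfolding \<phi> by (cases "even (length gs)") (simp_all add: cinner_minus_left)
    then show "cinner (clifford_product (map (shift s) hs) (clifford_product gs vacuum))
        (\<alpha> s x vacuum - sign_op (flip s) (\<alpha> s x vacuum)) = 0"
      unfolding \<phi>_def[symmetric] cinner_diff_right cinner_sign_op[OF m, symmetric] .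
  qed
  then have "\<alpha> s x vacuum - sign_op (flip s) (\<alpha> s x vacuum) = 0"
  proof (rule cyclic_orthogonal[rotated 2])
    fix \<zeta> assume \<zeta>: "\<zeta> \<in> N"
    then have \<zeta>0: "cinner (clifford_product (map (shift s) hs) (clifford_product gs vacuum)) \<zeta> = 0"
      if "hs \<in> lists square_integrable" "gs \<in> lists (supported_before s)" for hs gs
      using that by (simp add: N_def)
    show "cinner vacuum \<zeta> = 0" using \<zeta>0[of "[]" "[]"] by simp
    fix f :: "real \<Rightarrow> 'k" assume f: "f \<in> square_integrable"
    \<comment> \<open>Splitting at time \<open>s\<close> shows that \<open>N\<close> is invariant:
      the late part prolongs \<open>hs\<close>, and the early part passes \<open>hs\<close> up to a
      sign and prolongs \<open>gs\<close>.\<close>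
    define f1 where "f1 = (\<lambda>t. (if t < s then 1 else 0) *\<^sub>R f t)"
    define h where "h = (\<lambda>t. f (t + s))"
    have f1: "f1 \<in> square_integrable"
      unfolding f1_def by (rule square_integrable_mult[OF f]) auto
    then have f1s: "f1 \<in> supported_before s" by (simp add: supported_before_def f1_def)
    have h: "h \<in> square_integrable" unfolding h_def by (rule square_integrable_unshift[OF f s])
    note sh = square_integrable_shift[OF h s]
    have ff: "f = (\<lambda>t. f1 t + shift s h t)" by (auto simp: fun_eq_iff f1_def h_def shift_def)
    show "clifford_field f \<zeta> \<in> N"
      unfolding N_def mem_Collect_eq
    proof (intro ballI)
      fix hs gs :: "(real \<Rightarrow> 'k) list"
      assume hs: "hs \<in> lists square_integrable" and gs: "gs \<in> lists (supported_before s)"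
      let ?\<phi> = "clifford_product (map (shift s) hs) (clifford_product gs vacuum)"
      have "cinner ?\<phi> (clifford_field f \<zeta>) = cinner (clifford_field f ?\<phi>) \<zeta>"
        by (rule cinner_clifford_field[OF f, symmetric])
      also have "clifford_field f ?\<phi> = clifford_field f1 ?\<phi> + clifford_field (shift s h) ?\<phi>"
        by (subst ff) (rule clifford_field_add[OF f1 sh])
      also have "clifford_field (shift s h) ?\<phi> = clifford_product (map (shift s) (h # hs)) (clifford_product gs vacuum)"
        by simp
      also have "clifford_field f1 ?\<phi> = (-1) ^ length hs *\<^sub>R clifford_product (map (shift s) hs) (clifford_product (f1 # gs) vacuum)"
        using clifford_field_product_shift[OF s f1s hs] by simp
      finally show "cinner ?\<phi> (clifford_field f \<zeta>) = 0"
        using \<zeta>0[of "h # hs" gs] \<zeta>0[of hs "f1 # gs"] h hs gs f1s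
        by (simp only: cinner_add_left cinner_scaleR_left lists.Cons) simp
    qed
  qed
  then show ?thesis by simp
qed

end

section \<open>Gauge cocycles of the Clifford flow are scalar\<close>

text \<open>A truncated square wave written as a finite product of sign changes, so that invariance
  under each of them carries over. The index starts at 1 because the wave equals 1 on [0, d); after
  \<open>real n * d\<close> the function is constant and no longer follows the wave.\<close>

definition step :: "real \<Rightarrow> nat \<Rightarrow> real \<Rightarrow> real" where
  "step d n t = (\<Prod>j\<in>{1..<n}. if t < real j * d then 1 else - 1)"

lemma sign_function_step: "sign_function (step d n)"
proof -
  have "(\<lambda>t. step d n t) \<in> borel_measurable borel" unfolding step_def by measurable
  moreover have "step d n t * step d n t = 1" for t
    unfolding step_def prod.distrib[symmetric] by (rule prod.neutral) simp
  ultimately show ?thesis by (simp add: sign_function_def)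
qed

lemma step_eq_wave:
  assumes d: "d > 0" and t: "0 \<le> t" "t < real n * d"
  shows "step d n t = wave d t"
proof -
  define k where "k = nat \<lfloor>t / d\<rfloor>"
  have k: "\<lfloor>t / d\<rfloor> = int k" using d t by (simp add: k_def)
  have "real_of_int \<lfloor>t / d\<rfloor> \<le> t / d" "t / d < real_of_int \<lfloor>t / d\<rfloor> + 1" by linarith+
  then have kd: "real k \<le> t / d" "t / d < real k + 1" unfolding k by simp_all
  have iff: "real j * d \<le> t \<longleftrightarrow> j \<le> k" for j
  proof -
    have "real j * d \<le> t \<longleftrightarrow> real j \<le> t / d" using d by (simp add: field_simps)
    also have "\<dots> \<longleftrightarrow> j \<le> k" using kd by linarith
    finally show ?thesis .
  qed
  have "t / d < real n" using d t by (simp add: field_simps)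
  then have "k < n" using kd by linarith
  then have "{1..<n} \<inter> {j. real j * d \<le> t} = {1..k}" unfolding iff by auto
  then have "(\<Prod>j\<in>{1..<n}. if real j * d \<le> t then - 1 else 1 :: real) = (-1) ^ k"
    by (simp add: prod.If_cases)
  moreover have "(if t < real j * d then 1 else - 1 :: real) = (if real j * d \<le> t then - 1 else 1)" for j
    by simp
  ultimately have "step d n t = (-1) ^ k" unfolding step_def by simp
  then show ?thesis by (simp add: wave_def k minus_one_power_iff)
qed

lemma l2_inner_cong:
  assumes "\<And>t. t \<ge> 0 \<Longrightarrow> f t = f' t"
  shows "l2_inner f g = l2_inner f' g"
  unfolding l2_inner_def by (rule Bochner_Integration.integral_cong) (simp_all add: assms)

text \<open>The products of the indicator of \<open>[0, T)\<close> with the square waves of period \<open>2 T / n\<close> converge weakly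
  to zero, and so do the vectors obtained by applying them to all the factors of a nontrivial wedge.\<close>

lemma step_invariant_imp_vacuum_multiple:
  fixes \<xi> :: "'k::{real_inner, banach, second_countable_topology} fock"
  assumes T: "T > 0"
    and ind: "multiplier_invariant (\<lambda>t. if t < T then 1 else 0) \<xi>"
    and inv: "\<And>n. multiplier_invariant (step (T / real (Suc n)) (Suc n)) \<xi>"
  shows "\<xi> = cinner vacuum \<xi> *\<^sub>C vacuum"
proof (rule fock_eqI)
  fix fs :: "(real \<Rightarrow> 'k \<times> 'k) list" assume fs: "fs \<in> lists square_integrable"
  show "cinner (wedge fs) \<xi> = cinner (wedge fs) (cinner vacuum \<xi> *\<^sub>C vacuum)"
  proof (cases "fs = []")
    case True
    then show ?thesis by (simp add: cinner_scaleC_right)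
  next
    case False
    \<comment> \<open>The cut-off confines all factors to [0, T), where \<open>step\<close>
      coincides with the wave; after \<open>T\<close> both sides of the comparison below are
      zero.\<close>
    define b :: "real \<Rightarrow> real" where "b = (\<lambda>t. if t < T then 1 else 0)"
    define fs' where "fs' = map (\<lambda>f t. b t *\<^sub>R f t) fs"
    define m where "m = (\<lambda>n. step (T / real (Suc n)) (Suc n))"
    define w where "w = (\<lambda>n. wedge (map (\<lambda>f t. m n t *\<^sub>R f t) fs') :: 'k fock)"
    have m: "sign_function (m n)" for n unfolding m_def by (rule sign_function_step)
    have bm: "b \<in> borel_measurable borel" "\<And>t. \<bar>b t\<bar> \<le> 1" by (simp_all add: b_def)
    have fs': "fs' \<in> lists square_integrable"
      unfolding fs'_def using fs by (induction fs) (auto intro!: square_integrable_mult bm)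
    have w: "w n = sign_op (m n) (wedge fs')" for n
      unfolding w_def by (rule sign_op_wedge[OF m fs', symmetric])
    have nw: "norm (w n) \<le> norm (wedge fs' :: 'k fock)" for n
      unfolding w by (rule norm_sign_op[OF m])
    have weak: "(\<lambda>n. cinner (w n) (wedge gs)) \<longlonglongrightarrow> 0"
      if gs: "gs \<in> lists square_integrable" for gs :: "(real \<Rightarrow> 'k \<times> 'k) list"
    proof -
      have e: "cinner (w n) (wedge gs) = wedge_inner (map (\<lambda>f t. m n t *\<^sub>R f t) fs') gs" for n
        unfolding w_def by (rule cinner_wedge[OF map_sign_lists[OF m fs'] gs])
      show ?thesis
      proof (cases "length gs = length fs'")
        case True
        have "(\<lambda>n. \<Sum>p | p permutes {..<length fs'}. of_int (sign p) *
            (\<Prod>i<length fs'. l2_inner (\<lambda>t. m n t *\<^sub>R (fs' ! i) t) (gs ! p i))) \<longlonglongrightarrow> 0"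
        proof (rule tendsto_null_sum)
          fix p assume "p \<in> {p. p permutes {..<length fs'}}"
          then have p: "p i < length fs'" if "i < length fs'" for i
            using permutes_in_image[of p "{..<length fs'}" i] that by simp
          have l: "(\<lambda>n. l2_inner (\<lambda>t. m n t *\<^sub>R (fs' ! i) t) (gs ! p i)) \<longlonglongrightarrow> 0"
            if i: "i \<in> {..<length fs'}" for i
          proof -
            have i': "i < length fs" using i by (simp add: fs'_def)
            have "gs ! p i \<in> square_integrable" "fs' ! i \<in> square_integrable"
              using gs fs' i p[of i] True by (auto simp: in_lists_conv_set)
            moreover have "(\<lambda>n. T / real (Suc n)) \<longlonglongrightarrow> T * 0"
              unfolding divide_inverse by (intro tendsto_mult_left LIMSEQ_inverse_real_of_nat)
            ultimately have "(\<lambda>n. l2_inner (\<lambda>t. wave (T / real (Suc n)) t *\<^sub>R (fs' ! i) t) (gs ! p i)) \<longlonglongrightarrow> 0"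
              using T by (intro l2_inner_wave_tendsto) auto
            moreover have "l2_inner (\<lambda>t. m n t *\<^sub>R (fs' ! i) t) (gs ! p i)
                = l2_inner (\<lambda>t. wave (T / real (Suc n)) t *\<^sub>R (fs' ! i) t) (gs ! p i)" for n
            proof (rule l2_inner_cong)
              fix t :: real assume "t \<ge> 0"
              then show "m n t *\<^sub>R (fs' ! i) t = wave (T / real (Suc n)) t *\<^sub>R (fs' ! i) t"
                using step_eq_wave[of "T / real (Suc n)" t "Suc n"] T i'
                by (cases "t < T") (simp_all add: m_def fs'_def b_def del: of_nat_Suc)
            qed
            ultimately show ?thesis by simp
          qed
          have "(\<lambda>n. \<Prod>i<length fs'. l2_inner (\<lambda>t. m n t *\<^sub>R (fs' ! i) t) (gs ! p i)) \<longlonglongrightarrow> (\<Prod>i<length fs'. 0)"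
            by (rule tendsto_prod) (rule l)
          \<comment> \<open>A nontrivial wedge has at least one factor; an empty product would leave
            the limit 1.\<close>
          moreover have "(\<Prod>i<length fs'. 0 :: complex) = 0" using False by (simp add: fs'_def)
          ultimately show "(\<lambda>n. of_int (sign p) * (\<Prod>i<length fs'. l2_inner (\<lambda>t. m n t *\<^sub>R (fs' ! i) t) (gs ! p i))) \<longlonglongrightarrow> 0"
            by (intro tendsto_mult_right_zero) (simp only:)
        qed
        then show ?thesis unfolding e using True by (simp add: wedge_inner_def)
      next
        case False
        then show ?thesis unfolding e by (simp add: wedge_inner_def)
      qed
    qed
    \<comment> \<open>The \<open>w n\<close> are bounded by the norm of the cut-off wedge, so
      convergence against wedges extends to \<open>\<xi>\<close>.\<close>
    have "closed {\<zeta>. (\<lambda>n. cinner (w n) \<zeta>) \<longlonglongrightarrow> 0}"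
    proof (rule closed_null_set[where C = "norm (wedge fs' :: 'k fock)"])
      fix n \<zeta>
      show "norm (cinner (w n) \<zeta>) \<le> norm (wedge fs' :: 'k fock) * norm \<zeta>"
        by (rule order_trans[OF cinner_Cauchy_Schwarz mult_right_mono[OF nw]]) simp
    qed (simp add: cinner_diff_right)
    then have "{\<zeta>. (\<lambda>n. cinner (w n) \<zeta>) \<longlonglongrightarrow> 0} = UNIV"
      by (rule closed_subspace_eq_UNIV)
        (auto simp: cinner_add_right cinner_scaleC_right weak intro: tendsto_add_zero tendsto_mult_right_zero)
    then have "(\<lambda>n. cinner (w n) \<xi>) \<longlonglongrightarrow> 0" by blast
    moreover have "cinner (w n) \<xi> = cinner (wedge fs) \<xi>" for n
    proof -
      have "cinner (w n) \<xi> = cinner (wedge fs') \<xi>"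
        using inv[of n] fs' unfolding w_def m_def multiplier_invariant_def by blast
      also have "\<dots> = cinner (wedge fs) \<xi>"
        using ind fs unfolding fs'_def b_def multiplier_invariant_def by blast
      finally show ?thesis .
    qed
    ultimately have "cinner (wedge fs) \<xi> = 0" by (simp add: LIMSEQ_const_iff)
    moreover have "cinner (wedge fs) vacuum = 0"
      using False fs by (simp add: cinner_wedge wedge_inner_def)
    ultimately show ?thesis by (simp add: cinner_scaleC_right)
  qed
qed

lemma multiplier_invariant_prod:
  assumes "finite J" "\<And>j. j \<in> J \<Longrightarrow> multiplier_invariant (m j) \<xi>"
  shows "multiplier_invariant (\<lambda>t. \<Prod>j\<in>J. m j t) \<xi>"
  using assms
proof (induction J rule: finite_induct)
  case empty
  show ?case by (simp add: multiplier_invariant_def)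
next
  case (insert j J)
  then show ?case by (simp add: multiplier_invariant_mult)
qed

context clifford_flow_locale
begin

context
  fixes U :: "real \<Rightarrow> 'k fock \<Rightarrow> 'k fock"
  assumes U: "U \<in> gauge_group clifford_algebra \<alpha>"
begin

lemma cocycle: "U \<in> cocycles clifford_algebra \<alpha>"
  using U by (simp add: gauge_group_def)

lemma cocycle_algebra: "t \<ge> 0 \<Longrightarrow> U t \<in> clifford_algebra"
  and cocycle_unitary: "t \<ge> 0 \<Longrightarrow> unitary (U t)"
  and cocycle_continuous: "continuous_on {0..} (\<lambda>t. U t v)"
  and cocycle_identity: "s \<ge> 0 \<Longrightarrow> t \<ge> 0 \<Longrightarrow> U (s + t) = U s \<circ> \<alpha> s (U t)"
  using cocycle by (auto simp: cocycles_def)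

lemma gauge_commute:
  assumes t: "t \<ge> 0" and F: "F \<in> square_integrable" "\<And>s. s < t \<Longrightarrow> F s = 0"
  shows "U t (clifford_field F \<psi>) = clifford_field F (U t \<psi>)"
proof -
  note h = square_integrable_unshift[OF F(1) t]
  have "shift t (\<lambda>s. F (s + t)) = F" by (rule shift_unshift) (rule F(2))
  then have "clifford_field F = \<alpha> t (clifford_field (\<lambda>s. F (s + t)))"
    unfolding \<alpha>_field[OF t h] by simp
  then have "clifford_field F \<in> \<alpha> t ` clifford_algebra" using clifford_field_algebra[OF h] by blast
  moreover have "U t \<in> commutant (\<alpha> t ` clifford_algebra)" using U t by (simp add: gauge_group_def)
  ultimately show ?thesis unfolding commutant_iff by blast
qed

lemma gauge_parity: "t \<ge> 0 \<Longrightarrow> parity (U t vacuum) = U t vacuum"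
  by (rule relative_commutant_vacuum(1)[OF _ e cocycle_algebra gauge_commute]) auto

lemma gauge_outside:
  assumes "t \<ge> 0" "m \<in> borel_measurable borel" "\<And>s. \<bar>m s\<bar> \<le> 1" "\<And>s. s < t \<Longrightarrow> m s = 1"
  shows "multiplier_invariant m (U t vacuum)"
  by (rule multiplier_invariant_outside[OF assms(2,3,4)],
      simp, rule relative_commutant_vacuum(2)[OF assms(1) e cocycle_algebra[OF assms(1)] gauge_commute[OF assms(1)]])

lemma gauge_minus_one: "t \<ge> 0 \<Longrightarrow> multiplier_invariant (\<lambda>_. - 1) (U t vacuum)"
  using gauge_parity[of t] by (simp add: multiplier_invariant_sign_op)

text \<open>\<open>U s vacuum\<close> is even and has no particles after \<open>s\<close>, so the
  flip fixes it. Conjugation by the flip stays in the algebra and fixes the vacuum, so it fixes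
  \<open>U s\<close>, as the vacuum is separating.\<close>

lemma gauge_flip_conj:
  assumes s: "s \<ge> 0"
  shows "sign_op (flip s) (U s \<psi>) = U s (sign_op (flip s) \<psi>)"
proof -
  note m = sign_function_flip[of s]
  have "multiplier_invariant (flip s) (U s vacuum)"
    unfolding flip_eq by (intro multiplier_invariant_mult gauge_minus_one gauge_outside s) auto
  then have "sign_op (flip s) (U s vacuum) = U s vacuum"
    by (simp add: multiplier_invariant_sign_op[OF m])
  then have "(\<lambda>\<psi>. sign_op (flip s) (U s (sign_op (flip s) \<psi>))) = U s"
    by (intro algebra_eqI sign_op_conj_algebra m cocycle_algebra s) (simp add: sign_op_Nil[OF m])
  from fun_cong[OF this, of "sign_op (flip s) \<psi>"] show ?thesis by (simp add: sign_op_involution[OF m])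
qed

text \<open>In \<open>U s \<circ> \<alpha> s (U (T - s))\<close> the flip commutes with the first
  factor, and by \<open>flip_range\<close> it fixes the vector that the second makes of the
  vacuum.\<close>

lemma gauge_flip:
  assumes s: "0 \<le> s" "s \<le> T"
  shows "multiplier_invariant (flip s) (U T vacuum)"
proof -
  have "U T = U s \<circ> \<alpha> s (U (T - s))" using cocycle_identity[of s "T - s"] s by simp
  then have "sign_op (flip s) (U T vacuum) = U T vacuum"
    using s by (simp add: gauge_flip_conj flip_range cocycle_algebra)
  then show ?thesis by (simp add: multiplier_invariant_sign_op[OF sign_function_flip])
qed

lemma gauge_scalar_pos:
  assumes T: "T > 0"
  shows "U T = (\<lambda>\<psi>. cinner vacuum (U T vacuum) *\<^sub>C \<psi>)"
proof -
  have "multiplier_invariant (step (T / real (Suc n)) (Suc n)) (U T vacuum)" for n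
  proof -
    \<comment> \<open>The factors of \<open>step\<close> are negated flips, and the global sign is
      absorbed by evenness. All break points lie in [0, T], as \<open>gauge_flip\<close>
      demands.\<close>
    have *: "multiplier_invariant (\<lambda>t. if t < s then 1 else - 1) (U T vacuum)" if "0 \<le> s" "s \<le> T" for s
    proof -
      have "(\<lambda>t. if t < s then 1 else - 1) = (\<lambda>t. flip s t * (- 1))" by (auto simp: flip_def fun_eq_iff)
      then show ?thesis
        using multiplier_invariant_mult[OF gauge_flip[OF that] gauge_minus_one[of T]] T by simp
    qed
    have "real j * (T / real (Suc n)) \<le> T" if "j \<in> {1..<Suc n}" for j
    proof -
      have "real j * T \<le> real (Suc n) * T" using that T by (intro mult_right_mono) auto
      then show ?thesis by (simp add: field_simps del: of_nat_Suc)
    qed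
    then show ?thesis
      unfolding step_def[abs_def] using T
      by (intro multiplier_invariant_prod *) (auto simp del: of_nat_Suc)
  qed
  moreover have "multiplier_invariant (\<lambda>t. if t < T then 1 else 0) (U T vacuum)"
    using T by (intro gauge_outside) auto
  ultimately have "U T vacuum = cinner vacuum (U T vacuum) *\<^sub>C vacuum"
    by (intro step_invariant_imp_vacuum_multiple[OF T])
  then show ?thesis
    using T clifford_algebra_scaleC[OF clifford_algebra_id]
    by (intro algebra_eqI cocycle_algebra) auto
qed

text \<open>The weak limit argument needs a positive time; at time 0 the cocycle identity makes
  \<open>U 0\<close> an idempotent, which unitarity turns into the identity.\<close>

lemma cocycle_zero: "U 0 = id"
proof -
  have "\<alpha> 0 (U 0) = U 0" using E0 cocycle_algebra[of 0] by (simp add: E0_semigroup_def)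
  then have UU: "U 0 \<circ> U 0 = U 0" using cocycle_identity[of 0 0] by simp
  have a: "adj (U 0) \<circ> U 0 = id" using cocycle_unitary[of 0] by (simp add: unitary_def)
  have "U 0 = (adj (U 0) \<circ> U 0) \<circ> U 0" by (simp add: a)
  also have "\<dots> = adj (U 0) \<circ> U 0" by (simp add: o_assoc[symmetric] UU)
  finally show ?thesis by (simp add: a)
qed

definition phase :: "real \<Rightarrow> complex" where
  "phase t = cinner vacuum (U t vacuum)"

lemma gauge_scalar: "t \<ge> 0 \<Longrightarrow> U t = (\<lambda>\<psi>. phase t *\<^sub>C \<psi>)"
  using gauge_scalar_pos[of t] cocycle_zero by (cases "t = 0") (auto simp: phase_def)

lemma phase_zero: "phase 0 = 1"
  by (simp add: phase_def cocycle_zero)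

lemma phase_add:
  assumes "s \<ge> 0" "t \<ge> 0"
  shows "phase (s + t) = phase s * phase t"
proof -
  have "\<alpha> s (U t) = (\<lambda>\<psi>. phase t *\<^sub>C \<psi>)"
    using \<alpha>_scaleC[OF assms(1) clifford_algebra_id, of "phase t"]
    by (simp add: gauge_scalar[OF assms(2)] \<alpha>_id[OF assms(1)])
  then have "U (s + t) vacuum = (phase s * phase t) *\<^sub>C vacuum"
    using cocycle_identity[OF assms] by (simp add: gauge_scalar[OF assms(1)] scaleC_scaleC)
  then show ?thesis unfolding phase_def[of "s + t"] by (simp add: cinner_scaleC_right)
qed

lemma phase_continuous: "continuous_on {0..} phase"
  unfolding phase_def[abs_def]
  by (intro bounded_bilinear.continuous_on[OF bounded_bilinear_cinner] continuous_on_const cocycle_continuous)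

end

end

section \<open>Continuous multiplicative functions on the half line\<close>

text \<open>Smoothing gives differentiability: for the primitive \<open>F\<close>, multiplicativity
  yields \<open>c t * F h = F (t + h) - F t\<close>, whose right side is differentiable in
  \<open>t\<close>. The result is the equation c' = a c.\<close>

lemma multiplicative_eq_exp:
  fixes c :: "real \<Rightarrow> complex"
  assumes cont: "continuous_on {0..} c" and c0: "c 0 = 1"
    and mult: "\<And>s t. s \<ge> 0 \<Longrightarrow> t \<ge> 0 \<Longrightarrow> c (s + t) = c s * c t"
  shows "\<exists>a. \<forall>t\<ge>0. c t = exp (a * of_real t)"
proof -
  define F where "F = (\<lambda>t. integral {0..t} c)"
  have cB: "continuous_on {a..b} c" if "0 \<le> a" for a b
    by (rule continuous_on_subset[OF cont]) (use that in auto)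
  have F': "(F has_vector_derivative c t) (at t within {0..B})" if "t \<in> {0..B}" for t B
    unfolding F_def by (rule integral_has_vector_derivative[OF cB that]) simp
  \<comment> \<open>Otherwise the derivative of \<open>F\<close> at 0, which is
    \<open>c 0 = 1\<close>, would be 0.\<close>
  have "\<exists>h\<ge>0. F h \<noteq> 0"
  proof (rule ccontr)
    assume "\<not> (\<exists>h\<ge>0. F h \<noteq> 0)"
    then have z: "F t = 0" if "t \<ge> 0" for t using that by blast
    have "(F has_vector_derivative 0) (at 0 within {0..1})"
      by (rule has_vector_derivative_transform[of 0 "{0..1}" _ "\<lambda>_. 0"]) (auto simp: z)
    then have "c 0 = 0"
      using F'[of 0 1] by (intro vector_derivative_unique_within_closed_interval[of 0 1 0 F]) auto
    then show False using c0 by simp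
  qed
  then obtain h where h: "h \<ge> 0" "F h \<noteq> 0" by blast
  have diff: "c t * F h = F (t + h) - F t" if t: "t \<ge> 0" for t
  proof -
    have "c t * F h = integral {0..h} (\<lambda>s. c t * c s)"
      unfolding F_def by simp
    also have "\<dots> = integral {0..h} (c \<circ> (+) t)"
      using t by (intro integral_cong) (simp add: mult)
    also have "\<dots> = integral {0 + t..h + t} c" by (rule integral_shift_Icc_real)
    finally have "c t * F h = integral {t..t + h} c" by (simp add: add.commute)
    moreover have "integral {0..t} c + integral {t..t + h} c = integral {0..t + h} c"
      by (rule Henstock_Kurzweil_Integration.integral_combine)
        (use t h in \<open>auto intro!: integrable_continuous_real cB\<close>)
    ultimately show ?thesis unfolding F_def by (metis add_diff_cancel_left')
  qed
  define a where "a = (c h - 1) / F h"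
  have c': "(c has_vector_derivative a * c t) (at t within {0..B})" if t: "t \<in> {0..B}" for t B
  proof -
    have "((\<lambda>u. u + h) has_vector_derivative 1) (at t within {0..B})"
      by (auto intro!: derivative_eq_intros)
    moreover have "(F has_vector_derivative c (t + h)) (at (t + h) within (\<lambda>u. u + h) ` {0..B})"
      by (rule has_vector_derivative_within_subset[OF F'[of "t + h" "B + h"]]) (use t h in auto)
    ultimately have "((F \<circ> (\<lambda>u. u + h)) has_vector_derivative 1 *\<^sub>R c (t + h)) (at t within {0..B})"
      by (rule vector_diff_chain_within)
    then have "((\<lambda>u. (F (u + h) - F u) / F h) has_vector_derivative (c (t + h) - c t) / F h) (at t within {0..B})"
      unfolding o_def by (intro has_vector_derivative_divide has_vector_derivative_diff F'[OF t]) simp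
    moreover have "(c (t + h) - c t) / F h = a * c t"
      using t h by (simp add: mult a_def algebra_simps)
    ultimately show ?thesis
      by (intro has_vector_derivative_transform[OF t, of c "\<lambda>u. (F (u + h) - F u) / F h"])
        (use h diff in \<open>simp_all add: field_simps\<close>)
  qed
  have "c t = exp (a * of_real t)" if t: "t \<ge> 0" for t
  proof -
    \<comment> \<open>The integrating factor makes the product constant, hence equal to its value 1
      at time 0.\<close>
    have d: "((\<lambda>u. exp (- a * of_real u) * c u) has_vector_derivative 0) (at u within {0..t})"
      if u: "u \<in> {0..t}" for u
    proof -
      have "((\<lambda>u. exp (- a * of_real u)) has_vector_derivative (- a * exp (- a * of_real u))) (at u within {0..t})"
        by (rule has_vector_derivative_real_field) (auto intro!: derivative_eq_intros)
      from has_vector_derivative_mult[OF this c'[OF u]] show ?thesis by (simp add: algebra_simps)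
    qed
    have "(\<lambda>u. exp (- a * of_real u) * c u) t = (\<lambda>u. exp (- a * of_real u) * c u) 0"
      by (rule has_derivative_zero_unique[of "{0..t}"])
        (use d t in \<open>auto simp: has_vector_derivative_def\<close>)
    then have "exp (- (a * of_real t)) * c t = 1" by (simp add: c0)
    then show ?thesis by (simp add: exp_minus field_simps)
  qed
  then show ?thesis by blast
qed

lemma exp_rate_unique:
  fixes a b :: complex
  assumes "\<And>t. t \<ge> 0 \<Longrightarrow> exp (a * of_real t) = exp (b * of_real t)"
  shows "a = b"
proof (rule ccontr)
  assume "a \<noteq> b"
  define z where "z = a - b"
  have z: "z \<noteq> 0" using \<open>a \<noteq> b\<close> by (simp add: z_def)
  \<comment> \<open>At this time \<open>z * of_real t\<close> has modulus 1: not zero, and too small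
    for a nonzero multiple of 2 pi i.\<close>
  define t where "t = 1 / cmod z"
  have t: "t \<ge> 0" by (simp add: t_def)
  have "exp (z * of_real t) = 1"
    using assms[OF t] by (simp add: z_def left_diff_distrib exp_diff)
  then obtain n :: int where n: "Re (z * of_real t) = 0" "Im (z * of_real t) = of_int (2 * n) * pi"
    unfolding exp_eq_1 by blast
  have "cmod (z * of_real t) = 1" using z by (simp add: t_def norm_mult norm_divide)
  then have 1: "\<bar>of_int (2 * n) * pi\<bar> = 1"
    using n by (simp add: cmod_eq_Im)
  then have "n \<noteq> 0" by auto
  then have "\<bar>of_int (2 * n) * pi\<bar> \<ge> 2 * pi" by (simp add: abs_mult)
  then show False using 1 pi_gt3 by linarith
qed

section \<open>The gauge index\<close>

text \<open>A basis vector would have \<open>ip x x = 1\<close>, so the empty set is the only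
  orthonormal basis; this is the uniqueness demanded by the definite description.\<close>

lemma hilbert_dim_eq_0:
  assumes "\<And>x. x \<in> H \<Longrightarrow> ip x x = 0"
  shows "hilbert_dim H ip = 0"
  unfolding hilbert_dim_def
proof (rule the_equality)
  show "\<exists>B. orthonormal_basis H ip B \<and> 0 = (if finite B then enat (card B) else \<infinity>)"
    by (rule exI[of _ "{}"]) (simp add: orthonormal_basis_def assms zero_enat_def)
  fix d assume "\<exists>B. orthonormal_basis H ip B \<and> d = (if finite B then enat (card B) else \<infinity>)"
  then obtain B where B: "orthonormal_basis H ip B" "d = (if finite B then enat (card B) else \<infinity>)" by blast
  have "B = {}"
  proof (rule ccontr)
    assume "B \<noteq> {}"
    then obtain x where "x \<in> B" by blast
    then have "ip x x = 1" "x \<in> H" using B(1) by (auto simp: orthonormal_basis_def)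
    then show False using assms[of x] by simp
  qed
  then show "d = 0" using B(2) by (simp add: zero_enat_def)
qed

text \<open>The inner product is evaluated on representatives picked by \<open>SOME\<close>. Each
  class is nonempty, as it contains the sequence defining it, and any representative takes values in
  \<open>V\<close>, where the form vanishes.\<close>

lemma hcompletion_inner_eq_0:
  assumes B: "\<And>f. f \<in> V \<Longrightarrow> B f f = 0" and B0: "B (\<lambda>_. 0) (\<lambda>_. 0) = 0"
    and X: "X \<in> hcompletion V B"
  shows "hcompletion_inner B X X = 0"
proof -
  obtain x where x: "x \<in> cauchy_seqs V B" "X = {(x, y). null_equiv V B x y} `` {x}"
    using X unfolding hcompletion_def by (rule quotientE)
  have "x n - x n = (\<lambda>_. 0)" for n by (simp add: fun_eq_iff)
  then have "x \<in> X" using x B0 by (simp add: null_equiv_def)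
  then have "(SOME x. x \<in> X) \<in> X" by (rule someI[where P = "\<lambda>x. x \<in> X"])
  moreover have "X \<subseteq> cauchy_seqs V B" using x(2) by (auto simp: null_equiv_def)
  ultimately have "(SOME x. x \<in> X) \<in> cauchy_seqs V B" by (rule subsetD[rotated])
  then have "(SOME x. x \<in> X) n \<in> V" for n by (simp add: cauchy_seqs_def)
  then show ?thesis unfolding hcompletion_inner_def by (simp add: B)
qed

theorem proposition7p6:
  fixes \<alpha> :: "real \<Rightarrow> ('k::{real_inner, banach, second_countable_topology} fock \<Rightarrow> 'k fock) \<Rightarrow>
                 ('k fock \<Rightarrow> 'k fock)"
    and n :: enat
  assumes "1 \<le> n" and "hilbert_dim (UNIV :: 'k set) inner = n"
    and "clifford_flow \<alpha>"
  shows "gauge_index clifford_algebra vacuum_trace \<alpha> = 0"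
proof -
  \<comment> \<open>Over the zero space the dimension would be 0, so positive rank yields a nonzero
    vector.\<close>
  have "\<exists>e :: 'k. e \<noteq> 0"
  proof (rule ccontr)
    assume "\<not> (\<exists>e :: 'k. e \<noteq> 0)"
    then have "inner x x = 0" for x :: 'k by simp
    then have "hilbert_dim (UNIV :: 'k set) inner = 0" by (intro hilbert_dim_eq_0)
    then show False using assms by simp
  qed
  then obtain e :: 'k where "e \<noteq> 0" by blast
  then interpret clifford_flow_locale \<alpha> e using assms(3) by unfold_locales
  let ?G = "gauge_group clifford_algebra \<alpha>"
  have "\<exists>a. \<forall>t\<ge>0. U t = (\<lambda>\<psi>. exp (a * of_real t) *\<^sub>C \<psi>)" if U: "U \<in> ?G" for U
    using multiplicative_eq_exp[OF phase_continuous[OF U] phase_zero[OF U] phase_add[OF U]]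
      gauge_scalar[OF U] by fastforce
  then obtain a where a: "\<And>U t. U \<in> ?G \<Longrightarrow> t \<ge> 0 \<Longrightarrow> U t = (\<lambda>\<psi>. exp (a U * of_real t) *\<^sub>C \<psi>)" by metis
  have c_star: "c_star vacuum_trace U V = cnj (a U) + a V" if U: "U \<in> ?G" and V: "V \<in> ?G" for U V
  proof -
    have tr: "vacuum_trace (adj (U t) \<circ> V t) = exp ((cnj (a U) + a V) * of_real t)" if t: "t \<ge> 0" for t
    proof -
      have "adj (U t) = (\<lambda>\<psi>. cnj (exp (a U * of_real t)) *\<^sub>C \<psi>)"
        by (rule adj_eqI) (simp add: a[OF U t] cinner_simps)
      then have "vacuum_trace (adj (U t) \<circ> V t) = cnj (exp (a U * of_real t)) * exp (a V * of_real t)"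
        unfolding vacuum_trace_def o_apply a[OF V t] by (simp only: cinner_scaleC_right cinner_vacuum mult_1_right)
      also have "\<dots> = exp ((cnj (a U) + a V) * of_real t)"
        unfolding exp_cnj distrib_right exp_add by simp
      finally show ?thesis .
    qed
    show ?thesis
      unfolding c_star_def
    proof (rule the_equality)
      show "\<forall>t\<ge>0. vacuum_trace (adj (U t) \<circ> V t) = exp ((cnj (a U) + a V) * complex_of_real t)"
        by (intro allI impI tr)
      fix c assume c: "\<forall>t\<ge>0. vacuum_trace (adj (U t) \<circ> V t) = exp (c * complex_of_real t)"
      show "c = cnj (a U) + a V"
      proof (rule exp_rate_unique)
        fix t :: real assume t: "t \<ge> 0"
        then have "vacuum_trace (adj (U t) \<circ> V t) = exp (c * complex_of_real t)" using c by blast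
        then show "exp (c * of_real t) = exp ((cnj (a U) + a V) * of_real t)" unfolding tr[OF t] by (rule sym)
      qed
    qed
  qed
  have "kernel_form (c_star vacuum_trace) f f = 0" if f: "f \<in> zero_sum_functions ?G" for f
  proof -
    define A where "A = {U. f U \<noteq> 0}"
    have A: "A \<subseteq> ?G" and f0: "(\<Sum>U\<in>A. f U) = 0"
      using f by (auto simp: zero_sum_functions_def finsupp_def A_def)
    have "kernel_form (c_star vacuum_trace) f f = (\<Sum>U\<in>A. \<Sum>V\<in>A. (cnj (a U) * cnj (f U)) * f V + cnj (f U) * (a V * f V))"
      unfolding kernel_form_def A_def[symmetric]
      using A by (intro sum.cong refl) (auto simp: c_star algebra_simps subset_eq)
    also have "\<dots> = (\<Sum>U\<in>A. cnj (a U) * cnj (f U)) * (\<Sum>V\<in>A. f V) + cnj (\<Sum>U\<in>A. f U) * (\<Sum>V\<in>A. a V * f V)"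
      by (simp add: sum.distrib sum_product)
    finally show ?thesis by (simp add: f0)
  qed
  then show ?thesis
    unfolding gauge_index_def
    by (intro hilbert_dim_eq_0 hcompletion_inner_eq_0) (auto simp: kernel_form_def)
qed

end
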